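(* For an alphabet with $|\Sigma|\ge\Omega(n/d)$, any quantum algorithm that decides whether two strings $S_1,S_2\in\Sigma^n$ have a common substring of length $d$ (i.e., whether $S_1[i\,..\,i+d-1]=S_2[j\,..\,j+d-1]$ for some $i,j$) requires $\Omega(n^{2/3}/d^{1/6})$ quantum queries.
   Context: The input strings are accessed through quantum oracles $O_S\colon|i,b\rangle\mapsto|i,b\oplus S[i]\rangle$; query complexity is the number of oracle calls made by a bounded-error quantum algorithm. *)

theory Defs
  imports Complex_Main "Jordan_Normal_Form.Schur_Decomposition"
begin

section \<open>Common substrings\<close>

definition strings :: "nat \<Rightarrow> 'a set \<Rightarrow> 'a list set" where
  "strings n A = {S. length S = n \<and> set S \<subseteq> A}"

definition has_common_substring :: "nat \<Rightarrow> 'a list \<Rightarrow> 'a list \<Rightarrow> bool" where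
  "has_common_substring d S\<^sub>1 S\<^sub>2 \<longleftrightarrow>
     (\<exists>i j. i + d \<le> length S\<^sub>1 \<and> j + d \<le> length S\<^sub>2 \<and>
        take d (drop i S\<^sub>1) = take d (drop j S\<^sub>2))"

section \<open>Quantum query algorithms\<close>

text \<open>Symbols are \<open>m\<close>-bit words, encoded as natural numbers below \<open>2 ^ m\<close>, so that the
  exclusive or in the oracle is the bitwise one. With a workspace of dimension \<open>w\<close>, the
  basis state \<open>|i, b, z>\<close> with \<open>i < n\<close>, \<open>b < 2 ^ m\<close>, \<open>z < w\<close> has the following index.\<close>

definition basis_index :: "nat \<Rightarrow> nat \<Rightarrow> nat \<Rightarrow> nat \<Rightarrow> nat \<Rightarrow> nat" where
  "basis_index m w i b z = (i * 2 ^ m + b) * w + z"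

text \<open>The oracle of a string, acting as the identity on the workspace (see
  \<open>oracle_mat_basis\<close> below).\<close>

definition oracle_mat :: "nat \<Rightarrow> nat \<Rightarrow> nat list \<Rightarrow> complex mat" where
  "oracle_mat m w S =
     mat (length S * 2 ^ m * w) (length S * 2 ^ m * w) (\<lambda>(r, c).
       let i = c div w div 2 ^ m; b = c div w mod 2 ^ m; z = c mod w
       in if r = basis_index m w i (Bit_Operations.xor b (S ! i)) z then 1 else 0)"

text \<open>One query to the pair \<open>(S\<^sub>1, S\<^sub>2)\<close>: an additional leading qubit selects, possibly in
  superposition, which of the two oracles is applied. Algorithms that fix or adaptively
  choose the string to be queried at each step are special cases.\<close>

definition query_mat :: "nat \<Rightarrow> nat \<Rightarrow> nat list \<Rightarrow> nat list \<Rightarrow> complex mat" where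
  "query_mat m w S\<^sub>1 S\<^sub>2 =
     (let N = length S\<^sub>1 * 2 ^ m * w; M = length S\<^sub>2 * 2 ^ m * w
      in four_block_mat (oracle_mat m w S\<^sub>1) (0\<^sub>m N M) (0\<^sub>m M N) (oracle_mat m w S\<^sub>2))"

definition unitary_mat :: "nat \<Rightarrow> complex mat \<Rightarrow> bool" where
  "unitary_mat N U \<longleftrightarrow>
     U \<in> carrier_mat N N \<and> mat_adjoint U * U = 1\<^sub>m N \<and> U * mat_adjoint U = 1\<^sub>m N"

text \<open>\<open>gate t\<close> is the input-independent unitary applied after the \<open>t\<close>-th query. At the end the
  state is measured in the computational basis, and the algorithm answers yes iff the
  outcome lies in \<open>accepting\<close>. Intermediate measurements are covered by deferring them.\<close>

record query_algorithm =
  workspace_dim :: nat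
  num_queries :: nat
  gate :: "nat \<Rightarrow> complex mat"
  accepting :: "nat set"

definition state_dim :: "nat \<Rightarrow> nat \<Rightarrow> query_algorithm \<Rightarrow> nat" where
  "state_dim n m alg = 2 * (n * 2 ^ m * workspace_dim alg)"

definition valid_algorithm :: "nat \<Rightarrow> nat \<Rightarrow> query_algorithm \<Rightarrow> bool" where
  "valid_algorithm n m alg \<longleftrightarrow>
     workspace_dim alg > 0 \<and> (\<forall>t \<le> num_queries alg. unitary_mat (state_dim n m alg) (gate alg t))"

fun state_after ::
    "nat \<Rightarrow> nat \<Rightarrow> query_algorithm \<Rightarrow> nat list \<Rightarrow> nat list \<Rightarrow> nat \<Rightarrow> complex vec" where
  "state_after n m alg S\<^sub>1 S\<^sub>2 0 = gate alg 0 *\<^sub>v unit_vec (state_dim n m alg) 0"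
| "state_after n m alg S\<^sub>1 S\<^sub>2 (Suc t) =
     gate alg (Suc t) *\<^sub>v (query_mat m (workspace_dim alg) S\<^sub>1 S\<^sub>2 *\<^sub>v state_after n m alg S\<^sub>1 S\<^sub>2 t)"

definition accept_prob ::
    "nat \<Rightarrow> nat \<Rightarrow> query_algorithm \<Rightarrow> nat list \<Rightarrow> nat list \<Rightarrow> real" where
  "accept_prob n m alg S\<^sub>1 S\<^sub>2 =
     (\<Sum>k | k \<in> accepting alg \<and> k < state_dim n m alg.
        (cmod (state_after n m alg S\<^sub>1 S\<^sub>2 (num_queries alg) $ k))\<^sup>2)"

definition decides_common_substring ::
    "nat \<Rightarrow> nat \<Rightarrow> nat \<Rightarrow> nat set \<Rightarrow> query_algorithm \<Rightarrow> bool" where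
  "decides_common_substring n d m A alg \<longleftrightarrow>
     valid_algorithm n m alg \<and>
     (\<forall>S\<^sub>1 \<in> strings n A. \<forall>S\<^sub>2 \<in> strings n A.
        (has_common_substring d S\<^sub>1 S\<^sub>2 \<longrightarrow> accept_prob n m alg S\<^sub>1 S\<^sub>2 \<ge> 2 / 3) \<and>
        (\<not> has_common_substring d S\<^sub>1 S\<^sub>2 \<longrightarrow> accept_prob n m alg S\<^sub>1 S\<^sub>2 \<le> 1 / 3))"

section \<open>Sanity checks\<close>

lemma basis_index_less:
  assumes "i < n" "b < 2 ^ m" "z < w"
  shows "basis_index m w i b z < n * 2 ^ m * w"
proof -
  have "Suc (i * 2 ^ m + b) \<le> Suc i * 2 ^ m" using assms by simp
  also have "\<dots> \<le> n * 2 ^ m" using assms by (intro mult_right_mono) auto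
  finally have "Suc (i * 2 ^ m + b) * w \<le> n * 2 ^ m * w" by (rule mult_right_mono) simp
  then show ?thesis using assms by (simp add: basis_index_def)
qed

lemma xor_less_two_power:
  fixes a b :: nat
  assumes "a < 2 ^ m" "b < 2 ^ m"
  shows "Bit_Operations.xor a b < 2 ^ m"
  using assms by (metis take_bit_nat_eq_self_iff take_bit_xor)

lemma oracle_mat_basis:
  assumes "i < length S" "b < 2 ^ m" "z < w" "S ! i < 2 ^ m"
  shows "oracle_mat m w S *\<^sub>v unit_vec (length S * 2 ^ m * w) (basis_index m w i b z) =
    unit_vec (length S * 2 ^ m * w) (basis_index m w i (Bit_Operations.xor b (S ! i)) z)"
    (is "?O *\<^sub>v unit_vec ?N ?c = unit_vec ?N ?r")
proof -
  have c: "?c < ?N" using assms by (intro basis_index_less)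
  have dec: "?c div w = i * 2 ^ m + b" "?c mod w = z"
    using assms by (simp_all add: basis_index_def)
  have dec': "(i * 2 ^ m + b) div 2 ^ m = i" "(i * 2 ^ m + b) mod 2 ^ m = b"
    using assms by simp_all
  have O: "?O \<in> carrier_mat ?N ?N" by (simp add: oracle_mat_def)
  have "?O *\<^sub>v unit_vec ?N ?c = col ?O ?c"
    using O c by (intro eq_vecI) auto
  also have "\<dots> = unit_vec ?N ?r"
    using c by (intro eq_vecI) (auto simp: oracle_mat_def dec dec' assms(2) Let_def unit_vec_def)
  finally show ?thesis .
qed

end

theory Submission
  imports Defs "HOL-Complex_Analysis.Complex_Analysis"
begin

text \<open>The hard instances compose bipartite element distinctness on \<open>N = \<Theta>(n / d)\<close> symbols per string with search: each
  string consists of \<open>N\<close> blocks of length \<open>O(d)\<close>, and a block is blank except for one symbol at a hidden address among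
  \<open>h = \<Theta>(d)\<close> positions. The strings share a substring of length \<open>d\<close> iff they share a symbol.

  The polynomial method for the composition: average over uniformly random addresses. A query finds the address
  of a block it has no information about with amplitude \<open>O(1 / sqrt h)\<close>, so the part of a \<open>T\<close>-query computation that
  depends on more than \<open>J = O(T / sqrt h)\<close> blocks has small norm. Hence the averaged acceptance probability is
  close to a sum \<open>q\<close> of functions of \<open>2 * J\<close> symbols each.

  Now draw every symbol at random: junk private to the string with probability \<open>1 - s\<close>, and each of \<open>s / x\<close> common
  values with probability \<open>x\<close>. The expectation \<open>\<Psi> s x\<close> of \<open>q\<close> has degree at most \<open>2 * J\<close> in \<open>s\<close> and in \<open>x\<close>, is bounded
  when \<open>s / x\<close> is an integer and \<open>s \<le> 1\<close>, and \<open>\<Psi> (1 / 2) x\<close> jumps between \<open>x = 0\<close> and \<open>x \<approx> 1 / N\<^sup>2\<close>. Either \<open>\<Psi> (1 / 2) x\<close>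
  is bounded for \<open>x \<le> N powr (-2 / 3)\<close>, or for some such \<open>x\<close> the polynomial \<open>s \<mapsto> \<Psi> s x\<close> is large at \<open>s = 1 / 2\<close> although it is
  bounded on the multiples of \<open>x\<close>; both force the degree to be of order \<open>N powr (2 / 3)\<close>. If \<open>n / d\<close> is bounded, search
  for a single hidden symbol gives the bound \<open>sqrt d\<close>.\<close>

section \<open>Inequalities for polynomials\<close>

text \<open>The obstacle is the small alphabet: near \<open>x = 1 / N\<^sup>2\<close> the draws
  range over order \<open>N\<^sup>2\<close> values, while only order \<open>n / d\<close> symbols
  are guaranteed. Averaging over all renamings removes it. The average depends only on which
  coordinates agree and which are junk, and \<open>2 * N\<close> coordinates show at most
  \<open>2 * N\<close> values. Sampling is therefore defined on equality patterns, which gives the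
  expectation a meaning at all real \<open>s\<close> and \<open>x\<close>. Two variables are needed
  because boundedness is known only for integer \<open>s / x\<close>; along \<open>s = 1 / 2\<close>
  alone it holds just at the isolated points \<open>x = 1 / (2 * K)\<close>. Junk lets
  \<open>s\<close> vary below 1 and puts 1 / 2 in the middle of its range; being private to a
  string, it never creates a collision. Cutting off computations with many hits changes the averaged
  acceptance probability by at most 1 / 20, so 1 / 3 and 2 / 3 become 23 / 60 and 37 / 60. Finally
  \<open>sqrt h * N powr (2 / 3)\<close> with \<open>h = \<Theta>(d)\<close> and
  \<open>N = \<Theta>(n / d)\<close> has the order
  \<open>n powr (2 / 3) / d powr (1 / 6)\<close>.\<close>

lemma norm_poly_cos_le:
  fixes p :: "real poly" and z :: complex
  assumes deg: "degree p \<le> n" and bound: "\<And>u. \<bar>u\<bar> \<le> 1 \<Longrightarrow> \<bar>poly p u\<bar> \<le> M"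
  shows "norm (poly (map_poly of_real p) (cos z)) \<le> exp (real n * \<bar>Im z\<bar>) * M"
proof -
  define P :: "complex poly" where "P = map_poly of_real p"
  \<comment> \<open>\<open>Q w = w ^ n * P ((w + 1 / w) / 2)\<close>, written without the singularity at 0\<close>
  define Q where "Q w = (\<Sum>k\<le>n. coeff P k * w ^ (n - k) * ((w\<^sup>2 + 1) / 2) ^ k)" for w :: complex
  have degP: "degree P \<le> n" using deg by (simp add: P_def degree_map_poly)
  have Q_eq: "Q w = w ^ n * poly P ((w + 1 / w) / 2)" if "w \<noteq> 0" for w
  proof -
    have "poly P x = (\<Sum>k\<le>n. coeff P k * x ^ k)" for x
      unfolding poly_altdef by (rule sum.mono_neutral_left) (use degP in \<open>auto simp: coeff_eq_0\<close>)
    moreover have "w ^ (n - k) * ((w\<^sup>2 + 1) / 2) ^ k = w ^ n * ((w + 1 / w) / 2) ^ k" if "k \<le> n" for k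
    proof -
      have "(w\<^sup>2 + 1) / 2 = w * ((w + 1 / w) / 2)"
        using \<open>w \<noteq> 0\<close> by (simp add: field_simps power2_eq_square)
      then have "((w\<^sup>2 + 1) / 2) ^ k = w ^ k * ((w + 1 / w) / 2) ^ k" by (simp only: power_mult_distrib)
      moreover have "w ^ n = w ^ (n - k) * w ^ k" using that by (simp flip: power_add)
      ultimately show ?thesis by (simp only: mult.assoc)
    qed
    ultimately show ?thesis
      unfolding Q_def by (simp add: sum_distrib_left mult.assoc) (simp add: mult.left_commute)
  qed
  \<comment> \<open>On the unit circle \<open>1 / w\<close> is the conjugate of \<open>w\<close>, so
    \<open>(w + 1 / w) / 2\<close> is a real number in [-1, 1], where \<open>p\<close> is bounded by
    \<open>M\<close>; the maximum principle carries this into the disc. A point \<open>z\<close> of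
    the upper half-plane corresponds to \<open>w = exp (\<i> * z)\<close> of modulus
    \<open>exp (- Im z)\<close>, and the lower half-plane follows because the cosine is
    even.\<close>
  have disc: "norm (Q w) \<le> M" if "norm w \<le> 1" for w
  proof (rule maximum_modulus_frontier[where S = "cball 0 1" and f = Q])
    show "Q holomorphic_on interior (cball 0 1)" "continuous_on (closure (cball 0 1)) Q"
      unfolding Q_def by (auto intro!: holomorphic_intros continuous_intros)
    fix z :: complex assume "z \<in> frontier (cball 0 1)"
    then have nz: "norm z = 1" by (simp add: frontier_cball)
    then have "z \<noteq> 0" by auto
    have "1 / z = cnj z" using nz by (metis complex_norm_square divide_self_if \<open>z \<noteq> 0\<close> nonzero_mult_div_cancel_left norm_one of_real_1 power_one)
    then have "(z + 1 / z) / 2 = of_real (Re z)" by (simp add: complex_add_cnj)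
    then have "norm (Q z) = norm (poly P (of_real (Re z)))"
      using Q_eq[OF \<open>z \<noteq> 0\<close>] nz by (simp add: norm_mult norm_power)
    also have "\<dots> = \<bar>poly p (Re z)\<bar>" unfolding P_def by simp
    also have "\<dots> \<le> M" using bound abs_Re_le_cmod[of z] nz by simp
    finally show "norm (Q z) \<le> M" .
  qed (use that in auto)
  have upper: "norm (poly P (cos z)) \<le> exp (real n * Im z) * M" if "Im z \<ge> 0" for z
  proof -
    define w where "w = exp (\<i> * z)"
    have "cos z = (w + 1 / w) / 2" by (simp add: w_def cos_exp_eq exp_minus field_simps)
    moreover have "w \<noteq> 0" by (simp add: w_def)
    ultimately have "Q w = w ^ n * poly P (cos z)" using Q_eq[of w] by metis
    moreover have nw: "norm w = exp (- Im z)" by (simp add: w_def)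
    ultimately have "exp (- Im z) ^ n * norm (poly P (cos z)) \<le> M"
      using disc[of w] that by (simp add: norm_mult norm_power)
    then show ?thesis by (simp add: exp_minus field_simps flip: exp_of_nat_mult)
  qed
  show ?thesis
  proof (cases "Im z \<ge> 0")
    case True then show ?thesis using upper[of z] by (simp add: P_def)
  next
    case False then show ?thesis using upper[of "- z"] by (simp add: P_def)
  qed
qed

text \<open>Cauchy's estimate for \<open>p (cos z)\<close> on a circle of radius
  \<open>1 / n\<close>, where the growth factor is at most e. The derivative at
  \<open>\<theta> = arccos u\<close> is \<open>- sin \<theta>\<close> times the derivative of
  \<open>p\<close> at \<open>u\<close>; the sine is at least 3 / 5 here, and with e at most 3 the
  constant becomes 5.\<close>

lemma bernstein_weak:
  fixes p :: "real poly"
  assumes deg: "degree p \<le> n" and bound: "\<And>u. \<bar>u\<bar> \<le> 1 \<Longrightarrow> \<bar>poly p u\<bar> \<le> M" and u: "\<bar>u\<bar> \<le> 3 / 4"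
  shows "\<bar>poly (pderiv p) u\<bar> \<le> 5 * real n * M"
proof (cases "n = 0")
  case True
  then have "pderiv p = 0" using deg by (simp add: pderiv_eq_0_iff)
  then show ?thesis using True by simp
next
  case False
  define P :: "complex poly" where "P = map_poly of_real p"
  define F where "F z = poly P (cos z)" for z
  define \<theta> where "\<theta> = arccos u"
  have cos: "cos \<theta> = u" and sin: "sin \<theta> = sqrt (1 - u\<^sup>2)"
    using u by (auto simp: \<theta>_def sin_arccos)
  have M: "M \<ge> 0" using bound[of 0] by simp
  have "norm ((deriv ^^ 1) F (of_real \<theta>)) \<le> fact 1 * (exp 1 * M) / (1 / real n) ^ 1"
  proof (rule Cauchy_inequality)
    show "F holomorphic_on ball (of_real \<theta>) (1 / real n)" "continuous_on (cball (of_real \<theta>) (1 / real n)) F"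
      unfolding F_def by (auto intro!: holomorphic_intros continuous_intros)
    show "0 < 1 / real n" using False by simp
    fix z :: complex assume "norm (of_real \<theta> - z :: complex) = 1 / real n"
    then have "\<bar>Im z\<bar> \<le> 1 / real n" using abs_Im_le_cmod[of "of_real \<theta> - z"] by simp
    then have "real n * \<bar>Im z\<bar> \<le> 1" using False by (simp add: field_simps)
    then have "exp (real n * \<bar>Im z\<bar>) * M \<le> exp 1 * M" using M by (intro mult_right_mono) auto
    then show "norm (F z) \<le> exp 1 * M"
      using norm_poly_cos_le[OF deg bound, of z] unfolding F_def P_def by linarith
  qed
  moreover have "deriv F (of_real \<theta>) = of_real (- sin \<theta> * poly (pderiv p) u)"
  proof (rule DERIV_imp_deriv)
    have "(F has_field_derivative poly (pderiv P) (cos (of_real \<theta>)) * (- sin (of_real \<theta>))) (at (of_real \<theta>))"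
      unfolding F_def by (rule DERIV_chain2[OF poly_DERIV]) (auto intro!: derivative_eq_intros)
    moreover have "poly (pderiv P) (cos (of_real \<theta>)) = of_real (poly (pderiv p) u)"
      unfolding P_def cos_of_real cos by (simp add: of_real_hom.map_poly_pderiv[symmetric])
    ultimately show "(F has_field_derivative of_real (- sin \<theta> * poly (pderiv p) u)) (at (of_real \<theta>))"
      by (simp add: sin_of_real mult.commute)
  qed
  ultimately have 1: "sin \<theta> * \<bar>poly (pderiv p) u\<bar> \<le> exp 1 * M * n"
    using sin u by (simp add: norm_mult abs_mult abs_square_le_1 del: of_real_mult)
  have "u\<^sup>2 \<le> (3 / 4)\<^sup>2" using u by (metis abs_ge_zero power2_abs power_mono)
  then have "sqrt (1 - u\<^sup>2) \<ge> sqrt ((3 / 5)\<^sup>2)" by (intro real_sqrt_le_mono) (simp add: power2_eq_square)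
  then have "3 / 5 * \<bar>poly (pderiv p) u\<bar> \<le> sin \<theta> * \<bar>poly (pderiv p) u\<bar>"
    unfolding sin by (intro mult_right_mono) auto
  also note 1
  also have "exp 1 * M * n \<le> 3 * M * n" using exp_le M by (intro mult_right_mono) auto
  finally show ?thesis by (simp add: mult_ac)
qed


text \<open>Lagrange interpolation at \<open>D + 1\<close> equally spaced integers that spread over
  most of the interval. The bounds on the basis polynomials add up to
  \<open>(8 / 3) ^ D * D ^ D / fact D\<close>, and \<open>D ^ D / fact D\<close> is at most
  \<open>exp D\<close>, hence at most \<open>3 ^ D\<close>.\<close>

lemma poly_growth_from_integers:
  fixes p :: "real poly"
  assumes deg: "degree p \<le> D" and D: "D \<ge> 1" and \<rho>: "real D \<le> \<rho> / 4"
    and bound: "\<And>e::nat. real e \<le> 2 * \<rho> \<Longrightarrow> \<bar>poly p (real e)\<bar> \<le> B"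
    and s: "0 \<le> s" "s \<le> 2 * \<rho>"
  shows "\<bar>poly p s\<bar> \<le> B * 8 ^ D"
proof -
  \<comment> \<open>The spacing of the nodes has to be an integer. As
    \<open>2 * \<rho> / D \<ge> 8\<close>, rounding down costs at most a factor 8 / 7, relaxed to 4
    / 3 below.\<close>
  define g where "g = nat \<lfloor>2 * \<rho> / D\<rfloor>"
  have g_le: "real g \<le> 2 * \<rho> / D" using D \<rho> by (simp add: g_def)
  have "2 * \<rho> / D \<ge> 8" using D \<rho> by (simp add: field_simps)
  moreover have "real g > 2 * \<rho> / D - 1" using calculation unfolding g_def by linarith
  ultimately have g_ge: "2 * \<rho> / D \<le> 8 / 7 * real g" and g_pos: "g > 0" by auto
  have \<rho>_le: "2 * \<rho> \<le> 4 / 3 * (real D * real g)"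
  proof -
    have "2 * \<rho> \<le> 8 / 7 * (real D * real g)" using g_ge D by (simp add: field_simps)
    moreover have "real D * real g \<ge> 0" by simp
    ultimately show ?thesis by linarith
  qed
  have B: "B \<ge> 0" using bound[of 0] \<rho> D by auto
  define x where "x k = real (k * g)" for k :: nat
  define l where "l k = (\<Prod>j\<in>{..D} - {k}. smult (1 / (x k - x j)) [:- x j, 1:])" for k
  have inj: "x j \<noteq> x k" if "j \<noteq> k" for j k using that g_pos by (simp add: x_def)
  have l_eval: "poly (l k) t = (\<Prod>j\<in>{..D} - {k}. (t - x j) / (x k - x j))" for k t
    by (simp add: l_def poly_prod diff_divide_distrib)
  have l_deg: "degree (l k) \<le> D" if "k \<le> D" for k
  proof -
    have "degree (l k) \<le> (\<Sum>j\<in>{..D} - {k}. degree (smult (1 / (x k - x j)) [:- x j, 1:]))"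
      unfolding l_def using degree_prod_sum_le[of "{..D} - {k}" "\<lambda>j. smult (1 / (x k - x j)) [:- x j, 1:]"] by (simp only: o_def finite_Diff finite_atMost simp_thms)
    also have "\<dots> \<le> (\<Sum>j\<in>{..D} - {k}. 1)" by (intro sum_mono) (simp add: degree_smult_le)
    finally show ?thesis using that by simp
  qed
  have p_eq: "p = (\<Sum>k\<le>D. smult (poly p (x k)) (l k))"
  proof (rule poly_eqI_degree[where A = "x ` {..D}"])
    have card: "card (x ` {..D}) = Suc D" using inj by (subst card_image) (auto simp: inj_on_def)
    show "card (x ` {..D}) > degree p" using card deg by simp
    have "degree (\<Sum>k\<le>D. smult (poly p (x k)) (l k)) \<le> D"
      by (intro degree_sum_le) (auto intro: l_deg)
    then show "card (x ` {..D}) > degree (\<Sum>k\<le>D. smult (poly p (x k)) (l k))" using card by simp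
    fix t assume "t \<in> x ` {..D}"
    then obtain i where i: "i \<le> D" "t = x i" by auto
    have "poly (l k) t = (if k = i then 1 else 0)" if "k \<le> D" for k
      using that i inj by (auto simp: l_eval intro!: prod.neutral prod_zero)
    then have "(\<Sum>k\<le>D. poly p (x k) * poly (l k) t) = (\<Sum>k\<le>D. if k = i then poly p (x i) else 0)"
      by (intro sum.cong) auto
    then show "poly p t = poly (\<Sum>k\<le>D. smult (poly p (x k)) (l k)) t"
      using i by (simp add: poly_sum)
  qed
  have l_bound: "\<bar>poly (l k) s\<bar> \<le> (4 / 3 * D) ^ D / (fact k * fact (D - k))" if k: "k \<le> D" for k
  proof -
    have "\<bar>s - x j\<bar> \<le> 2 * \<rho>" if "j \<le> D" for j
    proof -
      have "real j * real g \<le> D * (2 * \<rho> / D)" using that g_le D by (intro mult_mono) auto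
      then have "x j \<le> 2 * \<rho>" "x j \<ge> 0" using D by (simp_all add: x_def)
      then show ?thesis using s by linarith
    qed
    then have num: "\<bar>s - x j\<bar> \<le> 4 / 3 * D * g" if "j \<le> D" for j
      using \<rho>_le that by (force simp: mult.assoc)
    have "\<bar>poly (l k) s\<bar> = (\<Prod>j\<in>{..D} - {k}. \<bar>s - x j\<bar> / (\<bar>real k - real j\<bar> * g))"
      unfolding l_eval abs_prod
    proof (intro prod.cong refl)
      fix j
      have "x k - x j = (real k - real j) * real g" by (simp add: x_def left_diff_distrib)
      then show "\<bar>(s - x j) / (x k - x j)\<bar> = \<bar>s - x j\<bar> / (\<bar>real k - real j\<bar> * g)"
        by (simp add: abs_mult)
    qed
    also have "\<dots> \<le> (\<Prod>j\<in>{..D} - {k}. 4 / 3 * D * g / (\<bar>real k - real j\<bar> * g))"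
      using num by (intro prod_mono conjI divide_right_mono) auto
    also have "\<dots> = (\<Prod>j\<in>{..D} - {k}. (4 / 3 * D) / \<bar>real k - real j\<bar>)"
      using g_pos by (intro prod.cong) auto
    also have "\<dots> = (4 / 3 * D) ^ D / (\<Prod>j\<in>{..D} - {k}. \<bar>real k - real j\<bar>)"
      unfolding prod_dividef prod_constant using k by simp
    also have "(\<Prod>j\<in>{..D} - {k}. \<bar>real k - real j\<bar>) = fact k * fact (D - k)"
    proof -
      have split: "{..D} - {k} = {..<k} \<union> {k<..D}" "{..<k} \<inter> {k<..D} = {}" using k by auto
      have "(\<Prod>j\<in>{..D} - {k}. \<bar>real k - real j\<bar>)
          = (\<Prod>j<k. \<bar>real k - real j\<bar>) * (\<Prod>j\<in>{k<..D}. \<bar>real k - real j\<bar>)"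
        unfolding split(1) by (rule prod.union_disjoint) (use split(2) in simp_all)
      also have "(\<Prod>j<k. \<bar>real k - real j\<bar>) = (\<Prod>j\<in>{1..k}. real j)"
        by (rule prod.reindex_bij_witness[of _ "\<lambda>j. k - j" "\<lambda>j. k - j"]) auto
      also have "(\<Prod>j\<in>{k<..D}. \<bar>real k - real j\<bar>) = (\<Prod>j\<in>{1..D - k}. real j)"
        by (rule prod.reindex_bij_witness[of _ "\<lambda>j. k + j" "\<lambda>j. j - k"]) auto
      finally show ?thesis by (simp add: fact_prod)
    qed
    finally show ?thesis .
  qed
  have "\<bar>poly p s\<bar> \<le> (\<Sum>k\<le>D. \<bar>poly p (x k)\<bar> * \<bar>poly (l k) s\<bar>)"
  proof -
    have "poly p s = (\<Sum>k\<le>D. poly p (x k) * poly (l k) s)"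
      using arg_cong[OF p_eq, of "\<lambda>p. poly p s"] by (simp add: poly_sum)
    then show ?thesis using sum_abs[of "\<lambda>k. poly p (x k) * poly (l k) s" "{..D}"] by (simp add: abs_mult)
  qed
  also have "\<dots> \<le> (\<Sum>k\<le>D. B * ((4 / 3 * D) ^ D / (fact k * fact (D - k))))"
  proof (intro sum_mono mult_mono)
    fix k assume "k \<in> {..D}"
    then have "real k * real g \<le> D * (2 * \<rho> / D)" using g_le D by (intro mult_mono) auto
    then show "\<bar>poly p (x k)\<bar> \<le> B" unfolding x_def using D by (intro bound) simp
    show "\<bar>poly (l k) s\<bar> \<le> (4 / 3 * D) ^ D / (fact k * fact (D - k))" using l_bound \<open>k \<in> {..D}\<close> by simp
  qed (use B in auto)
  also have "\<dots> = B * ((4 / 3 * D) ^ D / fact D) * (\<Sum>k\<le>D. real (D choose k))"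
    unfolding sum_distrib_left by (intro sum.cong) (simp_all add: binomial_fact)
  also have "(\<Sum>k\<le>D. real (D choose k)) = 2 ^ D"
    by (metis choose_row_sum of_nat_numeral of_nat_power of_nat_sum)
  also have "B * ((4 / 3 * D) ^ D / fact D) * 2 ^ D = B * (8 / 3) ^ D * (real D ^ D / fact D)"
  proof -
    have "(8 / 3 :: real) ^ D = (4 / 3) ^ D * 2 ^ D" by (simp flip: power_mult_distrib)
    then show ?thesis by (simp only: power_mult_distrib times_divide_eq_right) simp
  qed
  also have "\<dots> \<le> B * (8 / 3) ^ D * 3 ^ D"
  proof (intro mult_left_mono)
    have "real D ^ D / fact D \<le> exp (real D)"

      using sum_le_suminf[OF summable_exp[of "real D"], of "{D}"] by (simp add: exp_def field_simps)
    also have "\<dots> = exp 1 ^ D" by (simp flip: exp_of_nat_mult)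
    also have "\<dots> \<le> 3 ^ D" by (intro power_mono exp_le) simp
    finally show "real D ^ D / fact D \<le> 3 ^ D" .
  qed (use B in auto)
  also have "\<dots> = B * 8 ^ D"
  proof -
    have "(8 :: real) ^ D = (8 / 3) ^ D * 3 ^ D" by (simp flip: power_mult_distrib)
    then show ?thesis by simp
  qed
  finally show ?thesis .
qed


text \<open>Substituting \<open>x = X * u\<^sup>2\<close> moves the endpoint 0 to the centre of
  [-1, 1], where the derivative is bounded linearly rather than quadratically in the degree. The
  jump now happens over the distance \<open>sqrt (x0 / X)\<close>, with slope at most
  \<open>5 * (2 * D) * 2\<close>.\<close>

lemma degree_ge_of_jump_near_endpoint:
  fixes g :: "real poly"
  assumes deg: "degree g \<le> D" and X: "X > 0" and x0: "0 \<le> x0" "x0 \<le> X / 4"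
    and bound: "\<And>x. 0 \<le> x \<Longrightarrow> x \<le> X \<Longrightarrow> \<bar>poly g x\<bar> \<le> 2"
    and jump: "poly g x0 - poly g 0 \<ge> \<gamma>"
  shows "\<gamma> \<le> 20 * real D * sqrt (x0 / X)"
proof -
  define p where "p = pcompose g [:0, 0, X:]"
  have p_eval: "poly p u = poly g (X * u\<^sup>2)" for u
    by (simp add: p_def poly_pcompose power2_eq_square algebra_simps)
  have degp: "degree p \<le> 2 * D" using deg X by (simp add: p_def degree_pcompose)
  have pb: "\<bar>poly p u\<bar> \<le> 2" if "\<bar>u\<bar> \<le> 1" for u
  proof -
    have "u\<^sup>2 \<le> 1" using that by (simp add: abs_square_le_1)
    then have "X * u\<^sup>2 \<le> X * 1" using X by (intro mult_left_mono) auto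
    then show ?thesis unfolding p_eval using X by (intro bound) auto
  qed
  define u where "u = sqrt (x0 / X)"
  have Xu: "X * u\<^sup>2 = x0" using X x0 by (simp add: u_def)
  have "x0 / X \<le> (1 / 2)\<^sup>2" using X x0 by (simp add: power2_eq_square field_simps)
  then have "u \<le> sqrt ((1 / 2)\<^sup>2)" unfolding u_def by (rule real_sqrt_le_mono)
  then have u: "0 \<le> u" "u \<le> 1 / 2" using x0 X by (auto simp: u_def)
  have "\<bar>poly p u - poly p 0\<bar> \<le> 5 * real (2 * D) * 2 * \<bar>u - 0\<bar>"
  proof (rule field_differentiable_bound[where S = "{0..u}" and f' = "poly (pderiv p)", unfolded real_norm_def])
    fix t assume "t \<in> {0..u}"
    then show "\<bar>poly (pderiv p) t\<bar> \<le> 5 * real (2 * D) * 2"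
      using u by (intro bernstein_weak[OF degp pb]) auto
    show "(poly p has_field_derivative poly (pderiv p) t) (at t within {0..u})"
      by (rule DERIV_subset[OF poly_DERIV]) simp
  qed (use u in auto)
  then have "poly p u - poly p 0 \<le> 20 * real D * u" using u by simp
  then show ?thesis using jump unfolding p_eval Xu by (simp add: u_def)
qed

text \<open>The polynomial may be exponentially large near the ends of \<open>[0, 2 \<rho>]\<close>. Multiplying it with a power of
  \<open>1 - u\<^sup>2\<close> moves the maximum to the middle of the interval, where Bernstein's inequality applies.\<close>

lemma degree_ge_of_bounded_on_integers:
  fixes p :: "real poly"
  assumes deg: "degree p \<le> D" and \<rho>: "\<rho> \<ge> 2"
    and bound: "\<And>e::nat. real e \<le> 2 * \<rho> \<Longrightarrow> \<bar>poly p (real e)\<bar> \<le> 21 / 20"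
    and mid: "\<bar>poly p \<rho>\<bar> > 2"
  shows "real D \<ge> \<rho> / 200"
proof (rule ccontr)
  assume small: "\<not> real D \<ge> \<rho> / 200"
  have D: "D \<ge> 1"
  proof (rule ccontr)
    assume "\<not> D \<ge> 1"
    then have "degree p = 0" using deg by simp
    then have "poly p \<rho> = poly p (real 0)" by (simp add: poly_altdef)
    then show False using mid bound[of 0] \<rho> by simp
  qed
  \<comment> \<open>The exponent is chosen so that \<open>8 * (3 / 4) ^ 8 < 1\<close>: for
    \<open>\<bar>u\<bar> \<ge> 1 / 2\<close> the new factor then beats the possible growth
    \<open>8 ^ D\<close> of \<open>p\<close>.\<close>
  define P where "P = pcompose p [:\<rho>, \<rho>:] * [:1, 0, -1:] ^ (8 * D)"
  have P_eval: "poly P u = poly p (\<rho> + \<rho> * u) * (1 - u\<^sup>2) ^ (8 * D)" for u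
    by (simp add: P_def poly_pcompose poly_power power2_eq_square mult.commute)
  have degP: "degree P \<le> 17 * D"
  proof -
    have "degree P \<le> degree (pcompose p [:\<rho>, \<rho>:]) + degree ([:1, 0, -1::real:] ^ (8 * D))"
      unfolding P_def by (rule degree_mult_le)
    also have "\<dots> \<le> D + 2 * (8 * D)"
      using deg \<rho> by (intro add_mono order_trans[OF degree_power_le]) (auto simp: degree_pcompose)
    finally show ?thesis by simp
  qed
  have outer: "\<bar>poly P u\<bar> < 2" if "\<bar>u\<bar> \<le> 1" "\<bar>u\<bar> \<ge> 1 / 2" for u
  proof -
    have "\<rho> * \<bar>u\<bar> \<le> \<rho> * 1" using that \<rho> by (intro mult_left_mono) auto
    then have "\<bar>\<rho> * u\<bar> \<le> \<rho>" using \<rho> by (simp add: abs_mult)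
    then have "0 \<le> \<rho> + \<rho> * u" "\<rho> + \<rho> * u \<le> 2 * \<rho>" by linarith+
    moreover have "real D \<le> \<rho> / 4" using small \<rho> by simp
    ultimately have 1: "\<bar>poly p (\<rho> + \<rho> * u)\<bar> \<le> 21 / 20 * 8 ^ D"
      by (intro poly_growth_from_integers[OF deg D _ bound])
    have "(1 / 2)\<^sup>2 \<le> \<bar>u\<bar>\<^sup>2" using that by (intro power_mono) auto
    moreover have "u\<^sup>2 \<le> 1" using that by (simp add: abs_square_le_1)
    ultimately have "0 \<le> 1 - u\<^sup>2" "1 - u\<^sup>2 \<le> 3 / 4" by (auto simp: power2_eq_square)
    then have 2: "\<bar>(1 - u\<^sup>2) ^ (8 * D)\<bar> \<le> (3 / 4) ^ (8 * D)" by (simp add: power_abs power_mono)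
    have "\<bar>poly P u\<bar> \<le> 21 / 20 * 8 ^ D * (3 / 4) ^ (8 * D)"
      unfolding P_eval abs_mult using 1 2 by (intro mult_mono) auto
    also have "\<dots> = 21 / 20 * (8 * (3 / 4) ^ 8) ^ D" by (simp add: power_mult power_mult_distrib)
    also have "\<dots> \<le> 21 / 20 * 1"
      by (intro mult_left_mono power_le_one) (simp_all add: power_divide)
    finally show ?thesis by simp
  qed
  have "\<exists>u\<in>{-1..1::real}. \<forall>v\<in>{-1..1}. \<bar>poly P v\<bar> \<le> \<bar>poly P u\<bar>"
    by (intro continuous_attains_sup) (auto intro!: continuous_intros)
  then obtain u where u: "u \<in> {-1..1}" and max: "\<And>v. \<bar>v\<bar> \<le> 1 \<Longrightarrow> \<bar>poly P v\<bar> \<le> \<bar>poly P u\<bar>"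
    by (auto simp: abs_le_iff)
  define M where "M = \<bar>poly P u\<bar>"
  have M: "M > 2" using mid max[of 0] by (simp add: P_eval M_def)
  then have u2: "\<bar>u\<bar> < 1 / 2" using outer[of u] u by (force simp: M_def)
  \<comment> \<open>The integer nearest to the maximum point lies within
    \<open>1 / (2 * \<rho>)\<close> of it in the variable \<open>u\<close>. There
    \<open>\<bar>P\<bar>\<close> has dropped from \<open>M > 2\<close> to at most 21 / 20, which a
    slope of at most \<open>85 * D * M\<close> does not permit if
    \<open>D < \<rho> / 200\<close>.\<close>
  define e where "e = nat (round (\<rho> + \<rho> * u))"
  define v where "v = (real e - \<rho>) / \<rho>"
  have "\<rho> * \<bar>u\<bar> \<le> \<rho> * (1 / 2)" using u2 \<rho> by (intro mult_left_mono) auto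
  then have \<rho>u: "\<bar>\<rho> * u\<bar> \<le> \<rho> / 2" using \<rho> by (simp add: abs_mult)
  then have "\<rho> + \<rho> * u \<ge> 0" using \<rho> by linarith
  then have "real e = of_int (round (\<rho> + \<rho> * u))" unfolding e_def by (simp add: round_def)
  then have e: "\<bar>real e - (\<rho> + \<rho> * u)\<bar> \<le> 1 / 2" using of_int_round_abs_le by metis
  have e_le: "real e \<le> 2 * \<rho>" using e \<rho>u \<rho> by linarith
  have v_eq: "\<rho> + \<rho> * v = real e" using \<rho> by (simp add: v_def)
  have "\<rho> * \<bar>v - u\<bar> = \<bar>real e - (\<rho> + \<rho> * u)\<bar>"
    using \<rho> by (simp add: v_eq[symmetric] abs_mult flip: right_diff_distrib)
  then have vu: "\<rho> * \<bar>v - u\<bar> \<le> 1 / 2" using e by simp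
  moreover have "2 * \<bar>v - u\<bar> \<le> \<rho> * \<bar>v - u\<bar>" using \<rho> by (intro mult_right_mono) auto
  ultimately have "2 * \<bar>v - u\<bar> \<le> 1 / 2" by (rule order_trans[rotated])
  then have v34: "\<bar>v\<bar> \<le> 3 / 4" using u2 abs_triangle_ineq[of "v - u" u] by simp
  have "\<bar>poly P u - poly P v\<bar> \<le> 5 * real (17 * D) * M * \<bar>u - v\<bar>"
  proof (rule field_differentiable_bound[where S = "{-3/4..3/4}" and f' = "poly (pderiv P)", unfolded real_norm_def])
    fix t :: real assume "t \<in> {-3/4..3/4}"
    then show "\<bar>poly (pderiv P) t\<bar> \<le> 5 * real (17 * D) * M"
      unfolding M_def by (intro bernstein_weak[OF degP max]) auto
    show "(poly P has_field_derivative poly (pderiv P) t) (at t within {-3/4..3/4})"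
      by (rule DERIV_subset[OF poly_DERIV]) simp
  qed (use u2 v34 in auto)
  moreover have "\<bar>poly P v\<bar> \<le> 21 / 20"
  proof -
    have "v\<^sup>2 \<le> 1" using v34 by (simp add: abs_square_le_1)
    then have "\<bar>(1 - v\<^sup>2) ^ (8 * D)\<bar> \<le> 1" by (simp add: power_abs power_le_one)
    then have "\<bar>poly p (\<rho> + \<rho> * v)\<bar> * \<bar>(1 - v\<^sup>2) ^ (8 * D)\<bar> \<le> 21 / 20 * 1"
      using bound[OF e_le] unfolding v_eq by (intro mult_mono) auto
    then show ?thesis by (simp add: P_eval abs_mult)
  qed
  ultimately have "M - 21 / 20 \<le> 85 * real D * M * \<bar>u - v\<bar>" unfolding M_def by linarith
  also have "\<dots> \<le> 85 * (\<rho> / 200) * M * \<bar>u - v\<bar>"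
    using small M by (intro mult_right_mono mult_left_mono) auto
  also have "\<dots> = 85 / 200 * M * (\<rho> * \<bar>v - u\<bar>)" by (simp add: abs_minus_commute)
  also have "\<dots> \<le> 85 / 200 * M * (1 / 2)" using vu M by (intro mult_left_mono) auto
  finally show False using M by simp
qed

section \<open>Sums of juntas\<close>

definition is_junta :: "nat set \<Rightarrow> ((nat \<Rightarrow> 'a) \<Rightarrow> 'k \<Rightarrow> 'b) \<Rightarrow> bool" where
  "is_junta S f \<longleftrightarrow> (\<forall>x x'. (\<forall>i\<in>S. x i = x' i) \<longrightarrow> f x = f x')"

text \<open>The counterpart of a polynomial of degree \<open>j\<close> in the indicators of the
  coordinate values. Functions are vector valued: \<open>'k\<close> indexes amplitudes, so that
  gates can be applied to the values.\<close>

inductive junta_sum :: "nat set \<Rightarrow> nat \<Rightarrow> ((nat \<Rightarrow> 'a) \<Rightarrow> 'k \<Rightarrow> 'b::comm_ring_1) \<Rightarrow> bool"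
  for I :: "nat set" and j :: nat where
  junta: "S \<subseteq> I \<Longrightarrow> finite S \<Longrightarrow> card S \<le> j \<Longrightarrow> is_junta S f \<Longrightarrow> junta_sum I j f"
| add: "junta_sum I j f \<Longrightarrow> junta_sum I j g \<Longrightarrow> junta_sum I j (\<lambda>x k. f x k + g x k)"

lemma junta_sum_mono: "junta_sum I j f \<Longrightarrow> j \<le> j' \<Longrightarrow> junta_sum I j' f"
  by (induction rule: junta_sum.induct) (auto intro: junta_sum.intros)

lemma junta_sum_const: "junta_sum I j (\<lambda>x. v)"
  by (rule junta_sum.junta[of "{}"]) (auto simp: is_junta_def)

lemma junta_sum_sum:
  assumes "finite A" "\<And>a. a \<in> A \<Longrightarrow> junta_sum I j (f a)"
  shows "junta_sum I j (\<lambda>x k. \<Sum>a\<in>A. f a x k)"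
  using assms
proof (induction rule: finite_induct)
  case empty
  then show ?case using junta_sum_const[of I j "\<lambda>_. 0"] by simp
next
  case (insert a A)
  then show ?case using junta_sum.add[of I j "f a"] by simp
qed

lemma junta_sum_map:
  assumes "junta_sum I j f" and "\<And>u v k. L (\<lambda>k. u k + v k) k = L u k + L v k"
  shows "junta_sum I j (\<lambda>x. L (f x))"
  using assms(1)
proof (induction rule: junta_sum.induct)
  case (junta S f)
  then show ?case by (intro junta_sum.junta[of S]) (auto simp: is_junta_def, metis)
next
  case (add f g)
  then show ?case using junta_sum.add[of I j "\<lambda>x. L (f x)" "\<lambda>x. L (g x)"]
    by (simp add: assms(2) cong: if_cong flip: fun_eq_iff)
qed

lemma junta_sum_mult:
  assumes "junta_sum I j f" "junta_sum I j' g"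
  shows "junta_sum I (j + j') (\<lambda>x k. f x k * g x k)"
  using assms(1)
proof (induction rule: junta_sum.induct)
  case (junta S f)
  note f = junta
  show ?case using assms(2)
  proof (induction rule: junta_sum.induct)
    case (junta S' g)
    have "card (S \<union> S') \<le> j + j'" using card_Un_le[of S S'] f junta by linarith
    moreover have "is_junta (S \<union> S') (\<lambda>x k. f x k * g x k)"
      using f(4) junta(4) unfolding is_junta_def by (metis UnI1 UnI2)
    ultimately show ?case using f junta by (intro junta_sum.junta[of "S \<union> S'"]) auto
  next
    case (add g h)
    then show ?case using junta_sum.add[OF add.IH] by (simp add: distrib_left)
  qed
next
  case (add f h)
  then show ?case using junta_sum.add[OF add.IH] by (simp add: distrib_right)
qed

section \<open>Element distinctness\<close>

definition poly_fun :: "nat \<Rightarrow> (real \<Rightarrow> real) \<Rightarrow> bool" where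
  "poly_fun D f \<longleftrightarrow> (\<exists>p. degree p \<le> D \<and> (\<forall>x. f x = poly p x))"

text \<open>The degree is bounded in each variable separately, not in total, since one variable is
  always frozen when a polynomial inequality is applied.\<close>

definition bipoly :: "nat \<Rightarrow> (real \<Rightarrow> real \<Rightarrow> real) \<Rightarrow> bool" where
  "bipoly D f \<longleftrightarrow> (\<forall>s. poly_fun D (\<lambda>x. f s x)) \<and> (\<forall>x. poly_fun D (\<lambda>s. f s x))"

lemma poly_fun_linear: "D \<ge> 1 \<Longrightarrow> poly_fun D (\<lambda>x. a + b * x)"
  unfolding poly_fun_def by (rule exI[of _ "[:a, b:]"]) simp

lemma poly_fun_const: "poly_fun D (\<lambda>x. a)"
  unfolding poly_fun_def by (rule exI[of _ "[:a:]"]) simp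

lemma poly_fun_add: "poly_fun D f \<Longrightarrow> poly_fun D g \<Longrightarrow> poly_fun D (\<lambda>x. f x + g x)"
  unfolding poly_fun_def by (metis degree_add_le poly_add)

lemma poly_fun_mult: "poly_fun D f \<Longrightarrow> poly_fun D' g \<Longrightarrow> poly_fun (D + D') (\<lambda>x. f x * g x)"
  unfolding poly_fun_def by (metis degree_mult_le poly_mult add_mono order_trans)

lemma bipoly_const: "bipoly D (\<lambda>s x. c)"
  by (simp add: bipoly_def poly_fun_const)

lemma bipoly_add: "bipoly D f \<Longrightarrow> bipoly D g \<Longrightarrow> bipoly D (\<lambda>s x. f s x + g s x)"
  by (simp add: bipoly_def poly_fun_add)

lemma bipoly_mult: "bipoly D f \<Longrightarrow> bipoly D' g \<Longrightarrow> bipoly (D + D') (\<lambda>s x. f s x * g s x)"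
  by (simp add: bipoly_def poly_fun_mult)

lemma bipoly_sum:
  assumes "finite A" "\<And>a. a \<in> A \<Longrightarrow> bipoly D (f a)"
  shows "bipoly D (\<lambda>s x. \<Sum>a\<in>A. f a s x)"
  using assms by (induction rule: finite_induct) (simp_all add: bipoly_const bipoly_add)

lemma bipoly_mono: "bipoly D f \<Longrightarrow> D \<le> D' \<Longrightarrow> bipoly D' f"
  unfolding bipoly_def poly_fun_def by (meson order_trans)

lemma bipoly_linear: "bipoly 1 (\<lambda>s x. a + b * s + c * x)"
  unfolding bipoly_def
proof (intro conjI allI)
  fix s show "poly_fun 1 (\<lambda>x. a + b * s + c * x)" by (rule poly_fun_linear) simp
next
  fix x show "poly_fun 1 (\<lambda>s. a + b * s + c * x)"
    using poly_fun_linear[of 1 "a + c * x" b] by (simp add: algebra_simps)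
qed

section \<open>Equality patterns and sequential sampling\<close>

definition same_pattern :: "nat set \<Rightarrow> (nat \<Rightarrow> nat) \<Rightarrow> (nat \<Rightarrow> nat) \<Rightarrow> bool" where
  "same_pattern S u u' \<longleftrightarrow> (\<forall>i\<in>S. u i = 0 \<longleftrightarrow> u' i = 0) \<and> (\<forall>i\<in>S. \<forall>j\<in>S. u i = u j \<longleftrightarrow> u' i = u' j)"

definition pattern_junta :: "nat set \<Rightarrow> ((nat \<Rightarrow> nat) \<Rightarrow> real) \<Rightarrow> bool" where
  "pattern_junta S f \<longleftrightarrow> (\<forall>u u'. same_pattern S u u' \<longrightarrow> f u = f u')"

definition used :: "nat set \<Rightarrow> (nat \<Rightarrow> nat) \<Rightarrow> nat set" where
  "used I u = u ` I - {0}"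

definition fresh :: "nat set \<Rightarrow> (nat \<Rightarrow> nat) \<Rightarrow> nat" where
  "fresh I u = Suc (Max (insert 0 (u ` I)))"

lemma fresh: "finite I \<Longrightarrow> fresh I u \<noteq> 0" "finite I \<Longrightarrow> i \<in> I \<Longrightarrow> fresh I u \<noteq> u i"
   apply (simp add: fresh_def)
  by (metis Max_ge finite.insertI finite_imageI fresh_def image_eqI insertCI not_less_eq_eq order_refl)

lemma finite_used [simp]: "finite I \<Longrightarrow> finite (used I u)"
  by (simp add: used_def)

text \<open>Expected value of \<open>f\<close> when the coordinates in the list are drawn one after the other: the value is 0 with
  weight \<open>1 - s\<close>, each value already in use has weight \<open>x\<close>, and a fresh value takes the rest. For \<open>s = K * x\<close>
  these are independent draws from \<open>K\<close> values of probability \<open>x\<close> each, up to renaming, but the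
  definition makes sense for all real \<open>s\<close> and \<open>x\<close>.\<close>

fun pexp :: "nat set \<Rightarrow> real \<Rightarrow> real \<Rightarrow> nat list \<Rightarrow> ((nat \<Rightarrow> nat) \<Rightarrow> real) \<Rightarrow> (nat \<Rightarrow> nat) \<Rightarrow> real" where
  "pexp I s x [] f u = f u"
| "pexp I s x (i # is) f u =
     (1 - s) * pexp I s x is f (u(i := 0)) + (\<Sum>v\<in>used I u. x * pexp I s x is f (u(i := v)))
     + (s - x * card (used I u)) * pexp I s x is f (u(i := fresh I u))"

text \<open>In this form a used value enters only through its difference to a fresh one, which
  vanishes if the remaining expectation cannot tell the two apart.\<close>

lemma pexp_Cons_alt:
  assumes "finite I"
  shows "pexp I s x (i # is) f u =
     (1 - s) * pexp I s x is f (u(i := 0)) + s * pexp I s x is f (u(i := fresh I u))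
     + x * (\<Sum>v\<in>used I u. pexp I s x is f (u(i := v)) - pexp I s x is f (u(i := fresh I u)))"
  by (simp add: sum_subtractf sum_distrib_left algebra_simps)

lemma same_pattern_mono: "same_pattern S' u u' \<Longrightarrow> S \<subseteq> S' \<Longrightarrow> same_pattern S u u'"
  unfolding same_pattern_def by blast

lemma pattern_junta_mono: "pattern_junta S f \<Longrightarrow> S \<subseteq> S' \<Longrightarrow> pattern_junta S' f"
  unfolding pattern_junta_def using same_pattern_mono by blast

lemma pattern_junta_same: "pattern_junta S f \<Longrightarrow> same_pattern S u u' \<Longrightarrow> f u = f u'"
  by (simp add: pattern_junta_def)

lemma fresh_notin: "finite I \<Longrightarrow> S \<subseteq> I \<Longrightarrow> fresh I u \<notin> u ` S"
  using fresh(2) by blast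

lemma same_pattern_upd_new:
  assumes "same_pattern S u u'" "i \<notin> S" "v \<noteq> 0" "v \<notin> u ` S" "w \<noteq> 0" "w \<notin> u' ` S"
  shows "same_pattern (insert i S) (u(i := v)) (u'(i := w))"
  using assms unfolding same_pattern_def by (auto simp: image_iff)

text \<open>Values outside the image of \<open>S\<close> are indistinguishable from a fresh one.\<close>

lemma sum_used_eq:
  assumes "finite I" "S \<subseteq> I" "pattern_junta (insert i S) f" "i \<notin> S"
  shows "(\<Sum>v\<in>used I u. f (u(i := v)) - f (u(i := fresh I u)))
    = (\<Sum>v\<in>used S u. f (u(i := v)) - f (u(i := fresh I u)))"
proof (rule sum.mono_neutral_right)
  show "used S u \<subseteq> used I u" using assms by (auto simp: used_def)
  show "\<forall>v\<in>used I u - used S u. f (u(i := v)) - f (u(i := fresh I u)) = 0"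
  proof
    fix v assume "v \<in> used I u - used S u"
    then have "same_pattern (insert i S) (u(i := v)) (u(i := fresh I u))"
      using assms(4) fresh(1)[OF assms(1)] fresh_notin[OF assms(1,2)]
      by (intro same_pattern_upd_new) (auto simp: used_def same_pattern_def)
    then show "f (u(i := v)) - f (u(i := fresh I u)) = 0"
      using pattern_junta_same[OF assms(3)] by simp
  qed
qed (use assms in simp)

text \<open>The common pattern on \<open>S\<close> induces a bijection \<open>\<theta>\<close>
  between the nonzero values that \<open>u\<close> and \<open>u'\<close> take there, and it matches
  the sums term by term.\<close>

lemma sum_used_cong:
  assumes "finite I" "S \<subseteq> I" "pattern_junta (insert i S) f" "i \<notin> S" "same_pattern S u u'"
  shows "(\<Sum>v\<in>used S u. f (u(i := v)) - f (u(i := fresh I u)))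
    = (\<Sum>v\<in>used S u'. f (u'(i := v)) - f (u'(i := fresh I u')))"
proof -
  have fr: "f (u(i := fresh I u)) = f (u'(i := fresh I u'))"
  proof (rule pattern_junta_same[OF assms(3)])
    show "same_pattern (insert i S) (u(i := fresh I u)) (u'(i := fresh I u'))"
      by (intro same_pattern_upd_new assms fresh(1) fresh_notin)
  qed
  define \<theta> where "\<theta> v = u' (SOME j. j \<in> S \<and> u j = v)" for v
  have \<theta>: "\<theta> (u j) = u' j" if "j \<in> S" for j
  proof -
    have "(SOME k. k \<in> S \<and> u k = u j) \<in> S \<and> u (SOME k. k \<in> S \<and> u k = u j) = u j"
      by (rule someI[of _ j]) (use that in simp)
    then show ?thesis using assms(5) that unfolding \<theta>_def same_pattern_def by metis
  qed
  show ?thesis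
  proof (rule sum.reindex_bij_betw[of \<theta>, symmetric, THEN trans, symmetric])
    show "bij_betw \<theta> (used S u) (used S u')"
    proof (rule bij_betwI')
      fix y assume "y \<in> used S u'"
      then obtain j where "j \<in> S" "y = u' j" "u' j \<noteq> 0" by (auto simp: used_def)
      then show "\<exists>x\<in>used S u. y = \<theta> x"
        using assms(5) by (intro bexI[of _ "u j"]) (auto simp: \<theta> used_def same_pattern_def)
    qed (use assms(5) in \<open>auto simp: \<theta> used_def same_pattern_def\<close>)
    show "(\<Sum>v\<in>used S u. f (u'(i := \<theta> v)) - f (u'(i := fresh I u')))
      = (\<Sum>v\<in>used S u. f (u(i := v)) - f (u(i := fresh I u)))"
    proof (rule sum.cong[OF refl])
      fix v assume "v \<in> used S u"
      then obtain j where j: "j \<in> S" "v = u j" "v \<noteq> 0" by (auto simp: used_def)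
      have "same_pattern (insert i S) (u'(i := \<theta> v)) (u(i := v))"
        using assms(4,5) j by (auto simp: same_pattern_def \<theta>)
      then show "f (u'(i := \<theta> v)) - f (u'(i := fresh I u')) = f (u(i := v)) - f (u(i := fresh I u))"
        using pattern_junta_same[OF assms(3)] fr by metis
    qed
  qed
qed

text \<open>The recursion refers to the values used anywhere in \<open>I\<close>, which a pattern on
  fewer coordinates does not determine. The dependence cancels, because values that occur only
  outside the relevant coordinates are interchangeable with a fresh one.\<close>

lemma pexp_pattern_junta:
  assumes "finite I" "pattern_junta S f" "S \<subseteq> I" "distinct is"
  shows "pattern_junta (S - set is) (pexp I s x is f)"
  using assms(4)
proof (induction "is")
  case Nil
  then show ?case using assms by (simp add: pattern_junta_def)
next
  case (Cons i "is")
  define S' where "S' = S - set (i # is)"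
  have S': "S' \<subseteq> I" "i \<notin> S'" using assms(3) by (auto simp: S'_def)
  define g where "g = pexp I s x is f"
  have "pattern_junta (S - set is) g" using Cons by (simp add: g_def)
  then have g: "pattern_junta (insert i S') g"
    by (rule pattern_junta_mono) (auto simp: S'_def)
  show ?case unfolding S'_def[symmetric] pattern_junta_def
  proof (intro allI impI)
    fix u u' assume sp: "same_pattern S' u u'"
    have "same_pattern (insert i S') (u(i := 0)) (u'(i := 0))"
      using sp by (auto simp: same_pattern_def)
    moreover have "same_pattern (insert i S') (u(i := fresh I u)) (u'(i := fresh I u'))"
      by (intro same_pattern_upd_new assms fresh(1) fresh_notin sp S')
    ultimately show "pexp I s x (i # is) f u = pexp I s x (i # is) f u'"
      unfolding pexp_Cons_alt[OF assms(1)] g_def[symmetric]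
      using sum_used_eq[OF assms(1) S'(1) g S'(2)] sum_used_cong[OF assms(1) S'(1) g S'(2) sp]
        pattern_junta_same[OF g] by metis
  qed
qed

text \<open>The weights are linear in \<open>s\<close> and \<open>x\<close> and sum to 1. Hence
  drawing a coordinate outside \<open>S\<close> changes nothing, and each coordinate of
  \<open>S\<close> raises the degree by at most one.\<close>

lemma pexp_bipoly:
  assumes "finite I" "pattern_junta S f" "S \<subseteq> I" "distinct is"
  shows "bipoly (card (S \<inter> set is)) (\<lambda>s x. pexp I s x is f u)"
  using assms(4)
proof (induction "is" arbitrary: u)
  case Nil
  then show ?case by (simp add: bipoly_const)
next
  case (Cons i "is")
  let ?g = "\<lambda>s x. pexp I s x is f"
  have IH: "bipoly (card (S \<inter> set is)) (\<lambda>s x. ?g s x u)" for u using Cons by simp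
  show ?case
  proof (cases "i \<in> S")
    case False
    have "pexp I s x (i # is) f u = ?g s x u" for s x
    proof -
      have pj: "pattern_junta (S - set is) (?g s x)"
        using pexp_pattern_junta[OF assms(1-3)] Cons.prems by simp
      have eq: "?g s x (u(i := v)) = ?g s x u" for v
        by (rule pattern_junta_same[OF pj]) (use False in \<open>auto simp: same_pattern_def\<close>)
      show ?thesis unfolding pexp_Cons_alt[OF assms(1)] eq by (simp add: algebra_simps)
    qed
    then show ?thesis using IH False by simp
  next
    case True
    have fin: "finite S" using assms finite_subset by blast
    have "card (S \<inter> set (i # is)) = Suc (card (S \<inter> set is))"
      using True Cons.prems fin by (simp add: Int_insert_right)
    moreover have "bipoly (1 + card (S \<inter> set is)) (\<lambda>s x. pexp I s x (i # is) f u)"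
    proof -
      note m = bipoly_mult[OF bipoly_linear IH]
      have "bipoly (1 + card (S \<inter> set is)) (\<lambda>s x. (1 + (-1) * s + 0 * x) * ?g s x (u(i := 0))
        + (\<Sum>v\<in>used I u. (0 + 0 * s + 1 * x) * ?g s x (u(i := v)))
        + (0 + 1 * s + - real (card (used I u)) * x) * ?g s x (u(i := fresh I u)))"
        by (intro bipoly_add bipoly_sum m finite_used assms(1))
      then show ?thesis by (simp add: mult.commute)
    qed
    ultimately show ?thesis by simp
  qed
qed

lemma extend_to_permutation:
  fixes a b :: "'s \<Rightarrow> 'i"
  assumes "finite I" "a ` S \<subseteq> I" "b ` S \<subseteq> I" and eq: "\<And>i j. i \<in> S \<Longrightarrow> j \<in> S \<Longrightarrow> a i = a j \<longleftrightarrow> b i = b j"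
  obtains \<rho> where "\<rho> permutes I" "\<And>i. i \<in> S \<Longrightarrow> \<rho> (a i) = b i"
proof -
  define \<theta> where "\<theta> v = b (SOME i. i \<in> S \<and> a i = v)" for v
  have \<theta>: "\<theta> (a i) = b i" if "i \<in> S" for i
  proof -
    have "(SOME k. k \<in> S \<and> a k = a i) \<in> S \<and> a (SOME k. k \<in> S \<and> a k = a i) = a i"
      by (rule someI[of _ i]) (use that in simp)
    then show ?thesis using eq that unfolding \<theta>_def by metis
  qed
  have bij: "bij_betw \<theta> (a ` S) (b ` S)"
    by (rule bij_betwI') (auto simp: \<theta> eq)
  have "card (I - a ` S) = card (I - b ` S)"
    using assms(1-3) bij_betw_same_card[OF bij] by (simp add: card_Diff_subset finite_subset)
  then obtain \<theta>' where bij': "bij_betw \<theta>' (I - a ` S) (I - b ` S)"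
    using finite_same_card_bij[of "I - a ` S" "I - b ` S"] assms(1) by auto
  define \<rho> where "\<rho> v = (if v \<in> a ` S then \<theta> v else if v \<in> I then \<theta>' v else v)" for v
  have "bij_betw \<rho> (a ` S \<union> (I - a ` S)) (b ` S \<union> (I - b ` S))"
  proof (rule bij_betw_combine)
    show "bij_betw \<rho> (a ` S) (b ` S)"
      using bij by (subst bij_betw_cong[of _ _ \<theta>]) (auto simp: \<rho>_def)
    show "bij_betw \<rho> (I - a ` S) (I - b ` S)"
      using bij' by (subst bij_betw_cong[of _ _ \<theta>']) (auto simp: \<rho>_def)
  qed auto
  moreover have "a ` S \<union> (I - a ` S) = I" "b ` S \<union> (I - b ` S) = I" using assms(2,3) by auto
  ultimately have "bij_betw \<rho> I I" by simp
  then have "\<rho> permutes I"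
    by (rule bij_imp_permutes) (use assms(2) in \<open>auto simp: \<rho>_def\<close>)
  then show ?thesis using \<theta> by (intro that) (auto simp: \<rho>_def)
qed

section \<open>Renaming values within a small alphabet\<close>

definition rep :: "(nat \<Rightarrow> nat) \<Rightarrow> nat \<Rightarrow> nat" where
  "rep u i = (LEAST k. u k = u i)"

lemma rep: "u (rep u i) = u i" "rep u i \<le> i"
  unfolding rep_def by (rule LeastI[of _ i], simp) (rule Least_le, simp)

lemma rep_eq_iff: "rep u i = rep u j \<longleftrightarrow> u i = u j"
  by (metis rep(1) rep_def)

text \<open>Values are renamed by their first occurrence, so that \<open>n\<close> names suffice for \<open>n\<close> coordinates.\<close>

definition relabel :: "(nat \<Rightarrow> nat) \<Rightarrow> (nat \<Rightarrow> nat) \<Rightarrow> nat \<Rightarrow> nat" where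
  "relabel \<pi> u i = (if u i = 0 then 0 else Suc (\<pi> (rep u i)))"

definition sym_avg :: "nat \<Rightarrow> ((nat \<Rightarrow> nat) \<Rightarrow> real) \<Rightarrow> (nat \<Rightarrow> nat) \<Rightarrow> real" where
  "sym_avg n f u = (\<Sum>\<pi> | \<pi> permutes {..<n}. f (relabel \<pi> u)) / fact n"

text \<open>Assignments with the same pattern on \<open>S\<close> have first occurrences related by
  some permutation \<open>\<rho>\<close>, and composing with \<open>\<rho>\<close> only reorders the
  sum over all permutations.\<close>

lemma pattern_junta_sym_avg:
  assumes "is_junta S f" "S \<subseteq> {..<n}"
  shows "pattern_junta S (sym_avg n (\<lambda>v. f v k))"
  unfolding pattern_junta_def
proof (intro allI impI)
  fix u u' assume sp: "same_pattern S u u'"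
  have less: "rep w i < n" if "i \<in> S" for w i
    using rep(2)[of w i] that assms(2) by (force intro: le_less_trans)
  obtain \<rho> where \<rho>: "\<rho> permutes {..<n}" "\<And>i. i \<in> {i \<in> S. u i \<noteq> 0} \<Longrightarrow> \<rho> (rep u i) = rep u' i"
  proof (rule extend_to_permutation[of "{..<n}" "rep u" "{i \<in> S. u i \<noteq> 0}" "rep u'"])
    show "rep u i = rep u j \<longleftrightarrow> rep u' i = rep u' j"
      if "i \<in> {i \<in> S. u i \<noteq> 0}" "j \<in> {i \<in> S. u i \<noteq> 0}" for i j
      using sp that unfolding rep_eq_iff same_pattern_def by blast
  qed (use less in auto)
  have "f (relabel \<pi> u') = f (relabel (\<pi> \<circ> \<rho>) u)" for \<pi>
  proof -
    have "relabel \<pi> u' i = relabel (\<pi> \<circ> \<rho>) u i" if "i \<in> S" for i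
      using sp \<rho>(2) that by (auto simp: relabel_def same_pattern_def)
    then show ?thesis using assms(1) by (simp add: is_junta_def)
  qed
  then have "(\<Sum>\<pi> | \<pi> permutes {..<n}. f (relabel \<pi> u') k)
      = (\<Sum>\<pi> | \<pi> permutes {..<n}. f (relabel (\<pi> \<circ> \<rho>) u) k)" by simp
  also have "\<dots> = (\<Sum>\<pi> | \<pi> permutes {..<n}. f (relabel \<pi> u) k)"
    by (rule sum_permutations_compose_right[OF \<rho>(1), symmetric])
  finally show "sym_avg n (\<lambda>v. f v k) u = sym_avg n (\<lambda>v. f v k) u'" by (simp add: sym_avg_def)
qed

lemma sym_avg_ge:
  assumes "\<And>\<pi>. \<pi> permutes {..<n} \<Longrightarrow> c \<le> f (relabel \<pi> u)"
  shows "c \<le> sym_avg n f u"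
proof -
  have "(\<Sum>\<pi> | \<pi> permutes {..<n}. c) \<le> (\<Sum>\<pi> | \<pi> permutes {..<n}. f (relabel \<pi> u))"
    using assms by (intro sum_mono) auto
  then show ?thesis by (simp add: sym_avg_def card_permutations field_simps)
qed

lemma sym_avg_le:
  assumes "\<And>\<pi>. \<pi> permutes {..<n} \<Longrightarrow> f (relabel \<pi> u) \<le> c"
  shows "sym_avg n f u \<le> c"
proof -
  have "(\<Sum>\<pi> | \<pi> permutes {..<n}. f (relabel \<pi> u)) \<le> (\<Sum>\<pi> | \<pi> permutes {..<n}. c)"
    using assms by (intro sum_mono) auto
  then show ?thesis by (simp add: sym_avg_def card_permutations field_simps)
qed

section \<open>Bounds for sampled expectations\<close>

lemma pexp_add: "pexp I s x is (\<lambda>u. f u + g u) u = pexp I s x is f u + pexp I s x is g u"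
  by (induction "is" arbitrary: u) (simp_all add: distrib_left sum.distrib)

lemma pexp_uminus: "pexp I s x is (\<lambda>u. - f u) u = - pexp I s x is f u"
  by (induction "is" arbitrary: u) (simp_all add: sum_negf algebra_simps)

lemma pexp_append: "pexp I s x (is @ js) f u = pexp I s x is (pexp I s x js f) u"
  by (induction "is" arbitrary: u) simp_all

lemma pexp_sym_avg_bipoly:
  assumes "junta_sum {..<n} D q"
  shows "bipoly D (\<lambda>s x. pexp {..<n} s x [0..<n] (sym_avg n (\<lambda>v. q v k)) u)"
  using assms
proof (induction rule: junta_sum.induct)
  case (junta S f)
  have "card (S \<inter> set [0..<n]) \<le> card S" using junta by (intro card_mono) auto
  then show ?case
    using junta bipoly_mono[OF pexp_bipoly[OF finite_lessThan pattern_junta_sym_avg[of S f n k]]]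
    by (meson distinct_upt order_trans)
next
  case (add f g)
  have "sym_avg n (\<lambda>v. f v k + g v k) = (\<lambda>u. sym_avg n (\<lambda>v. f v k) u + sym_avg n (\<lambda>v. g v k) u)"
    by (simp add: sym_avg_def sum.distrib add_divide_distrib fun_eq_iff)
  then show ?case using bipoly_add[OF add.IH] by (simp add: pexp_add)
qed

text \<open>A submartingale argument: \<open>\<phi>\<close> does not decrease in expectation from
  one draw to the next. \<open>Inv\<close> keeps the weights nonnegative; after drawing a used or a
  fresh value it is demanded only if that branch has positive weight. This covers both
  \<open>x = 0\<close>, where nothing is repeated, and the moment when no fresh value is
  left.\<close>

lemma pexp_ge:
  fixes x s :: real
  assumes x: "0 \<le> x" and s: "s \<le> 1"
    and Inv: "\<And>i is u. Inv (i # is) u \<Longrightarrow> x * card (used I u) \<le> s \<and> Inv is (u(i := 0))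
        \<and> (0 < x \<longrightarrow> (\<forall>v\<in>used I u. Inv is (u(i := v)))) \<and> (x * card (used I u) < s \<longrightarrow> Inv is (u(i := fresh I u)))"
    and step: "\<And>i is u. Inv (i # is) u \<Longrightarrow> \<phi> (i # is) u \<le> (1 - s) * \<phi> is (u(i := 0))
        + (\<Sum>v\<in>used I u. x * \<phi> is (u(i := v))) + (s - x * card (used I u)) * \<phi> is (u(i := fresh I u))"
    and leaf: "\<And>u. Inv [] u \<Longrightarrow> \<phi> [] u \<le> f u"
  shows "Inv is u \<Longrightarrow> \<phi> is u \<le> pexp I s x is f u"
proof (induction "is" arbitrary: u)
  case Nil
  then show ?case using leaf by simp
next
  case (Cons i "is")
  note I = Inv[OF Cons.prems]
  have "(s - x * card (used I u)) * \<phi> is (u(i := fresh I u))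
      \<le> (s - x * card (used I u)) * pexp I s x is f (u(i := fresh I u))"
  proof (cases "x * card (used I u) < s")
    case True
    then show ?thesis using I Cons.IH by (intro mult_left_mono) auto
  next
    case False
    then have "s - x * card (used I u) = 0" using I by linarith
    then show ?thesis by simp
  qed
  moreover have "(1 - s) * \<phi> is (u(i := 0)) \<le> (1 - s) * pexp I s x is f (u(i := 0))"
    using I Cons.IH s by (intro mult_left_mono) auto
  moreover have "(\<Sum>v\<in>used I u. x * \<phi> is (u(i := v))) \<le> (\<Sum>v\<in>used I u. x * pexp I s x is f (u(i := v)))"
    using I Cons.IH x
    by (cases "x = 0") (auto intro!: sum_mono mult_left_mono)
  ultimately show ?case using step[OF Cons.prems] by simp
qed

lemma card_used_upd:
  assumes "finite I"
  shows "card (used I (u(i := 0))) \<le> card (used I u)"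
    and "v \<in> used I u \<Longrightarrow> card (used I (u(i := v))) \<le> card (used I u)"
    and "card (used I (u(i := v))) \<le> Suc (card (used I u))"
proof -
  show "card (used I (u(i := 0))) \<le> card (used I u)"
    using assms by (intro card_mono) (auto simp: used_def)
  show "card (used I (u(i := v))) \<le> card (used I u)" if "v \<in> used I u"
    using that assms by (intro card_mono) (auto simp: used_def)
  have "card (used I (u(i := v))) \<le> card (insert v (used I u))"
    using assms by (intro card_mono) (auto simp: used_def)
  also have "\<dots> \<le> Suc (card (used I u))" using assms by (simp add: card_insert_if)
  finally show "card (used I (u(i := v))) \<le> Suc (card (used I u))" .
qed

text \<open>If \<open>s = K * x\<close>, a fresh value has weight zero once \<open>K\<close> values
  are in use. So at most \<open>K\<close> values occur and all weights are probabilities; for other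
  \<open>s\<close> and \<open>x\<close> the fresh weight may become negative.\<close>

lemma pexp_lower_bound:
  assumes "finite I" "0 \<le> x" "s \<le> 1" "s = real K * x" "\<And>u. c \<le> f u" "card (used I u) \<le> K"
  shows "c \<le> pexp I s x is f u"
proof (rule pexp_ge[where \<phi> = "\<lambda>_ _. c" and Inv = "\<lambda>_ u. card (used I u) \<le> K"])
  fix i u assume c: "card (used I u) \<le> K"
  have "card (used I (u(i := fresh I u))) \<le> K" if "x * card (used I u) < s"
  proof -
    have "card (used I u) \<noteq> K" using that assms(4) by (auto simp: mult.commute)
    then show ?thesis using card_used_upd(3)[OF assms(1), of u i "fresh I u"] c by linarith
  qed
  moreover have "x * card (used I u) \<le> x * K" using c assms(2) by (intro mult_left_mono) auto
  ultimately show "x * card (used I u) \<le> s \<and> card (used I (u(i := 0))) \<le> K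
      \<and> (0 < x \<longrightarrow> (\<forall>v\<in>used I u. card (used I (u(i := v))) \<le> K))
      \<and> (x * card (used I u) < s \<longrightarrow> card (used I (u(i := fresh I u))) \<le> K)"
    using card_used_upd(1,2)[OF assms(1), where u = u and i = i] c assms(4)
    by (auto simp: mult.commute intro: order_trans)
  show "c \<le> (1 - s) * c + (\<Sum>v\<in>used I u. x * c) + (s - x * real (card (used I u))) * c"
    by (simp add: algebra_simps)
qed (use assms in auto)

lemma pexp_upper_bound:
  assumes "finite I" "0 \<le> x" "s \<le> 1" "s = real K * x" "\<And>u. f u \<le> c" "card (used I u) \<le> K"
  shows "pexp I s x is f u \<le> c"
  using pexp_lower_bound[of I x s K "- c" "\<lambda>u. - f u" u "is"] assms by (simp add: pexp_uminus)

text \<open>The first string owns the coordinates below \<open>N\<close>, the second one those from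
  \<open>N\<close> on; \<open>k\<close> allows for a second string that is drawn only up to
  coordinate \<open>k\<close>. The value 0 is junk and never counts as common.\<close>

definition shares :: "nat \<Rightarrow> nat \<Rightarrow> (nat \<Rightarrow> nat) \<Rightarrow> bool" where
  "shares N k u \<longleftrightarrow> (\<exists>i<N. \<exists>j. N \<le> j \<and> j < k \<and> u i = u j \<and> u i \<noteq> 0)"

lemma shares_relabel:
  assumes "\<pi> permutes {..<n}"
  shows "shares N k (relabel \<pi> u) \<longleftrightarrow> shares N k u"
proof -
  have "relabel \<pi> u i = relabel \<pi> u j \<and> relabel \<pi> u i \<noteq> 0 \<longleftrightarrow> u i = u j \<and> u i \<noteq> 0" for i j
    using permutes_inj[OF assms] by (auto simp: relabel_def inj_eq rep_eq_iff)
  then show ?thesis unfolding shares_def by blast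
qed

lemma relabel_le:
  assumes "\<pi> permutes {..<n}" "i < n"
  shows "relabel \<pi> u i \<le> n"
proof -
  have "rep u i < n" using rep(2)[of u i] assms(2) by simp
  then have "\<pi> (rep u i) < n" using permutes_in_image[OF assms(1)] by simp
  then show ?thesis by (simp add: relabel_def)
qed

text \<open>At \<open>x = 0\<close> no value is ever repeated.\<close>

lemma pexp_no_repetition:
  assumes "0 \<le> s" "s \<le> 1" and f: "\<And>u. \<not> shares N (2 * N) u \<Longrightarrow> f u \<le> c"
  shows "pexp {..<2 * N} s 0 is f (\<lambda>_. 0) \<le> c"
proof -
  let ?I = "{..<2 * N}"
  have "- c \<le> pexp ?I s 0 is (\<lambda>u. - f u) (\<lambda>_. 0)"
  proof (rule pexp_ge[where \<phi> = "\<lambda>_ _. - c" and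
        Inv = "\<lambda>_ u. \<forall>i\<in>?I. \<forall>j\<in>?I. i \<noteq> j \<longrightarrow> u i = u j \<longrightarrow> u i = 0"])
    fix i and u :: "nat \<Rightarrow> nat" assume inv: "\<forall>i\<in>?I. \<forall>j\<in>?I. i \<noteq> j \<longrightarrow> u i = u j \<longrightarrow> u i = 0"
    have "\<forall>k\<in>?I. \<forall>j\<in>?I. k \<noteq> j \<longrightarrow> (u(i := w)) k = (u(i := w)) j \<longrightarrow> (u(i := w)) k = 0"
      if "w = 0 \<or> w \<notin> u ` ?I" for w using inv that by (auto simp: image_iff)
    then show "0 * real (card (used ?I u)) \<le> s
      \<and> (\<forall>k\<in>?I. \<forall>j\<in>?I. k \<noteq> j \<longrightarrow> (u(i := 0)) k = (u(i := 0)) j \<longrightarrow> (u(i := 0)) k = 0)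
      \<and> (0 < (0 :: real) \<longrightarrow> (\<forall>v\<in>used ?I u. \<forall>k\<in>?I. \<forall>j\<in>?I. k \<noteq> j \<longrightarrow> (u(i := v)) k = (u(i := v)) j \<longrightarrow> (u(i := v)) k = 0))
      \<and> (0 * real (card (used ?I u)) < s \<longrightarrow> (\<forall>k\<in>?I. \<forall>j\<in>?I. k \<noteq> j \<longrightarrow>
           (u(i := fresh ?I u)) k = (u(i := fresh ?I u)) j \<longrightarrow> (u(i := fresh ?I u)) k = 0))"
      using fresh_notin[of ?I ?I u] assms(1) by (simp del: fun_upd_apply)
  next
    fix u :: "nat \<Rightarrow> nat" assume inv: "\<forall>i\<in>?I. \<forall>j\<in>?I. i \<noteq> j \<longrightarrow> u i = u j \<longrightarrow> u i = 0"
    have "\<not> shares N (2 * N) u"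
    proof
      assume "shares N (2 * N) u"
      then obtain i j where "i < N" "N \<le> j" "j < 2 * N" "u i = u j" "u i \<noteq> 0" by (auto simp: shares_def)
      then show False using inv[rule_format, of i j] by auto
    qed
    then show "- c \<le> - f u" using f by simp
  next
    fix u
    show "- c \<le> (1 - s) * - c + (\<Sum>v\<in>used ?I u. 0 * - c) + (s - 0 * real (card (used ?I u))) * - c"
      by (simp add: algebra_simps)
  qed (use assms in auto)
  then show ?thesis by (simp add: pexp_uminus)
qed


lemma shares_Suc: "shares N (Suc k) u \<longleftrightarrow> shares N k u \<or> N \<le> k \<and> u k \<in> used {..<N} u"
proof
  assume "shares N (Suc k) u"
  then obtain i j where "i < N" "N \<le> j" "j < Suc k" "u i = u j" "u i \<noteq> 0" by (auto simp: shares_def)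
  then show "shares N k u \<or> N \<le> k \<and> u k \<in> used {..<N} u"
  proof (cases "j = k")
    case True
    then show ?thesis using \<open>i < N\<close> \<open>N \<le> j\<close> \<open>u i = u j\<close> \<open>u i \<noteq> 0\<close> by (auto simp: used_def intro: image_eqI[of _ u i])
  next
    case False
    then have "j < k" using \<open>j < Suc k\<close> by simp
    then show ?thesis using \<open>i < N\<close> \<open>N \<le> j\<close> \<open>u i = u j\<close> \<open>u i \<noteq> 0\<close> unfolding shares_def by blast
  qed
next
  assume "shares N k u \<or> N \<le> k \<and> u k \<in> used {..<N} u"
  then show "shares N (Suc k) u"
  proof
    assume "shares N k u"
    then obtain i j where "i < N" "N \<le> j" "j < k" "u i = u j" "u i \<noteq> 0" by (auto simp: shares_def)
    then show ?thesis unfolding shares_def by (intro exI[of _ i] conjI exI[of _ j]) auto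
  next
    assume "N \<le> k \<and> u k \<in> used {..<N} u"
    then obtain i where "N \<le> k" "i < N" "u k = u i" "u k \<noteq> 0" by (auto simp: used_def)
    then show ?thesis unfolding shares_def by (intro exI[of _ i] conjI exI[of _ k]) auto
  qed
qed

lemma shares_upd: "N \<le> k \<Longrightarrow> shares N k (u(k := v)) \<longleftrightarrow> shares N k u"
  unfolding shares_def by (intro ex_cong1 conj_cong refl) auto

lemma used_upd_outside: "i \<notin> I \<Longrightarrow> used I (u(i := v)) = used I u"
  by (auto simp: used_def)

lemma upt_eq_ConsD: "i # is = [k..<n] \<Longrightarrow> i = k \<and> k < n \<and> is = [Suc k..<n]"
  by (cases "k < n") (auto simp: upt_conv_Cons)

text \<open>If the first string shows \<open>c\<close> distinct values, each draw for the second one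
  misses all of them with probability \<open>1 - x * c\<close>. Accordingly \<open>\<phi>\<close> is
  \<open>L\<close> once a value is shared, and otherwise \<open>L\<close> times the chance that some
  remaining draw succeeds.\<close>

lemma pexp_second_phase:
  fixes x s :: real
  assumes x: "0 \<le> x" "x * (2 * N) \<le> s" and s: "s \<le> 1" and L: "0 \<le> L"
    and f: "\<And>u. 0 \<le> f u" "\<And>u. shares N (2 * N) u \<Longrightarrow> L \<le> f u"
    and c: "card (used {..<2 * N} u) \<le> N"
  shows "L * (1 - (1 - x * card (used {..<N} u)) ^ N) \<le> pexp {..<2 * N} s x [N..<2 * N] f u"
proof -
  let ?I = "{..<2 * N}"
  define \<phi> where "\<phi> js u = (if shares N (2 * N - length js) u then L
    else L * (1 - (1 - x * card (used {..<N} u)) ^ length js))" for js :: "nat list" and u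
  define Inv where "Inv js u \<longleftrightarrow> (\<exists>k\<ge>N. k \<le> 2 * N \<and> js = [k..<2 * N] \<and> card (used ?I u) \<le> k)"
    for js :: "nat list" and u
  have x1: "x * c \<le> 1" if "c \<le> 2 * N" for c
  proof -
    have "x * real c \<le> x * (2 * N)" using that x(1) by (intro mult_left_mono) simp_all
    then show ?thesis using x(2) s by linarith
  qed
  have cN: "card (used {..<N} u) \<le> N" for u
  proof -
    have "card (used {..<N} u) \<le> card (u ` {..<N})" by (intro card_mono) (auto simp: used_def)
    also have "\<dots> \<le> card {..<N}" by (rule card_image_le) simp
    finally show ?thesis by simp
  qed
  have \<phi>_le: "\<phi> js u \<le> L" for js u
  proof -
    have "x * card (used {..<N} u) \<le> 1" using cN[of u] by (intro x1) linarith
    then have "0 \<le> L * (1 - x * card (used {..<N} u)) ^ length js" using L by simp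
    then show ?thesis by (simp add: \<phi>_def right_diff_distrib)
  qed
  have "\<phi> [N..<2 * N] u \<le> pexp ?I s x [N..<2 * N] f u"
  proof (rule pexp_ge[where \<phi> = \<phi> and Inv = Inv])
    fix i js u assume "Inv (i # js) u"
    then obtain k where k: "N \<le> k" "k < 2 * N" "i = k" "js = [Suc k..<2 * N]" "card (used ?I u) \<le> k"
      unfolding Inv_def by (auto dest!: upt_eq_ConsD)
    have "x * card (used ?I u) \<le> x * (2 * N)" using k x(1) by (intro mult_left_mono) simp_all
    moreover have "Inv js (u(i := v))" for v
      using k card_used_upd(3)[of ?I u k v] unfolding Inv_def by (intro exI[of _ "Suc k"]) auto
    ultimately show "x * card (used ?I u) \<le> s \<and> Inv js (u(i := 0))
        \<and> (0 < x \<longrightarrow> (\<forall>v\<in>used ?I u. Inv js (u(i := v))))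
        \<and> (x * card (used ?I u) < s \<longrightarrow> Inv js (u(i := fresh ?I u)))" using x(2) by simp
    define c where "c = card (used {..<N} u)"
    define n where "n = length js"
    have len: "2 * N - n = Suc k" "2 * N - Suc n = k" using k by (auto simp: n_def)
    have succ: "\<phi> js (u(k := v)) = (if shares N k u \<or> v \<in> used {..<N} u then L else L * (1 - (1 - x * c) ^ n))" for v
      using k(1) by (simp add: \<phi>_def n_def[symmetric] c_def[symmetric] len shares_Suc shares_upd used_upd_outside)
    have \<beta>: "0 \<le> 1 - x * c" "0 \<le> (1 - x * c) ^ n" using x1[of c] cN[of u] by (auto simp: c_def)
    have weight: "x * card (used ?I u) \<le> s" using \<open>x * card (used ?I u) \<le> x * (2 * N)\<close> x by linarith
    define y where "y = L * (1 - (1 - x * c) ^ n)"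
    define z where "z = L * (1 - x * c) ^ n"
    have y: "y + z = L" "0 \<le> z" using L \<beta> by (auto simp: y_def z_def algebra_simps)
    show "\<phi> (i # js) u \<le> (1 - s) * \<phi> js (u(i := 0)) + (\<Sum>v\<in>used ?I u. x * \<phi> js (u(i := v)))
        + (s - x * card (used ?I u)) * \<phi> js (u(i := fresh ?I u))"
    proof (cases "shares N k u")
      case True
      then show ?thesis unfolding \<open>i = k\<close> succ using \<phi>_le[of "k # js" u] by (simp add: algebra_simps)
    next
      case False
      have sub: "used {..<N} u \<subseteq> used ?I u" by (auto simp: used_def)
      have "(\<Sum>v\<in>used ?I u. x * \<phi> js (u(k := v))) = (\<Sum>v\<in>used ?I u. x * y + (if v \<in> used {..<N} u then x * z else 0))"
        using False y by (intro sum.cong) (auto simp: succ y_def[symmetric] simp flip: distrib_left)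
      also have "\<dots> = card (used ?I u) * (x * y) + c * (x * z)"
        using sub by (simp add: sum.distrib c_def Int_absorb1 flip: sum.inter_restrict)
      finally have "(\<Sum>v\<in>used ?I u. x * \<phi> js (u(k := v))) = card (used ?I u) * (x * y) + c * (x * z)" .
      moreover have "y \<le> \<phi> js (u(k := v))" for v using y unfolding succ by (auto simp: y_def)
      then have "(1 - s) * y \<le> (1 - s) * \<phi> js (u(k := 0))"
        "(s - x * card (used ?I u)) * y \<le> (s - x * card (used ?I u)) * \<phi> js (u(k := fresh ?I u))"
        using s weight by (auto intro!: mult_left_mono)
      moreover have "\<phi> (k # js) u = y + c * (x * z)"
      proof -
        have "\<phi> (k # js) u = L * (1 - (1 - x * c) ^ Suc n)"
          using False by (simp add: \<phi>_def len n_def[symmetric] c_def[symmetric] del: power_Suc)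
        then show ?thesis by (simp add: y_def z_def algebra_simps)
      qed
      ultimately show ?thesis unfolding \<open>i = k\<close> by (simp add: algebra_simps)
    qed
  next
    fix u assume "Inv [] u"
    then show "\<phi> [] u \<le> f u" using f[of u] by (auto simp: \<phi>_def)
  next
    show "Inv [N..<2 * N] u" using c by (auto simp: Inv_def)
  qed (use x s in auto)
  moreover have "2 * N - N = N" "\<not> shares N N u" by (auto simp: shares_def)
  ultimately show ?thesis by (simp add: \<phi>_def)
qed

text \<open>This bounds the generating function of the number of distinct values in the first
  string. Each draw is fresh with weight at least 1 / 4 and then contributes a factor
  \<open>y\<close>, so the expectation of \<open>y ^ c\<close> is at most
  \<open>(1 - (1 - y) / 4) ^ N\<close>.\<close>

lemma pexp_first_phase:
  fixes x s :: real
  assumes x: "0 \<le> x" "x * N \<le> s - 1 / 4" and s: "s \<le> 1" and y: "0 \<le> y" "y \<le> 1" and L: "0 \<le> L"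
    and F: "\<And>u. card (used {..<2 * N} u) \<le> N \<Longrightarrow> L * (1 - y ^ card (used {..<N} u)) \<le> F u"
  shows "L * (1 - (1 - (1 - y) / 4) ^ N) \<le> pexp {..<2 * N} s x [0..<N] F (\<lambda>_. 0)"
proof -
  let ?I = "{..<2 * N}"
  define \<theta> where "\<theta> = 1 - (1 - y) / 4"
  define \<phi> where "\<phi> js u = L * (1 - y ^ card (used ?I u) * \<theta> ^ length js)" for js :: "nat list" and u
  define Inv where "Inv js u \<longleftrightarrow> (\<exists>k\<le>N. js = [k..<N] \<and> card (used ?I u) \<le> k \<and> (\<forall>i\<ge>k. u i = 0))"
    for js :: "nat list" and u
  have \<theta>: "0 \<le> \<theta>" using y by (simp add: \<theta>_def)
  have "\<phi> [0..<N] (\<lambda>_. 0) \<le> pexp ?I s x [0..<N] F (\<lambda>_. 0)"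
  proof (rule pexp_ge[where \<phi> = \<phi> and Inv = Inv])
    fix i js u assume "Inv (i # js) u"
    then obtain k where k: "k < N" "i = k" "js = [Suc k..<N]" "card (used ?I u) \<le> k" "\<And>i. i \<ge> k \<Longrightarrow> u i = 0"
      unfolding Inv_def by (auto dest!: upt_eq_ConsD)
    define c where "c = card (used ?I u)"
    have "x * c \<le> x * N" using k x(1) by (intro mult_left_mono) (simp_all add: c_def)
    then have weight: "x * c \<le> s - 1 / 4" using x(2) by linarith
    have "Inv js (u(i := v))" for v
      using k card_used_upd(3)[of ?I u k v] unfolding Inv_def by (intro exI[of _ "Suc k"]) auto
    then show "x * card (used ?I u) \<le> s \<and> Inv js (u(i := 0))
        \<and> (0 < x \<longrightarrow> (\<forall>v\<in>used ?I u. Inv js (u(i := v))))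
        \<and> (x * card (used ?I u) < s \<longrightarrow> Inv js (u(i := fresh ?I u)))"
      using weight by (auto simp: c_def)
    define n where "n = length js"
    have "u k = 0" using k by simp
    then have "used ?I (u(k := v)) = (if v = 0 then used ?I u else insert v (used ?I u))" for v
      using k by (auto simp: used_def image_iff)
    moreover have "fresh ?I u \<notin> used ?I u" "fresh ?I u \<noteq> 0"
      using fresh(1) fresh_notin[of ?I ?I u] by (auto simp: used_def)
    ultimately have "card (used ?I (u(k := 0))) = c" "card (used ?I (u(k := fresh ?I u))) = Suc c"
      "\<And>v. v \<in> used ?I u \<Longrightarrow> card (used ?I (u(k := v))) = c"
      by (auto simp: c_def insert_absorb used_def)
    then have succ: "\<phi> js (u(k := 0)) = L * (1 - y ^ c * \<theta> ^ n)"
      "\<phi> js (u(k := fresh ?I u)) = L * (1 - y ^ Suc c * \<theta> ^ n)"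
      "\<And>v. v \<in> used ?I u \<Longrightarrow> \<phi> js (u(k := v)) = L * (1 - y ^ c * \<theta> ^ n)"
      by (simp_all add: \<phi>_def n_def)
    define w where "w = L * (y ^ c * \<theta> ^ n)"
    have w: "0 \<le> w" using L y \<theta> by (simp add: w_def)
    have sum: "(\<Sum>v\<in>used ?I u. x * \<phi> js (u(k := v))) = c * (x * (L * (1 - y ^ c * \<theta> ^ n)))"
      using succ(3) by (simp add: c_def)
    have "(1 / 4) * (1 - y) \<le> (s - x * c) * (1 - y)" using weight y by (intro mult_right_mono) auto
    then have "w * (1 - (s - x * c) * (1 - y)) \<le> w * \<theta>" using w by (intro mult_left_mono) (auto simp: \<theta>_def)
    moreover have "\<phi> (k # js) u = L - w * \<theta>" by (simp add: \<phi>_def w_def c_def n_def algebra_simps)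
    moreover have "(1 - s) * \<phi> js (u(k := 0)) + (\<Sum>v\<in>used ?I u. x * \<phi> js (u(k := v)))
        + (s - x * card (used ?I u)) * \<phi> js (u(k := fresh ?I u)) = L - w * (1 - (s - x * c) * (1 - y))"
      unfolding succ(1,2) sum c_def[symmetric] w_def by (simp add: algebra_simps)
    ultimately show "\<phi> (i # js) u \<le> (1 - s) * \<phi> js (u(i := 0)) + (\<Sum>v\<in>used ?I u. x * \<phi> js (u(i := v)))
        + (s - x * card (used ?I u)) * \<phi> js (u(i := fresh ?I u))" unfolding \<open>i = k\<close> by linarith
  next
    fix u assume "Inv [] u"
    then have inv: "card (used ?I u) \<le> N" "\<And>i. i \<ge> N \<Longrightarrow> u i = 0" by (auto simp: Inv_def)
    have "used ?I u = used {..<N} u"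
    proof (intro equalityI subsetI)
      fix v assume "v \<in> used ?I u"
      then obtain i where i: "v = u i" "u i \<noteq> 0" by (auto simp: used_def)
      then have "i < N" using inv(2)[of i] by (meson not_less)
      then show "v \<in> used {..<N} u" using i by (simp add: used_def)
    qed (auto simp: used_def)
    then show "\<phi> [] u \<le> F u" using F[OF inv(1)] by (simp add: \<phi>_def)
  next
    show "Inv [0..<N] (\<lambda>_. 0)" by (auto simp: Inv_def used_def)
  qed (use x s in auto)
  moreover have "used ?I (\<lambda>_. 0) = {}" by (auto simp: used_def)
  ultimately show ?thesis by (simp add: \<phi>_def \<theta>_def)
qed

lemma collision_junta_degree:
  fixes q :: "(nat \<Rightarrow> nat) \<Rightarrow> unit \<Rightarrow> real"
  assumes q: "junta_sum {..<2 * N} D q" and N: "N \<ge> 400"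
    and range: "\<And>v. (\<And>i. i < 2 * N \<Longrightarrow> v i \<le> 2 * N) \<Longrightarrow> 0 \<le> q v () \<and> q v () \<le> 21 / 20"
    and no: "\<And>v. (\<And>i. i < 2 * N \<Longrightarrow> v i \<le> 2 * N) \<Longrightarrow> \<not> shares N (2 * N) v \<Longrightarrow> q v () \<le> 23 / 60"
    and yes: "\<And>v. (\<And>i. i < 2 * N \<Longrightarrow> v i \<le> 2 * N) \<Longrightarrow> shares N (2 * N) v \<Longrightarrow> 37 / 60 \<le> q v ()"
  shows "real D \<ge> real N powr (2 / 3) / 1000"
proof -
  let ?I = "{..<2 * N}"
  define G where "G = sym_avg (2 * N) (\<lambda>v. q v ())"
  define \<Psi> where "\<Psi> s x = pexp ?I s x [0..<2 * N] G (\<lambda>_. 0)" for s x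
  have relabel_q: "0 \<le> q (relabel \<pi> u) () \<and> q (relabel \<pi> u) () \<le> 21 / 20"
      "shares N (2 * N) u \<Longrightarrow> 37 / 60 \<le> q (relabel \<pi> u) ()"
      "\<not> shares N (2 * N) u \<Longrightarrow> q (relabel \<pi> u) () \<le> 23 / 60"
    if "\<pi> permutes ?I" for \<pi> u
    using range[of "relabel \<pi> u"] yes[of "relabel \<pi> u"] no[of "relabel \<pi> u"]
      relabel_le[OF that] shares_relabel[OF that] by blast+
  have G: "0 \<le> G u" "G u \<le> 21 / 20" for u
    unfolding G_def using relabel_q(1) by (blast intro: sym_avg_ge sym_avg_le)+
  have G_no: "G u \<le> 23 / 60" if "\<not> shares N (2 * N) u" for u
    unfolding G_def using relabel_q(3)[OF _ that] by (blast intro: sym_avg_le)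
  have G_yes: "37 / 60 \<le> G u" if "shares N (2 * N) u" for u
    unfolding G_def using relabel_q(2)[OF _ that] by (blast intro: sym_avg_ge)
  have "bipoly D \<Psi>" using pexp_sym_avg_bipoly[OF q] unfolding \<Psi>_def G_def by simp
  then obtain g where g: "degree g \<le> D" "\<And>x. \<Psi> (1 / 2) x = poly g x"
    and h: "\<And>x. \<exists>h. degree h \<le> D \<and> (\<forall>s. \<Psi> s x = poly h s)"
    unfolding bipoly_def poly_fun_def by metis
  have empty: "used ?I (\<lambda>_. 0) = {}" by (auto simp: used_def)
  have grid: "0 \<le> \<Psi> (real K * x) x \<and> \<Psi> (real K * x) x \<le> 21 / 20" if "0 \<le> x" "real K * x \<le> 1" for K x
    unfolding \<Psi>_def using that G empty
    by (intro conjI pexp_lower_bound[where K = K] pexp_upper_bound[where K = K]) auto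
  have at_0: "\<Psi> (1 / 2) 0 \<le> 23 / 60"
    unfolding \<Psi>_def by (rule pexp_no_repetition) (use G_no in auto)
  \<comment> \<open>The resulting \<open>x0\<close> is about \<open>50 / N\<^sup>2\<close>. This is
    large enough for \<open>N * x0 * N / 8 \<ge> 6\<close>, so that a collision is missed with
    probability at most 1 / 64, and 37 / 60 times 63 / 64 still exceeds 3 / 5.\<close>
  define K where "K = N\<^sup>2 div 100"
  define x0 where "x0 = 1 / (2 * real K)"
  have "400 * 400 \<le> N * N" using N by (intro mult_mono) auto
  then have N2: "160000 \<le> real (N\<^sup>2)" by (simp add: power2_eq_square flip: of_nat_mult)
  have K: "real K \<le> real (N\<^sup>2) / 100" "real (N\<^sup>2) / 200 \<le> real K"
  proof -
    show "real K \<le> real (N\<^sup>2) / 100"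
    proof -
      have "real (100 * K) \<le> real (N\<^sup>2)" unfolding K_def of_nat_le_iff by (rule times_div_less_eq_dividend)
      then show ?thesis by simp
    qed
    have "N\<^sup>2 < 100 * K + 100" unfolding K_def using dividend_less_times_div[of 100 "N\<^sup>2"] by simp
    then have "real (N\<^sup>2) < real (100 * K + 100)" unfolding of_nat_less_iff .
    then have "real (N\<^sup>2) < 100 * (real K + 1)" by simp
    then show "real (N\<^sup>2) / 200 \<le> real K" using N2 by simp
  qed
  have Kpos: "real K > 0" using K N2 by linarith
  have x0: "0 < x0" "50 \<le> real N * (x0 * real N)" "x0 * real N \<le> 1 / 4"
  proof -
    show "0 < x0" using Kpos by (simp add: x0_def)
    have "real N * (x0 * real N) = real (N\<^sup>2) / (2 * real K)" by (simp add: x0_def power2_eq_square)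
    moreover have "50 \<le> real (N\<^sup>2) / (2 * real K)"
      using K(1) Kpos by (subst pos_le_divide_eq) linarith+
    ultimately show "50 \<le> real N * (x0 * real N)" by (simp only:)
    have "400 * real N \<le> real (N\<^sup>2)" using N by (simp add: power2_eq_square)
    then have "2 * real N \<le> real K" using K by linarith
    then show "x0 * real N \<le> 1 / 4" using Kpos by (simp add: x0_def field_simps)
  qed
  \<comment> \<open>With this \<open>y\<close> the probability \<open>(1 - x0 * c) ^ N\<close> that
    the second string misses \<open>c\<close> values is at most \<open>y ^ c\<close>, the geometric
    form handled by the first phase.\<close>
  define y where "y = exp (- (x0 * N))"
  have at_x0: "3 / 5 \<le> \<Psi> (1 / 2) x0"
  proof -
    have pow: "y ^ c = exp (- (x0 * real c)) ^ N" for c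
      by (simp add: y_def mult_ac flip: exp_of_nat_mult)
    have "37 / 60 * (1 - (1 - (1 - y) / 4) ^ N) \<le> pexp ?I (1 / 2) x0 [0..<N] (pexp ?I (1 / 2) x0 [N..<2 * N] G) (\<lambda>_. 0)"
    proof (rule pexp_first_phase)
      fix u assume c: "card (used ?I u) \<le> N"
      define c' where "c' = card (used {..<N} u)"
      have "c' \<le> card (used ?I u)" unfolding c'_def by (intro card_mono) (auto simp: used_def)
      then have "x0 * c' \<le> x0 * N" using c x0(1) by (intro mult_left_mono) simp_all
      then have "0 \<le> 1 - x0 * c'" using x0(3) by linarith
      then have "(1 - x0 * c') ^ N \<le> y ^ c'"
        unfolding pow using exp_ge_add_one_self[of "- (x0 * c')"] by (intro power_mono) auto
      then have "37 / 60 * (1 - y ^ c') \<le> 37 / 60 * (1 - (1 - x0 * c') ^ N)" by simp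
      also have "\<dots> \<le> pexp ?I (1 / 2) x0 [N..<2 * N] G u" unfolding c'_def
        using x0 c G G_yes by (intro pexp_second_phase) auto
      finally show "37 / 60 * (1 - y ^ card (used {..<N} u)) \<le> pexp ?I (1 / 2) x0 [N..<2 * N] G u"
        unfolding c'_def .
    qed (use x0 in \<open>auto simp: y_def\<close>)
    moreover have "[0..<2 * N] = [0..<N] @ [N..<2 * N]" using upt_add_eq_append[of 0 N N] by (simp add: mult_2)
    ultimately have 1: "37 / 60 * (1 - (1 - (1 - y) / 4) ^ N) \<le> \<Psi> (1 / 2) x0"
      by (simp add: \<Psi>_def pexp_append)
    define z where "z = x0 * real N"
    have z: "0 \<le> z" "z \<le> 1 / 4" using x0 by (auto simp: z_def)
    have "1 + z \<le> exp z" by (rule exp_ge_add_one_self)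
    have "y * (1 + z) \<le> y * exp z" unfolding y_def by (intro mult_left_mono exp_ge_add_one_self) simp
    also have "y * exp z = 1" by (simp add: y_def z_def flip: exp_add)
    finally have "y * (1 + z) \<le> 1" .
    moreover have "1 \<le> (1 - z / 2) * (1 + z)"
      using mult_nonneg_nonneg[of z "1 - z"] z by (simp add: algebra_simps)
    ultimately have "y * (1 + z) \<le> (1 - z / 2) * (1 + z)" by linarith
    then have "y \<le> 1 - z / 2" using z by (simp add: mult_le_cancel_right)
    then have "1 - (1 - y) / 4 \<le> 1 + - (z / 8)" by (simp add: field_simps)
    also have "\<dots> \<le> exp (- (z / 8))" by (rule exp_ge_add_one_self)
    finally have "1 - (1 - y) / 4 \<le> exp (- (z / 8))" .
    moreover have "0 \<le> 1 - (1 - y) / 4" by (simp add: y_def add_nonneg_nonneg diff_divide_distrib)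
    ultimately have "(1 - (1 - y) / 4) ^ N \<le> exp (- (z / 8)) ^ N" by (intro power_mono)
    also have "\<dots> = exp (- (real N * z / 8))" by (simp flip: exp_of_nat_mult)
    also have "\<dots> \<le> exp (- 6)" using x0(2) by (simp add: z_def)
    also have "\<dots> \<le> 1 / 64"
    proof -
      have "(2::real) ^ 6 \<le> exp 1 ^ 6" using exp_ge_add_one_self[of "1::real"] by (intro power_mono) auto
      then show ?thesis by (simp add: exp_minus field_simps flip: exp_of_nat_mult)
    qed
    finally show ?thesis using 1 by simp
  qed
  \<comment> \<open>The exponent balances the two cases. Boundedness up to \<open>1 / R\<close>
    forces a degree of order \<open>sqrt (1 / (R * x0))\<close>, that is \<open>N / sqrt R\<close>;
    a large value at some \<open>x \<le> 1 / R\<close> forces order \<open>1 / x\<close>, hence at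
    least order \<open>R\<close>.\<close>
  define R where "R = real N powr (2 / 3)"
  have "real N powr (2 / 3) \<ge> 400 powr (2 / 3)" using N by (intro powr_mono2) auto
  moreover have "(400::real) powr (2 / 3) \<ge> 8 powr (2 / 3)" by (intro powr_mono2) auto
  moreover have "(8::real) powr (2 / 3) = 4"
  proof -
    have "(8::real) = 2 powr 3" by simp
    then have "(8::real) powr (2 / 3) = 2 powr (3 * (2 / 3))" by (simp only: powr_powr)
    then show ?thesis by simp
  qed
  ultimately have R4: "R \<ge> 4" by (simp add: R_def)
  have R3: "R * R * R = real (N\<^sup>2)"
    using N by (simp add: R_def flip: powr_add)
  show ?thesis
  proof (cases "\<forall>x. 0 \<le> x \<longrightarrow> x \<le> 1 / R \<longrightarrow> \<bar>poly g x\<bar> \<le> 2")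
    case True
    have "x0 = 100 / (200 * real K)" by (simp add: x0_def)
    also have "\<dots> \<le> 100 / real (N\<^sup>2)"
    proof (rule divide_left_mono)
      show "real (N\<^sup>2) \<le> 200 * real K" using K(2) by linarith
      show "0 < 200 * real K * real (N\<^sup>2)" using Kpos N2 by (intro mult_pos_pos) linarith+
    qed simp
    also have "\<dots> = 100 / (R * R * R)" by (simp add: R3)
    finally have x0R: "x0 \<le> 100 / (R * R * R)" .
    have "400 \<le> R * R"
    proof (rule ccontr)
      assume "\<not> 400 \<le> R * R"
      then have "R < 20" using mult_mono[of 20 R 20 R] by force
      then have "R * R * R \<le> 20 * 20 * 20" using R4 by (intro mult_mono) auto
      then show False using R3 N2 by simp
    qed
    then have "x0 \<le> 1 / R / 4" using x0R R4 by (intro order_trans[OF x0R]) (simp add: field_simps)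
    then have "1 / 5 \<le> 20 * real D * sqrt (x0 / (1 / R))"
      using True R4 x0 at_0 at_x0 g by (intro degree_ge_of_jump_near_endpoint) auto
    also have "\<dots> \<le> 20 * real D * (10 / R)"
    proof (intro mult_left_mono real_le_lsqrt)
      have "x0 * R \<le> 100 / (R * R * R) * R" using x0R R4 by (intro mult_right_mono) auto
      then show "x0 / (1 / R) \<le> (10 / R)\<^sup>2" using R4 by (simp add: power2_eq_square)
    qed (use x0 R4 in auto)
    finally show ?thesis using R4 by (simp add: R_def[symmetric] field_simps)
  next
    case False
    then obtain x where x: "0 \<le> x" "x \<le> 1 / R" "\<bar>poly g x\<bar> > 2" by (auto simp: not_le)
    have "\<bar>\<Psi> (1 / 2) 0\<bar> \<le> 2"
      using at_0 pexp_no_repetition[of "1 / 2" N "\<lambda>u. - G u" 0 "[0..<2 * N]"] G(1)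
      by (simp add: pexp_uminus flip: \<Psi>_def)
    then have "x > 0" using x g(2)[of 0] by (cases "x = 0") auto
    obtain h where h: "degree h \<le> D" "\<And>s. \<Psi> s x = poly h s" using h by blast
    \<comment> \<open>The integer \<open>e\<close> now stands for \<open>s = e * x\<close>, a point
      with integral \<open>s / x\<close> where the expectation is bounded. The point
      \<open>s = 1 / 2\<close> becomes the midpoint of the interval from 0 to
      \<open>1 / x\<close>.\<close>
    define p where "p = pcompose h [:0, x:]"
    have "real D \<ge> 1 / (2 * x) / 200"
    proof (rule degree_ge_of_bounded_on_integers)
      show "degree p \<le> D" using h \<open>x > 0\<close> by (simp add: p_def degree_pcompose)
      have "R * x \<le> 1" using x R4 by (simp add: field_simps)
      moreover have "4 * x \<le> R * x" using R4 \<open>x > 0\<close> by (intro mult_right_mono) auto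
      ultimately have "4 * x \<le> 1" by linarith
      then show "2 \<le> 1 / (2 * x)" using \<open>x > 0\<close> by (simp add: field_simps)
      fix e :: nat assume "real e \<le> 2 * (1 / (2 * x))"
      then have "real e * x \<le> 1" using \<open>x > 0\<close> by (simp add: field_simps)
      then show "\<bar>poly p (real e)\<bar> \<le> 21 / 20"
        using grid[of x e] \<open>x > 0\<close> by (simp add: p_def poly_pcompose mult.commute flip: h(2))
    next
      show "2 < \<bar>poly p (1 / (2 * x))\<bar>"
        using x(3) \<open>x > 0\<close> by (simp add: p_def poly_pcompose flip: h(2) g(2))
    qed
    moreover have "R / 400 \<le> 1 / (2 * x) / 200" using x R4 \<open>x > 0\<close> by (simp add: field_simps)
    moreover have "R / 1000 \<le> R / 400" using R4 by simp
    ultimately show ?thesis unfolding R_def[symmetric] by linarith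
  qed
qed

section \<open>Composition with search\<close>

definition with_addr :: "(nat \<Rightarrow> 'a) \<Rightarrow> (nat \<Rightarrow> 'b) \<Rightarrow> nat \<Rightarrow> 'a \<times> 'b" where
  "with_addr y p i = (y i, p i)"

lemma with_addr_upd: "(with_addr y p)(i := (y i, r)) = with_addr y (p(i := r))"
  by (auto simp: with_addr_def)

lemma junta_sum_with_addr: "junta_sum I j f \<Longrightarrow> junta_sum I j (\<lambda>y k. f (with_addr y p) k)"
proof (induction rule: junta_sum.induct)
  case (junta S f)
  then show ?case by (intro junta_sum.junta[of S]) (auto simp: is_junta_def with_addr_def)
next
  case (add f g)
  then show ?case using junta_sum.add[OF add.IH] by simp
qed

text \<open>Coordinate \<open>c\<close> of the state queries offset \<open>r\<close> of block \<open>i\<close> if \<open>loc c = Some (i, r)\<close>. The oracle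
  permutes coordinates by \<open>\<tau> s\<close> when the symbol there is \<open>s\<close>, and by \<open>\<beta>\<close> when there is no hidden symbol.\<close>

locale hidden_query =
  fixes dim h :: nat and I :: "nat set" and loc :: "nat \<Rightarrow> (nat \<times> nat) option"
    and \<beta> :: "nat \<Rightarrow> nat" and \<tau> :: "nat \<Rightarrow> nat \<Rightarrow> nat"
    and U :: "nat \<Rightarrow> (nat \<Rightarrow> complex) \<Rightarrow> nat \<Rightarrow> complex" and v0 :: "nat \<Rightarrow> complex"
  assumes finite_I: "finite I" and h_pos: "h > 0"
    and loc: "loc c = Some (i, r) \<Longrightarrow> i \<in> I \<and> r < h"
    and \<beta>: "c < dim \<Longrightarrow> \<beta> c < dim \<and> \<beta> (\<beta> c) = c \<and> loc (\<beta> c) = loc c"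
    and \<tau>: "c < dim \<Longrightarrow> \<tau> s c < dim \<and> \<tau> s (\<tau> s c) = c \<and> loc (\<tau> s c) = loc c"
    and U_add: "U t (\<lambda>c. v c + w c) c = U t v c + U t w c"
    and U_norm: "(\<Sum>c<dim. (cmod (U t v c))\<^sup>2) \<le> (\<Sum>c<dim. (cmod (v c))\<^sup>2)"
    and v0_norm: "(\<Sum>c<dim. (cmod (v0 c))\<^sup>2) \<le> 1"
begin

definition query :: "((nat \<Rightarrow> nat \<times> nat) \<Rightarrow> nat \<Rightarrow> complex) \<Rightarrow> (nat \<Rightarrow> nat \<times> nat) \<Rightarrow> nat \<Rightarrow> complex" where
  "query \<Psi> x c = (case loc c of None \<Rightarrow> \<Psi> x (\<beta> c)
     | Some (i, r) \<Rightarrow> if snd (x i) = r then \<Psi> x (\<tau> (fst (x i)) c) else \<Psi> x (\<beta> c))"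

text \<open>\<open>hit\<close> is the part of a query that learns a hidden address: it acts on the component of the state that is
  uniform in the address of the queried block, and has norm \<open>O(1 / sqrt h)\<close>.\<close>

definition avg :: "nat \<Rightarrow> ((nat \<Rightarrow> nat \<times> nat) \<Rightarrow> nat \<Rightarrow> complex) \<Rightarrow> (nat \<Rightarrow> nat \<times> nat) \<Rightarrow> nat \<Rightarrow> complex" where
  "avg i \<Psi> x c = (\<Sum>r<h. \<Psi> (x(i := (fst (x i), r))) c) / of_nat h"

definition hit :: "((nat \<Rightarrow> nat \<times> nat) \<Rightarrow> nat \<Rightarrow> complex) \<Rightarrow> (nat \<Rightarrow> nat \<times> nat) \<Rightarrow> nat \<Rightarrow> complex" where
  "hit \<Psi> x c = (case loc c of None \<Rightarrow> 0
     | Some (i, r) \<Rightarrow> if snd (x i) = r then avg i \<Psi> x (\<tau> (fst (x i)) c) - avg i \<Psi> x (\<beta> c) else 0)"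

definition rest :: "((nat \<Rightarrow> nat \<times> nat) \<Rightarrow> nat \<Rightarrow> complex) \<Rightarrow> (nat \<Rightarrow> nat \<times> nat) \<Rightarrow> nat \<Rightarrow> complex" where
  "rest \<Psi> x c = query \<Psi> x c - hit \<Psi> x c"

primrec state :: "nat \<Rightarrow> (nat \<Rightarrow> nat \<times> nat) \<Rightarrow> nat \<Rightarrow> complex" where
  "state 0 x = v0"
| "state (Suc t) x = U t (query (state t) x)"

text \<open>\<open>hist t j\<close> is the part of the state after \<open>t\<close> queries in which exactly \<open>j\<close> queries were hits.\<close>

primrec hist :: "nat \<Rightarrow> nat \<Rightarrow> (nat \<Rightarrow> nat \<times> nat) \<Rightarrow> nat \<Rightarrow> complex" where
  "hist 0 j x = (if j = 0 then v0 else (\<lambda>c. 0))"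
| "hist (Suc t) j x =
     U t (\<lambda>c. rest (hist t j) x c + (case j of 0 \<Rightarrow> 0 | Suc j' \<Rightarrow> hit (hist t j') x c))"

lemma U_zero: "U t (\<lambda>c. 0) c = 0"
  using U_add[of t "\<lambda>_. 0" "\<lambda>_. 0" c] by simp

lemma U_sum: "finite A \<Longrightarrow> U t (\<lambda>c. \<Sum>a\<in>A. v a c) c = (\<Sum>a\<in>A. U t (v a) c)"
  by (induction rule: finite_induct) (simp_all add: U_zero U_add)

lemma avg_add: "avg i (\<lambda>x c. f x c + g x c) x c = avg i f x c + avg i g x c"
  by (simp add: avg_def sum.distrib add_divide_distrib)

lemma hit_add: "hit (\<lambda>x c. f x c + g x c) x c = hit f x c + hit g x c"
  by (simp add: hit_def avg_add split: option.split)

lemma query_add: "query (\<lambda>x c. f x c + g x c) x c = query f x c + query g x c"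
  by (simp add: query_def split: option.split)

lemma query_sum: "query (\<lambda>x c. \<Sum>a\<in>A. f a x c) x c = (\<Sum>a\<in>A. query (f a) x c)"
  by (simp add: query_def split: option.split)

lemma rest_add: "rest (\<lambda>x c. f x c + g x c) x c = rest f x c + rest g x c"
  by (simp add: rest_def query_add hit_add)

lemma avg_junta:
  assumes "is_junta S f" "i \<notin> S"
  shows "avg i f x c = f x c"
proof -
  have "f (x(i := (fst (x i), r))) = f x" for r
    using assms by (auto simp: is_junta_def)
  then show ?thesis using h_pos by (simp add: avg_def)
qed

lemma avg_cong:
  assumes "is_junta S f" "\<And>k. k \<in> S \<Longrightarrow> x k = x' k" "fst (x i) = fst (x' i)"
  shows "avg i f x c = avg i f x' c"
proof -
  have "f (x(i := (fst (x i), r))) = f (x'(i := (fst (x' i), r)))" for r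
    using assms(1) unfolding is_junta_def by (rule allE, elim allE impE) (use assms(2,3) in auto)
  then show ?thesis by (simp add: avg_def)
qed

text \<open>A block whose address has not been touched contributes to \<open>rest\<close> only through the blank oracle,
  so \<open>rest\<close> does not enlarge the set of relevant blocks.\<close>

lemma rest_junta_sum: "junta_sum I j f \<Longrightarrow> junta_sum I j (rest f)"
proof (induction rule: junta_sum.induct)
  case (junta S f)
  have "is_junta S (rest f)"
    unfolding is_junta_def
  proof (intro allI impI ext)
    fix x x' :: "nat \<Rightarrow> nat \<times> nat" and c assume eq: "\<forall>i\<in>S. x i = x' i"
    then have f: "f x = f x'" using junta(4) by (simp add: is_junta_def)
    show "rest f x c = rest f x' c"
    proof (cases "loc c")
      case None
      then show ?thesis by (simp add: rest_def query_def hit_def f)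
    next
      case (Some b)
      obtain i r where b: "b = (i, r)" by force
      show ?thesis
      proof (cases "i \<in> S")
        case True
        then have "avg i f x = avg i f x'"
          using avg_cong[OF junta(4), of x x' i] eq by auto
        then show ?thesis using True eq by (simp add: rest_def query_def hit_def f Some b)
      next
        case False
        then show ?thesis
          by (simp add: rest_def query_def hit_def f Some b avg_junta[OF junta(4)])
      qed
    qed
  qed
  then show ?case using junta by (intro junta_sum.junta[of S]) auto
next
  case (add f g)
  have "rest (\<lambda>x k. f x k + g x k) = (\<lambda>x k. rest f x k + rest g x k)" by (intro ext rest_add)
  then show ?case using junta_sum.add[OF add.IH] by simp
qed

text \<open>At coordinates that query block \<open>i\<close>, a hit involves the old blocks and
  \<open>i\<close>. Sorting coordinates by the queried block writes \<open>hit f\<close> as a sum of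
  such terms; how many terms there are is irrelevant to the bound.\<close>

lemma hit_junta_sum: "junta_sum I j f \<Longrightarrow> junta_sum I (Suc j) (hit f)"
proof (induction rule: junta_sum.induct)
  case (junta S f)
  define g where "g i x c = (case loc c of None \<Rightarrow> 0 | Some (i', r) \<Rightarrow> if i' = i then hit f x c else 0)" for i x c
  have "junta_sum I (Suc j) (g i)" if "i \<in> I" for i
  proof (rule junta_sum.junta[of "insert i S"])
    show "card (insert i S) \<le> Suc j" using junta by (simp add: card_insert_if)
    show "is_junta (insert i S) (g i)"
      unfolding is_junta_def
    proof (intro allI impI ext)
      fix x x' :: "nat \<Rightarrow> nat \<times> nat" and c assume eq: "\<forall>k\<in>insert i S. x k = x' k"
      then have "avg i f x = avg i f x'" using avg_cong[OF junta(4), of x x' i] by auto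
      then show "g i x c = g i x' c" using eq by (simp add: g_def hit_def split: option.split)
    qed
  qed (use junta that in auto)
  then have "junta_sum I (Suc j) (\<lambda>x c. \<Sum>i\<in>I. g i x c)" by (rule junta_sum_sum[OF finite_I])
  moreover have "(\<Sum>i\<in>I. g i x c) = hit f x c" for x c
  proof (cases "loc c")
    case None
    then show ?thesis by (simp add: g_def hit_def)
  next
    case (Some b)
    obtain i r where "b = (i, r)" by force
    then show ?thesis using Some loc[of c i r] finite_I by (simp add: g_def)
  qed
  ultimately show ?case by simp
next
  case (add f g)
  have "hit (\<lambda>x k. f x k + g x k) = (\<lambda>x k. hit f x k + hit g x k)" by (intro ext hit_add)
  then show ?case using junta_sum.add[OF add.IH] by simp
qed

lemma hist_junta_sum: "junta_sum I j (hist t j)"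
proof (induction t arbitrary: j)
  case 0
  have "hist 0 j = (\<lambda>x. if j = 0 then v0 else (\<lambda>c. 0))" by (simp add: fun_eq_iff)
  then show ?case by (simp add: junta_sum_const)
next
  case (Suc t)
  have "junta_sum I j (\<lambda>x c. rest (hist t j) x c + (case j of 0 \<Rightarrow> 0 | Suc j' \<Rightarrow> hit (hist t j') x c))"
  proof (rule junta_sum.add[OF rest_junta_sum[OF Suc]])
    show "junta_sum I j (\<lambda>x c. case j of 0 \<Rightarrow> 0 | Suc j' \<Rightarrow> hit (hist t j') x c)"
      using hit_junta_sum[OF Suc] junta_sum_const by (cases j) auto
  qed
  then have "junta_sum I j (\<lambda>x. U t (\<lambda>c. rest (hist t j) x c + (case j of 0 \<Rightarrow> 0 | Suc j' \<Rightarrow> hit (hist t j') x c)))"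
    by (rule junta_sum_map) (rule U_add)
  then show ?case by (simp add: fun_eq_iff)
qed

lemma hist_zero: "t < j \<Longrightarrow> hist t j x c = 0"
proof (induction t arbitrary: j x c)
  case (Suc t)
  have 1: "hist t j = (\<lambda>x c. 0)" by (intro ext Suc.IH) (use Suc.prems in simp)
  have 2: "hist t (j - 1) = (\<lambda>x c. 0)" by (intro ext Suc.IH) (use Suc.prems in simp)
  have "rest (\<lambda>x c. 0) x c = 0" "hit (\<lambda>x c. 0) x c = 0" for c
    by (simp_all add: rest_def query_def hit_def avg_def split: option.split)
  then show ?case using 1 2 Suc.prems by (cases j) (simp_all add: U_zero)
qed simp

lemma state_eq_sum_hist: "t < M \<Longrightarrow> state t x c = (\<Sum>j<M. hist t j x c)"
proof (induction t arbitrary: x c M)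
  case 0
  then show ?case by (simp add: lessThan_def if_distrib if_distribR sum.delta cong: if_cong)
next
  case (Suc t)
  then obtain M' where M: "M = Suc M'" "t < M'" by (cases M) auto
  have "query (state t) x c = (\<Sum>j<M. rest (hist t j) x c + (case j of 0 \<Rightarrow> 0 | Suc j' \<Rightarrow> hit (hist t j') x c))" for c
  proof -
    have "state t = (\<lambda>x c. \<Sum>j<M'. hist t j x c)" using Suc.IH[OF M(2)] by blast
    then have "query (state t) x c = (\<Sum>j<M'. rest (hist t j) x c) + (\<Sum>j<M'. hit (hist t j) x c)"
      by (simp add: query_sum rest_def flip: sum.distrib)
    moreover have "hist t M' = (\<lambda>x c. 0)" using hist_zero[OF M(2)] by blast
    then have "rest (hist t M') x c = 0"
      by (simp add: rest_def query_def hit_def avg_def split: option.split)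
    then have "(\<Sum>j<M'. rest (hist t j) x c) = (\<Sum>j<M. rest (hist t j) x c)" by (simp add: M)
    moreover have "(\<Sum>j<M. case j of 0 \<Rightarrow> 0 | Suc j' \<Rightarrow> hit (hist t j') x c) = (\<Sum>j<M'. hit (hist t j) x c)"
      unfolding M sum.lessThan_Suc_shift by simp
    ultimately show ?thesis by (simp only: sum.distrib)
  qed
  then have "query (state t) x =
      (\<lambda>c. \<Sum>j<M. rest (hist t j) x c + (case j of 0 \<Rightarrow> 0 | Suc j' \<Rightarrow> hit (hist t j') x c))"
    by blast
  then show ?case unfolding state.simps hist.simps by (simp only: U_sum[OF finite_lessThan])
qed

section \<open>Norms over random addresses\<close>

definition P :: "(nat \<Rightarrow> nat) set" where
  "P = (\<Pi>\<^sub>E i\<in>I. {..<h})"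

lemma finite_P: "finite P" and card_P: "card P > 0"
proof -
  show "finite P" unfolding P_def using finite_I by (rule finite_PiE) simp
  have "card P = h ^ card I" unfolding P_def using finite_I by (simp add: card_PiE)
  then show "card P > 0" using h_pos by simp
qed

definition sqn :: "(nat \<Rightarrow> nat) \<Rightarrow> ((nat \<Rightarrow> nat \<times> nat) \<Rightarrow> nat \<Rightarrow> complex) \<Rightarrow> real" where
  "sqn y \<Psi> = (\<Sum>p\<in>P. \<Sum>c<dim. (cmod (\<Psi> (with_addr y p) c))\<^sup>2)"

text \<open>The states for all addresses are stacked into one vector while the symbols
  \<open>y\<close> stay fixed. There is no division by the number of addresses, so a family of unit
  states has norm \<open>sqrt (card P)\<close>.\<close>

definition nrm :: "(nat \<Rightarrow> nat) \<Rightarrow> ((nat \<Rightarrow> nat \<times> nat) \<Rightarrow> nat \<Rightarrow> complex) \<Rightarrow> real" where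
  "nrm y \<Psi> = L2_set (\<lambda>(p, c). cmod (\<Psi> (with_addr y p) c)) (P \<times> {..<dim})"

lemma nrm_eq: "nrm y \<Psi> = sqrt (sqn y \<Psi>)"
  by (simp add: nrm_def sqn_def L2_set_def sum.cartesian_product case_prod_unfold)

lemma nrm_nonneg: "0 \<le> nrm y \<Psi>"
  by (simp add: nrm_def)

lemma nrm_triangle: "nrm y (\<lambda>x c. f x c + g x c) \<le> nrm y f + nrm y g"
proof -
  have "nrm y (\<lambda>x c. f x c + g x c) \<le> L2_set (\<lambda>pc. (case pc of (p, c) \<Rightarrow> cmod (f (with_addr y p) c))
      + (case pc of (p, c) \<Rightarrow> cmod (g (with_addr y p) c))) (P \<times> {..<dim})"
    unfolding nrm_def by (rule L2_set_mono) (auto simp: norm_triangle_ineq)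
  also have "\<dots> \<le> nrm y f + nrm y g" unfolding nrm_def by (rule L2_set_triangle_ineq)
  finally show ?thesis .
qed

lemma nrm_uminus: "nrm y (\<lambda>x c. - f x c) = nrm y f"
  by (simp add: nrm_def)

lemma nrm_sum: "finite A \<Longrightarrow> nrm y (\<lambda>x c. \<Sum>a\<in>A. f a x c) \<le> (\<Sum>a\<in>A. nrm y (f a))"
proof (induction rule: finite_induct)
  case empty
  then show ?case by (simp add: nrm_def L2_set_def case_prod_unfold)
next
  case (insert a A)
  then show ?case using nrm_triangle[of y "f a" "\<lambda>x c. \<Sum>a\<in>A. f a x c"] by simp
qed

lemma nrm_U: "nrm y (\<lambda>x. U t (\<Psi> x)) \<le> nrm y \<Psi>"
  unfolding nrm_eq sqn_def by (intro real_sqrt_le_mono sum_mono U_norm)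

lemma nrm_query: "nrm y (query \<Psi>) = nrm y \<Psi>"
proof -
  have "(\<Sum>c<dim. (cmod (query \<Psi> (with_addr y p) c))\<^sup>2) = (\<Sum>c<dim. (cmod (\<Psi> (with_addr y p) c))\<^sup>2)" for p
  proof -
    define \<sigma> where "\<sigma> c = (case loc c of None \<Rightarrow> \<beta> c | Some (i, r) \<Rightarrow> if p i = r then \<tau> (y i) c else \<beta> c)" for c
    have \<sigma>: "\<sigma> c < dim" "\<sigma> (\<sigma> c) = c" if "c < dim" for c
      using \<beta>[OF that] \<tau>[OF that] by (auto simp: \<sigma>_def split: option.splits)
    have "query \<Psi> (with_addr y p) c = \<Psi> (with_addr y p) (\<sigma> c)" for c
      by (simp add: query_def \<sigma>_def with_addr_def split: option.split)
    then show ?thesis by (intro sum.reindex_bij_witness[of _ \<sigma> \<sigma>]) (auto simp: \<sigma>)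
  qed
  then show ?thesis by (simp add: nrm_eq sqn_def)
qed

lemma cmod_avg_sq_le:
  "(cmod (avg i \<Psi> (with_addr y p) c))\<^sup>2 \<le> (\<Sum>r<h. (cmod (\<Psi> (with_addr y (p(i := r))) c))\<^sup>2) / h"
proof -
  define a where "a r = cmod (\<Psi> (with_addr y (p(i := r))) c)" for r
  have "cmod (avg i \<Psi> (with_addr y p) c) \<le> (\<Sum>r<h. a r) / h"
    unfolding avg_def norm_divide a_def
    using norm_sum[of "\<lambda>r. \<Psi> ((with_addr y p)(i := (fst (with_addr y p i), r))) c" "{..<h}"]
    by (simp add: divide_right_mono with_addr_upd with_addr_def[of y p i])
  then have "(cmod (avg i \<Psi> (with_addr y p) c))\<^sup>2 \<le> ((\<Sum>r<h. a r) / h)\<^sup>2" by (intro power_mono) auto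
  also have "\<dots> = (\<Sum>r<h. a r)\<^sup>2 / (real h)\<^sup>2" by (rule power_divide)
  also have "\<dots> \<le> ((\<Sum>r<h. (a r)\<^sup>2) * h) / (real h)\<^sup>2"
    using sum_squared_le_sum_of_squares[of a "{..<h}"] by (intro divide_right_mono) (simp_all add: mult.commute)
  also have "\<dots> = (\<Sum>r<h. (a r)\<^sup>2) / h" using h_pos by (simp add: power2_eq_square)
  finally show ?thesis unfolding a_def .
qed

lemma sum_P_split:
  assumes "i \<in> I" "r < h"
  shows "(\<Sum>p | p \<in> P \<and> p i = r. \<Sum>r'<h. f (p(i := r'))) = sum f P"
proof -
  have "(\<Sum>p | p \<in> P \<and> p i = r. \<Sum>r'<h. f (p(i := r'))) =
      (\<Sum>(p, r')\<in>{p. p \<in> P \<and> p i = r} \<times> {..<h}. f (p(i := r')))"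
    by (rule sum.cartesian_product)
  also have "\<dots> = sum f P"
    using assms by (intro sum.reindex_bij_witness[of _ "\<lambda>p. (p(i := r), p i)" "\<lambda>(p, r'). p(i := r')"])
      (auto simp: P_def PiE_iff extensional_def)
  finally show ?thesis .
qed

text \<open>A coordinate querying \<open>(i, r)\<close> is hit only if \<open>p i = r\<close>, which
  holds for one address in \<open>h\<close>, and the averaged amplitude does not depend on
  \<open>p i\<close>. With Cauchy-Schwarz the squared norm shrinks by \<open>h\<close>. The factor 4
  pays for the difference of two terms, each of which merely permutes coordinates.\<close>

lemma nrm_hit: "nrm y (hit \<Psi>) \<le> 2 / sqrt h * nrm y \<Psi>"
proof -
  define a where "a p c = (case loc c of None \<Rightarrow> 0
    | Some (i, r) \<Rightarrow> if p i = r then (cmod (avg i \<Psi> (with_addr y p) c))\<^sup>2 else 0)" for p c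
  have inner: "(\<Sum>c<dim. (cmod (hit \<Psi> (with_addr y p) c))\<^sup>2) \<le> 4 * (\<Sum>c<dim. a p c)" for p
  proof -
    define \<sigma> where "\<sigma> c = (case loc c of None \<Rightarrow> c | Some (i, r) \<Rightarrow> \<tau> (y i) c)" for c
    have \<sigma>: "\<sigma> c < dim" "\<sigma> (\<sigma> c) = c" if "c < dim" for c
      using \<tau>[OF that] that by (auto simp: \<sigma>_def split: option.splits)
    have "(cmod (hit \<Psi> (with_addr y p) c))\<^sup>2 \<le> 2 * a p (\<sigma> c) + 2 * a p (\<beta> c)" if "c < dim" for c
    proof (cases "loc c")
      case None
      then show ?thesis using \<beta>[OF that] by (simp add: hit_def a_def \<sigma>_def)
    next
      case (Some b)
      obtain i r where b: "b = (i, r)" by force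
      have sq: "(cmod (u - v))\<^sup>2 \<le> 2 * (cmod u)\<^sup>2 + 2 * (cmod v)\<^sup>2" for u v
      proof -
        have "(cmod (u - v))\<^sup>2 \<le> (cmod u + cmod v)\<^sup>2" by (intro power_mono norm_triangle_ineq4) simp
        also have "\<dots> \<le> 2 * (cmod u)\<^sup>2 + 2 * (cmod v)\<^sup>2"
          using zero_le_power2[of "cmod u - cmod v"] by (simp add: power2_eq_square algebra_simps)
        finally show ?thesis .
      qed
      show ?thesis using sq \<beta>[OF that] \<tau>[OF that, of "y i"]
        by (simp add: hit_def a_def \<sigma>_def Some b with_addr_def)
    qed
    then have "(\<Sum>c<dim. (cmod (hit \<Psi> (with_addr y p) c))\<^sup>2) \<le> (\<Sum>c<dim. 2 * a p (\<sigma> c) + 2 * a p (\<beta> c))"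
      by (intro sum_mono) simp
    also have "\<dots> = 2 * (\<Sum>c<dim. a p (\<sigma> c)) + 2 * (\<Sum>c<dim. a p (\<beta> c))"
      by (simp add: sum.distrib sum_distrib_left)
    also have "(\<Sum>c<dim. a p (\<sigma> c)) = (\<Sum>c<dim. a p c)"
      by (rule sum.reindex_bij_witness[of _ \<sigma> \<sigma>]) (auto simp: \<sigma>)
    also have "(\<Sum>c<dim. a p (\<beta> c)) = (\<Sum>c<dim. a p c)"
      by (rule sum.reindex_bij_witness[of _ \<beta> \<beta>]) (use \<beta> in auto)
    finally show ?thesis by simp
  qed
  have outer: "(\<Sum>p\<in>P. a p c) \<le> (\<Sum>p\<in>P. (cmod (\<Psi> (with_addr y p) c))\<^sup>2) / h" for c
  proof (cases "loc c")
    case None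
    then show ?thesis by (simp add: a_def sum_nonneg)
  next
    case (Some b)
    obtain i r where b: "b = (i, r)" by force
    then have ir: "i \<in> I" "r < h" using loc[of c i r] Some by auto
    have "(\<Sum>p\<in>P. a p c) = (\<Sum>p | p \<in> P \<and> p i = r. (cmod (avg i \<Psi> (with_addr y p) c))\<^sup>2)"
      using finite_P by (simp add: a_def Some b sum.inter_filter)
    also have "\<dots> \<le> (\<Sum>p | p \<in> P \<and> p i = r. (\<Sum>r'<h. (cmod (\<Psi> (with_addr y (p(i := r'))) c))\<^sup>2) / h)"
      by (intro sum_mono cmod_avg_sq_le)
    also have "\<dots> = (\<Sum>p\<in>P. (cmod (\<Psi> (with_addr y p) c))\<^sup>2) / h"
      unfolding sum_divide_distrib[symmetric]
      using sum_P_split[OF ir, of "\<lambda>p. (cmod (\<Psi> (with_addr y p) c))\<^sup>2"] by simp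
    finally show ?thesis .
  qed
  have "sqn y (hit \<Psi>) \<le> (\<Sum>p\<in>P. 4 * (\<Sum>c<dim. a p c))"
    unfolding sqn_def by (intro sum_mono inner)
  also have "\<dots> = 4 * (\<Sum>c<dim. \<Sum>p\<in>P. a p c)"
    by (simp only: sum_distrib_left[symmetric] sum.swap[of a "{..<dim}" P])
  also have "\<dots> \<le> 4 * (\<Sum>c<dim. (\<Sum>p\<in>P. (cmod (\<Psi> (with_addr y p) c))\<^sup>2) / h)"
    by (intro mult_left_mono sum_mono outer) simp
  also have "\<dots> = 4 / h * sqn y \<Psi>"
    unfolding sqn_def sum_divide_distrib[symmetric]
    using sum.swap[of "\<lambda>p c. (cmod (\<Psi> (with_addr y p) c))\<^sup>2" "{..<dim}" P] by simp
  finally have "nrm y (hit \<Psi>) \<le> sqrt (4 / h * sqn y \<Psi>)" unfolding nrm_eq by (rule real_sqrt_le_mono)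
  also have "\<dots> = 2 / sqrt h * nrm y \<Psi>" by (simp add: nrm_eq real_sqrt_mult real_sqrt_divide)
  finally show ?thesis .
qed

lemma nrm_rest: "nrm y (rest \<Psi>) \<le> (1 + 2 / sqrt h) * nrm y \<Psi>"
proof -
  have "rest \<Psi> = (\<lambda>x c. query \<Psi> x c + - hit \<Psi> x c)" by (simp add: rest_def fun_eq_iff)
  then have "nrm y (rest \<Psi>) \<le> nrm y (query \<Psi>) + nrm y (hit \<Psi>)"
    using nrm_triangle[of y "query \<Psi>" "\<lambda>x c. - hit \<Psi> x c"] by (simp add: nrm_uminus)
  then show ?thesis using nrm_hit[of y \<Psi>] by (simp add: nrm_query algebra_simps)
qed

lemma nrm_v0: "nrm y (\<lambda>x. v0) \<le> sqrt (card P)"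
  unfolding nrm_eq sqn_def
  using v0_norm by (intro real_sqrt_le_mono) (simp add: mult_left_le)

text \<open>The variable \<open>z\<close> marks hits. With \<open>\<delta> = 2 / sqrt h\<close>, one
  query contributes at most \<open>1 + \<delta>\<close> through \<open>rest\<close>, which is an
  isometry minus a hit, and \<open>\<delta> * z\<close> through a new hit.\<close>

lemma nrm_hist_generating:
  assumes "z \<ge> 0"
  shows "(\<Sum>j<M. z ^ j * nrm y (hist t j)) \<le> (1 + 2 / sqrt h * (1 + z)) ^ t * sqrt (card P)"
proof (induction t)
  case 0
  show ?case
  proof (cases M)
    case (Suc M')
    have "hist 0 0 = (\<lambda>x. v0)" "hist 0 (Suc j) = (\<lambda>x c. 0)" for j by (auto simp: fun_eq_iff)
    moreover have "nrm y (\<lambda>x c. 0) = 0" by (simp add: nrm_def L2_set_def case_prod_unfold)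
    ultimately show ?thesis unfolding Suc sum.lessThan_Suc_shift using nrm_v0[of y]
      by (simp del: hist.simps)
  qed simp
next
  case (Suc t)
  define \<delta> where "\<delta> = 2 / sqrt h"
  define n where "n j = nrm y (hist t j)" for j
  have \<delta>: "\<delta> \<ge> 0" by (simp add: \<delta>_def)
  have n: "n j \<ge> 0" for j by (simp add: n_def nrm_nonneg)
  have step0: "nrm y (hist (Suc t) 0) \<le> (1 + \<delta>) * n 0"
  proof -
    have "hist (Suc t) 0 = (\<lambda>x. U t (rest (hist t 0) x))" by (simp add: fun_eq_iff)
    then show ?thesis
      using nrm_U[of y t "rest (hist t 0)"] nrm_rest[of y "hist t 0"] by (simp add: n_def \<delta>_def)
  qed
  have step: "nrm y (hist (Suc t) (Suc j)) \<le> (1 + \<delta>) * n (Suc j) + \<delta> * n j" for j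
  proof -
    have "hist (Suc t) (Suc j) = (\<lambda>x. U t (\<lambda>c. rest (hist t (Suc j)) x c + hit (hist t j) x c))"
      by (simp add: fun_eq_iff)
    then have "nrm y (hist (Suc t) (Suc j)) \<le> nrm y (\<lambda>x c. rest (hist t (Suc j)) x c + hit (hist t j) x c)"
      by (simp only: nrm_U)
    also have "\<dots> \<le> nrm y (rest (hist t (Suc j))) + nrm y (hit (hist t j))" by (rule nrm_triangle)
    finally show ?thesis using nrm_rest[of y "hist t (Suc j)"] nrm_hit[of y "hist t j"]
      by (simp add: n_def \<delta>_def)
  qed
  have "(\<Sum>j<M. z ^ j * nrm y (hist (Suc t) j)) \<le> (1 + \<delta> * (1 + z)) * (\<Sum>j<M. z ^ j * n j)"
  proof (cases M)
    case (Suc M')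
    have "(\<Sum>j<M. z ^ j * nrm y (hist (Suc t) j))
        = nrm y (hist (Suc t) 0) + (\<Sum>j<M'. z ^ Suc j * nrm y (hist (Suc t) (Suc j)))"
      unfolding Suc sum.lessThan_Suc_shift by (simp del: hist.simps)
    also have "\<dots> \<le> (1 + \<delta>) * n 0 + (\<Sum>j<M'. z ^ Suc j * ((1 + \<delta>) * n (Suc j) + \<delta> * n j))"
      using assms step0 step by (intro add_mono sum_mono mult_left_mono) (auto simp del: hist.simps)
    also have "\<dots> = (1 + \<delta>) * (n 0 + (\<Sum>j<M'. z ^ Suc j * n (Suc j))) + \<delta> * z * (\<Sum>j<M'. z ^ j * n j)"
      by (simp add: sum.distrib sum_distrib_left algebra_simps)
    also have "n 0 + (\<Sum>j<M'. z ^ Suc j * n (Suc j)) = (\<Sum>j<M. z ^ j * n j)"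
      unfolding Suc sum.lessThan_Suc_shift by simp
    also have "(1 + \<delta>) * (\<Sum>j<M. z ^ j * n j) + \<delta> * z * (\<Sum>j<M'. z ^ j * n j)
        \<le> (1 + \<delta>) * (\<Sum>j<M. z ^ j * n j) + \<delta> * z * (\<Sum>j<M. z ^ j * n j)"
      using assms \<delta> n by (intro add_mono mult_left_mono sum_mono2) (auto simp: Suc)
    also have "\<dots> = (1 + \<delta> * (1 + z)) * (\<Sum>j<M. z ^ j * n j)" by (simp add: algebra_simps)
    finally show ?thesis .
  qed simp
  also have "\<dots> \<le> (1 + \<delta> * (1 + z)) * ((1 + \<delta> * (1 + z)) ^ t * sqrt (card P))"
    using Suc assms \<delta> unfolding n_def \<delta>_def[symmetric] by (intro mult_left_mono) auto
  finally show ?case unfolding \<delta>_def power_Suc mult.assoc .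
qed

text \<open>A Chernoff-type bound with \<open>z = 200\<close>, whence
  \<open>402 = 2 * (1 + 200)\<close>. Parts with more than \<open>J\<close> hits carry weight at
  least \<open>200 ^ Suc J\<close>, while the generating function is at most
  \<open>exp (402 * t / sqrt h)\<close> and so at most \<open>3 ^ Suc J\<close>, up to the factor
  \<open>sqrt (card P)\<close>.\<close>

lemma nrm_tail:
  assumes J: "real (Suc J) \<ge> 402 * real t / sqrt h"
  shows "nrm y (\<lambda>x c. state t x c - (\<Sum>j<Suc J. hist t j x c)) \<le> 3 / 200 * sqrt (card P)"
proof -
  define M where "M = t + J + 2"
  have "{..<M} = {..<Suc J} \<union> {Suc J..<M}" "{..<Suc J} \<inter> {Suc J..<M} = {}" by (auto simp: M_def)
  then have "(\<Sum>j<M. hist t j x c) = (\<Sum>j<Suc J. hist t j x c) + (\<Sum>j\<in>{Suc J..<M}. hist t j x c)" for x c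
    by (simp only: sum.union_disjoint finite_lessThan finite_atLeastLessThan)
  then have diff: "state t x c - (\<Sum>j<Suc J. hist t j x c) = (\<Sum>j\<in>{Suc J..<M}. hist t j x c)" for x c
    using state_eq_sum_hist[of t M x c] by (simp add: M_def)
  have "200 ^ Suc J * nrm y (\<lambda>x c. \<Sum>j\<in>{Suc J..<M}. hist t j x c)
      \<le> 200 ^ Suc J * (\<Sum>j\<in>{Suc J..<M}. nrm y (hist t j))"
    by (intro mult_left_mono nrm_sum) simp_all
  also have "\<dots> = (\<Sum>j\<in>{Suc J..<M}. 200 ^ Suc J * nrm y (hist t j))" by (rule sum_distrib_left)
  also have "\<dots> \<le> (\<Sum>j\<in>{Suc J..<M}. 200 ^ j * nrm y (hist t j))"
    by (intro sum_mono mult_right_mono power_increasing nrm_nonneg) auto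
  also have "\<dots> \<le> (\<Sum>j<M. 200 ^ j * nrm y (hist t j))"
    by (intro sum_mono2) (auto simp: nrm_nonneg)
  also have "\<dots> \<le> (1 + 2 / sqrt h * (1 + 200)) ^ t * sqrt (card P)"
    by (rule nrm_hist_generating) simp
  also have "\<dots> \<le> 3 ^ Suc J * sqrt (card P)"
  proof (rule mult_right_mono)
    have "(1 + 2 / sqrt h * (1 + 200)) ^ t \<le> exp (2 / sqrt h * (1 + 200)) ^ t"
      by (intro power_mono exp_ge_add_one_self) (simp add: add_nonneg_nonneg)
    also have "\<dots> = exp (402 * real t / sqrt h)" by (simp flip: exp_of_nat_mult add: mult.commute)
    also have "\<dots> \<le> exp (real (Suc J))" using J by simp
    also have "\<dots> = exp 1 ^ Suc J" using exp_of_nat_mult[of "Suc J" "1 :: real"] by (simp only: mult_1_right)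
    also have "\<dots> \<le> 3 ^ Suc J" by (intro power_mono exp_le) simp
    finally show "(1 + 2 / sqrt h * (1 + 200)) ^ t \<le> 3 ^ Suc J" .
  qed simp
  finally have "nrm y (\<lambda>x c. \<Sum>j\<in>{Suc J..<M}. hist t j x c) \<le> (3 / 200) ^ Suc J * sqrt (card P)"
    by (simp add: power_divide field_simps)
  also have "\<dots> \<le> 3 / 200 * sqrt (card P)"
  proof (rule mult_right_mono)
    show "(3 / 200 :: real) ^ Suc J \<le> 3 / 200" using power_le_one[of "3 / 200 :: real" J] by simp
  qed simp
  finally show ?thesis by (simp only: diff)
qed

lemma nrm_state: "nrm y (state t) \<le> sqrt (card P)"
proof (induction t)
  case 0
  have "state 0 = (\<lambda>x. v0)" by (simp add: fun_eq_iff)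
  then show ?case using nrm_v0 by simp
next
  case (Suc t)
  have "state (Suc t) = (\<lambda>x. U t (query (state t) x))" by (simp add: fun_eq_iff)
  then have "nrm y (state (Suc t)) \<le> nrm y (query (state t))" by (simp only: nrm_U)
  also have "\<dots> = nrm y (state t)" by (rule nrm_query)
  also note Suc
  finally show ?case .
qed

text \<open>The truncated state consists of juntas on \<open>J\<close> blocks, and its squared
  modulus doubles this number. Being a squared norm, \<open>q\<close> is nonnegative. A difference
  of norms of 3 / 200 times a sum of norms of at most 203 / 100 keeps the change of the probability
  below 1 / 20.\<close>

theorem junta_approximation:
  assumes J: "real (Suc J) \<ge> 402 * real t / sqrt h" and Acc: "Acc \<subseteq> {..<dim}"
  shows "\<exists>q :: (nat \<Rightarrow> nat) \<Rightarrow> unit \<Rightarrow> real. junta_sum I (2 * J) q \<and>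
    (\<forall>y. 0 \<le> q y () \<and> q y () \<le> 21 / 20 \<and>
      \<bar>q y () - (\<Sum>p\<in>P. \<Sum>c\<in>Acc. (cmod (state t (with_addr y p) c))\<^sup>2) / card P\<bar> \<le> 1 / 20)"
proof -
  define \<psi> where "\<psi> x c = (\<Sum>j<Suc J. hist t j x c)" for x c
  define q where "q y k = (\<Sum>p\<in>P. \<Sum>c\<in>Acc. (cmod (\<psi> (with_addr y p) c))\<^sup>2 / card P)" for y and k :: unit
  have fin: "finite Acc" using Acc finite_subset by blast
  have \<psi>: "junta_sum I J \<psi>"
    unfolding \<psi>_def by (rule junta_sum_sum) (auto intro: junta_sum_mono[OF hist_junta_sum])
  have "junta_sum I J (\<lambda>x c. cnj (\<psi> x c))"
    using junta_sum_map[OF \<psi>, of "\<lambda>u c. cnj (u c)"] by simp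
  then have "junta_sum I (2 * J) (\<lambda>x c. \<psi> x c * cnj (\<psi> x c))"
    using junta_sum_mult[OF \<psi>] by (simp add: mult_2)
  then have "junta_sum I (2 * J) (\<lambda>x (k :: unit). \<Sum>c\<in>Acc. Re (\<psi> x c * cnj (\<psi> x c)) / card P)"
    by (rule junta_sum_map[of I "2 * J" _ "\<lambda>u k. \<Sum>c\<in>Acc. Re (u c) / card P"])
      (simp add: sum.distrib add_divide_distrib)
  then have "junta_sum I (2 * J) (\<lambda>x (k :: unit). \<Sum>c\<in>Acc. (cmod (\<psi> x c))\<^sup>2 / card P)"
    by (simp add: complex_mult_cnj cmod_power2)
  then have junta: "junta_sum I (2 * J) q"
    unfolding q_def by (intro junta_sum_sum[OF finite_P]) (rule junta_sum_with_addr)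
  define s where "s = sqrt (card P)"
  have s: "s > 0" using card_P by (simp add: s_def)
  have ss: "s\<^sup>2 = card P" by (simp add: s_def)
  have "0 \<le> q y () \<and> q y () \<le> 21 / 20 \<and>
      \<bar>q y () - (\<Sum>p\<in>P. \<Sum>c\<in>Acc. (cmod (state t (with_addr y p) c))\<^sup>2) / card P\<bar> \<le> 1 / 20" for y
  proof -
    define L where "L f = L2_set (\<lambda>(p, c). cmod (f (with_addr y p) c)) (P \<times> Acc)" for f
    have L_sq: "(L f)\<^sup>2 = (\<Sum>p\<in>P. \<Sum>c\<in>Acc. (cmod (f (with_addr y p) c))\<^sup>2)" for f
      by (simp add: L_def L2_set_def sum.cartesian_product case_prod_unfold sum_nonneg)
    have L_le: "L f \<le> nrm y f" for f
      unfolding L_def nrm_def L2_set_def using Acc finite_P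
      by (intro real_sqrt_le_mono sum_mono2) auto
    have tri: "L f \<le> L g + nrm y (\<lambda>x c. f x c - g x c)" for f g
    proof -
      have "L f \<le> L2_set (\<lambda>pc. (case pc of (p, c) \<Rightarrow> cmod (g (with_addr y p) c))
          + (case pc of (p, c) \<Rightarrow> cmod (f (with_addr y p) c - g (with_addr y p) c))) (P \<times> Acc)"
        unfolding L_def
      proof (rule L2_set_mono)
        fix pc
        show "(case pc of (p, c) \<Rightarrow> cmod (f (with_addr y p) c))
          \<le> (case pc of (p, c) \<Rightarrow> cmod (g (with_addr y p) c))
          + (case pc of (p, c) \<Rightarrow> cmod (f (with_addr y p) c - g (with_addr y p) c))"
          using norm_triangle_sub[of "f (with_addr y (fst pc)) (snd pc)" "g (with_addr y (fst pc)) (snd pc)"]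
          by (simp add: case_prod_unfold)
      qed auto
      also have "\<dots> \<le> L g + L (\<lambda>x c. f x c - g x c)" unfolding L_def by (rule L2_set_triangle_ineq)
      finally show ?thesis using L_le[of "\<lambda>x c. f x c - g x c"] by linarith
    qed
    have err: "nrm y (\<lambda>x c. state t x c - \<psi> x c) \<le> 3 / 200 * s"
      unfolding \<psi>_def s_def by (rule nrm_tail[OF J])
    have "nrm y (\<lambda>x c. \<psi> x c - state t x c) = nrm y (\<lambda>x c. state t x c - \<psi> x c)"
      using nrm_uminus[of y "\<lambda>x c. state t x c - \<psi> x c"] by simp
    then have 1: "L \<psi> \<le> L (state t) + 3 / 200 * s" "L (state t) \<le> L \<psi> + 3 / 200 * s"
      using tri[of \<psi> "state t"] tri[of "state t" \<psi>] err by linarith+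
    have 2: "0 \<le> L f" for f by (simp add: L_def)
    have 3: "L (state t) \<le> s" using L_le[of "state t"] nrm_state[of y t] by (simp add: s_def)
    have "L \<psi> + L (state t) \<le> 203 / 100 * s" using 1 3 s by linarith
    moreover have "\<bar>L \<psi> - L (state t)\<bar> \<le> 3 / 200 * s" by (intro abs_leI) (use 1 in linarith)+
    ultimately have "\<bar>L \<psi> - L (state t)\<bar> * \<bar>L \<psi> + L (state t)\<bar> \<le> 3 / 200 * s * (203 / 100 * s)"
      using 2[of \<psi>] 2[of "state t"] s by (intro mult_mono) auto
    also have "\<dots> \<le> 1 / 20 * s\<^sup>2" using s by (simp add: power2_eq_square)
    finally have "\<bar>(L \<psi>)\<^sup>2 - (L (state t))\<^sup>2\<bar> \<le> 1 / 20 * s\<^sup>2"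
      by (simp add: abs_mult power2_eq_square square_diff_square_factored mult.commute)
    moreover have "(L (state t))\<^sup>2 \<le> s\<^sup>2" using 3 2 by (intro power_mono) auto
    moreover have "q y () = (L \<psi>)\<^sup>2 / s\<^sup>2"
      by (simp add: q_def L_sq ss sum_divide_distrib)
    moreover have S: "s\<^sup>2 > 0" using s by simp
    ultimately have q_eq: "q y () = (L \<psi>)\<^sup>2 / s\<^sup>2" and "(L (state t))\<^sup>2 / s\<^sup>2 \<le> 1"
      and "\<bar>(L \<psi>)\<^sup>2 - (L (state t))\<^sup>2\<bar> / s\<^sup>2 \<le> 1 / 20"
      by (simp_all add: divide_le_eq)
    moreover have "\<bar>(L \<psi>)\<^sup>2 - (L (state t))\<^sup>2\<bar> / s\<^sup>2 = \<bar>(L \<psi>)\<^sup>2 / s\<^sup>2 - (L (state t))\<^sup>2 / s\<^sup>2\<bar>"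
      using S by (simp add: abs_divide flip: diff_divide_distrib)
    moreover have "0 \<le> (L \<psi>)\<^sup>2 / s\<^sup>2" by simp
    ultimately have "0 \<le> q y () \<and> q y () \<le> 21 / 20 \<and> \<bar>q y () - (L (state t))\<^sup>2 / s\<^sup>2\<bar> \<le> 1 / 20"
      unfolding q_eq by linarith
    then show ?thesis unfolding ss L_sq .
  qed
  then show ?thesis using junta by blast
qed

end

section \<open>Query algorithms\<close>

lemma unitary_mat_norm:
  assumes U: "unitary_mat N U"
  shows "(\<Sum>c<N. (cmod (\<Sum>k<N. index_mat U (c, k) * v k))\<^sup>2) = (\<Sum>c<N. (cmod (v c))\<^sup>2)"
proof -
  have dim: "dim_row U = N" "dim_col U = N" and adj: "mat_adjoint U * U = 1\<^sub>m N"
    using U by (auto simp: unitary_mat_def)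
  have orth: "(\<Sum>c<N. cnj (index_mat U (c, i)) * index_mat U (c, j)) = (if i = j then 1 else 0)"
    if "i < N" "j < N" for i j
  proof -
    have "(\<Sum>c<N. cnj (index_mat U (c, i)) * index_mat U (c, j)) = index_mat (mat_adjoint U * U) (i, j)"
      using that dim by (simp add: mat_adjoint_def mat_of_rows_def scalar_prod_def lessThan_atLeast0)
    then show ?thesis using that by (simp add: adj)
  qed
  have "complex_of_real (\<Sum>c<N. (cmod (\<Sum>k<N. index_mat U (c, k) * v k))\<^sup>2)
      = (\<Sum>c<N. (\<Sum>k<N. index_mat U (c, k) * v k) * cnj (\<Sum>k<N. index_mat U (c, k) * v k))"
    by (simp only: of_real_sum complex_norm_square)
  also have "\<dots> = (\<Sum>c<N. \<Sum>i<N. \<Sum>j<N. (v j * cnj (v i)) * (cnj (index_mat U (c, i)) * index_mat U (c, j)))"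
    by (simp add: sum_product mult_ac) (rule sum.cong[OF refl], rule sum.swap)
  also have "\<dots> = (\<Sum>i<N. \<Sum>c<N. \<Sum>j<N. (v j * cnj (v i)) * (cnj (index_mat U (c, i)) * index_mat U (c, j)))"
    by (rule sum.swap)
  also have "\<dots> = (\<Sum>i<N. \<Sum>j<N. (v j * cnj (v i)) * (\<Sum>c<N. cnj (index_mat U (c, i)) * index_mat U (c, j)))"
    unfolding sum_distrib_left by (intro sum.cong refl sum.swap)
  also have "\<dots> = (\<Sum>i<N. \<Sum>j<N. if i = j then v j * cnj (v i) else 0)"
    by (intro sum.cong refl) (simp add: orth)
  also have "\<dots> = complex_of_real (\<Sum>c<N. (cmod (v c))\<^sup>2)"
    unfolding of_real_sum complex_norm_square by simp
  finally show ?thesis unfolding of_real_eq_iff .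
qed

section \<open>Oracle calls as permutations of basis indices\<close>

definition pos_of :: "nat \<Rightarrow> nat \<Rightarrow> nat \<Rightarrow> nat" where
  "pos_of m w c = c div w div 2 ^ m"

text \<open>Reducing \<open>s\<close> modulo \<open>2 ^ m\<close> makes this an involution of the
  index range for every number \<open>s\<close>, as \<open>hidden_query\<close> asks for all
  symbols.\<close>

definition flip_bits :: "nat \<Rightarrow> nat \<Rightarrow> nat \<Rightarrow> nat \<Rightarrow> nat" where
  "flip_bits m w s c = basis_index m w (pos_of m w c) (Bit_Operations.xor (c div w mod 2 ^ m) (s mod 2 ^ m)) (c mod w)"

lemma basis_index_decode:
  assumes "b < 2 ^ m" "z < w"
  shows "pos_of m w (basis_index m w i b z) = i" "basis_index m w i b z div w mod 2 ^ m = b"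
    "basis_index m w i b z mod w = z"
  using assms by (simp_all add: basis_index_def pos_of_def)

lemma basis_index_encode: "basis_index m w (pos_of m w c) (c div w mod 2 ^ m) (c mod w) = c"
  by (simp only: basis_index_def pos_of_def div_mult_mod_eq)

lemma flip_bits:
  assumes "w > 0"
  shows "pos_of m w (flip_bits m w s c) = pos_of m w c" "flip_bits m w s (flip_bits m w s c) = c"
    and "c < k * 2 ^ m * w \<Longrightarrow> flip_bits m w s c < k * 2 ^ m * w"
    and "c < k * 2 ^ m * w \<Longrightarrow> pos_of m w c < k"
proof -
  have lt: "Bit_Operations.xor (c div w mod 2 ^ m) (s mod 2 ^ m) < 2 ^ m"
    by (rule xor_less_two_power) simp_all
  note dec = basis_index_decode[OF lt, of "c mod w" w "pos_of m w c"]
  show pos: "pos_of m w (flip_bits m w s c) = pos_of m w c"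
    using dec assms by (simp add: flip_bits_def)
  have "flip_bits m w s (flip_bits m w s c) = basis_index m w (pos_of m w c)
      (Bit_Operations.xor (Bit_Operations.xor (c div w mod 2 ^ m) (s mod 2 ^ m)) (s mod 2 ^ m)) (c mod w)"
    using dec assms by (simp add: flip_bits_def)
  then show "flip_bits m w s (flip_bits m w s c) = c"
    by (simp add: xor.assoc basis_index_encode)
  show less: "c < k * 2 ^ m * w \<Longrightarrow> pos_of m w c < k"
    by (simp add: pos_of_def less_mult_imp_div_less)
  show "c < k * 2 ^ m * w \<Longrightarrow> flip_bits m w s c < k * 2 ^ m * w"
    unfolding flip_bits_def using lt less assms by (intro basis_index_less) auto
qed

lemma flip_bits_shift:
  assumes "w > 0"
  shows "pos_of m w (k * 2 ^ m * w + c) = k + pos_of m w c"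
    and "flip_bits m w s (k * 2 ^ m * w + c) = k * 2 ^ m * w + flip_bits m w s c"
proof -
  have 1: "(k * 2 ^ m * w + c) div w = k * 2 ^ m + c div w" "(k * 2 ^ m * w + c) mod w = c mod w"
    using assms by simp_all
  have 2: "(k * 2 ^ m + x) div 2 ^ m = k + x div 2 ^ m" "(k * 2 ^ m + x) mod 2 ^ m = x mod 2 ^ m" for x :: nat
    by simp_all
  show "pos_of m w (k * 2 ^ m * w + c) = k + pos_of m w c" by (simp only: pos_of_def 1 2)
  then show "flip_bits m w s (k * 2 ^ m * w + c) = k * 2 ^ m * w + flip_bits m w s c"
    by (simp only: flip_bits_def 1 2) (simp add: basis_index_def algebra_simps)
qed

lemma oracle_mat_index:
  assumes "w > 0" "\<And>i. i < length S \<Longrightarrow> S ! i < 2 ^ m" "r < length S * 2 ^ m * w" "c < length S * 2 ^ m * w"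
  shows "index_mat (oracle_mat m w S) (r, c) = (if c = flip_bits m w (S ! pos_of m w r) r then 1 else 0)"
proof -
  have flip: "flip_bits m w (S ! pos_of m w c) c
      = basis_index m w (pos_of m w c) (Bit_Operations.xor (c div w mod 2 ^ m) (S ! pos_of m w c)) (c mod w)"
    if "c < length S * 2 ^ m * w" for c
    using assms(2)[OF flip_bits(4)[OF assms(1) that]] by (simp add: flip_bits_def)
  have "index_mat (oracle_mat m w S) (r, c) = (if r = flip_bits m w (S ! pos_of m w c) c then 1 else 0)"
    using assms(3,4) unfolding flip[OF assms(4)] by (simp add: oracle_mat_def Let_def pos_of_def)
  moreover have "r = flip_bits m w (S ! pos_of m w c) c \<longleftrightarrow> c = flip_bits m w (S ! pos_of m w r) r"
    using flip_bits(1,2)[OF assms(1)] by metis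
  ultimately show ?thesis by simp
qed

text \<open>The leading qubit shifts the index by \<open>n * 2 ^ m * w\<close> and thus the position
  by \<open>n\<close>. The two oracles together therefore act as a single oracle for the
  concatenation of the strings.\<close>

lemma query_mat_mult:
  assumes w: "w > 0" and len: "length S\<^sub>1 = n" "length S\<^sub>2 = n"
    and less: "\<And>k. k < 2 * n \<Longrightarrow> (S\<^sub>1 @ S\<^sub>2) ! k < 2 ^ m"
    and v: "v \<in> carrier_vec (2 * (n * 2 ^ m * w))" and c: "c < 2 * (n * 2 ^ m * w)"
  shows "vec_index (query_mat m w S\<^sub>1 S\<^sub>2 *\<^sub>v v) c = vec_index v (flip_bits m w ((S\<^sub>1 @ S\<^sub>2) ! pos_of m w c) c)"
proof -
  define N where "N = n * 2 ^ m * w"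
  define f where "f = flip_bits m w ((S\<^sub>1 @ S\<^sub>2) ! pos_of m w c) c"
  have less1: "S\<^sub>1 ! i < 2 ^ m" if "i < n" for i using less[of i] that by (simp add: nth_append len)
  have less2: "S\<^sub>2 ! i < 2 ^ m" if "i < n" for i using less[of "n + i"] that by (simp add: nth_append len)
  have dimO: "oracle_mat m w S\<^sub>1 \<in> carrier_mat N N" "oracle_mat m w S\<^sub>2 \<in> carrier_mat N N"
    by (simp_all add: oracle_mat_def len N_def)
  have Q: "query_mat m w S\<^sub>1 S\<^sub>2 = four_block_mat (oracle_mat m w S\<^sub>1) (0\<^sub>m N N) (0\<^sub>m N N) (oracle_mat m w S\<^sub>2)"
    by (simp add: query_mat_def len N_def Let_def)
  have entry: "index_mat (query_mat m w S\<^sub>1 S\<^sub>2) (c, k) = (if k = f then 1 else 0)" if k: "k < 2 * N" for k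
  proof (cases "c < N")
    case True
    then have pos: "pos_of m w c < n" using flip_bits(4)[OF w] by (simp add: N_def)
    have f: "f = flip_bits m w (S\<^sub>1 ! pos_of m w c) c" using pos by (simp add: f_def nth_append len)
    have "f < N" unfolding f N_def using flip_bits(3)[OF w] True by (simp add: N_def)
    then show ?thesis
      using oracle_mat_index[OF w, of S\<^sub>1 m c k] True k dimO less1 len f
      by (auto simp: Q N_def)
  next
    case False
    define c' where "c' = c - N"
    have c': "c = N + c'" "c' < N" using False c by (auto simp: c'_def N_def)
    have pos: "pos_of m w c = n + pos_of m w c'" unfolding c'(1) N_def by (rule flip_bits_shift(1)[OF w])
    have f: "f = N + flip_bits m w (S\<^sub>2 ! pos_of m w c') c'"
      unfolding f_def pos by (simp add: nth_append len c'(1) N_def flip_bits_shift(2)[OF w])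
    then show ?thesis
      using oracle_mat_index[OF w, of S\<^sub>2 m c' "k - N"] c' k dimO less2 len
      by (cases "k < N") (auto simp: Q N_def)
  qed
  have "f < 2 * N" unfolding f_def N_def using flip_bits(3)[OF w, of c "2 * n" m] c by (simp add: mult.assoc)
  have "vec_index (query_mat m w S\<^sub>1 S\<^sub>2 *\<^sub>v v) c = (\<Sum>k<2 * N. index_mat (query_mat m w S\<^sub>1 S\<^sub>2) (c, k) * vec_index v k)"
    using c v dimO by (simp add: scalar_prod_def Q N_def lessThan_atLeast0)
  also have "\<dots> = (\<Sum>k<2 * N. if k = f then vec_index v k else 0)"
    by (intro sum.cong) (simp_all add: entry)
  also have "\<dots> = vec_index v f" using \<open>f < 2 * N\<close> by simp
  finally show ?thesis by (simp add: f_def)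
qed

text \<open>This applies the abstract model to matrices. Position \<open>k\<close> of the
  concatenated strings is either fixed or a possible address of one block, as recorded by
  \<open>loc k\<close>; \<open>base k\<close> is its symbol when nothing is hidden there. The
  thresholds are 2 / 3 - 1 / 20 and 1 / 3 + 1 / 20.\<close>

lemma junta_approximation_of_algorithm:
  fixes S\<^sub>1 S\<^sub>2 :: "(nat \<Rightarrow> nat) \<Rightarrow> (nat \<Rightarrow> nat) \<Rightarrow> nat list"
  assumes valid: "valid_algorithm n m alg" and I: "finite I" and h: "h > 0"
    and loc: "\<And>k i r. loc k = Some (i, r) \<Longrightarrow> i \<in> I \<and> r < h"
    and len: "\<And>y p. length (S\<^sub>1 y p) = n" "\<And>y p. length (S\<^sub>2 y p) = n"
    and base: "\<And>k. k < 2 * n \<Longrightarrow> base k < 2 ^ m"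
    and S: "\<And>y p k. p \<in> (\<Pi>\<^sub>E i\<in>I. {..<h}) \<Longrightarrow> k < 2 * n \<Longrightarrow> (S\<^sub>1 y p @ S\<^sub>2 y p) ! k =
      (case loc k of None \<Rightarrow> base k | Some (i, r) \<Rightarrow> if p i = r then y i else base k)"
    and J: "real (Suc J) \<ge> 402 * real (num_queries alg) / sqrt h"
  shows "\<exists>q :: (nat \<Rightarrow> nat) \<Rightarrow> unit \<Rightarrow> real. junta_sum I (2 * J) q \<and>
    (\<forall>y. (\<forall>i\<in>I. y i < 2 ^ m) \<longrightarrow> 0 \<le> q y () \<and> q y () \<le> 21 / 20 \<and>
      ((\<forall>p \<in> (\<Pi>\<^sub>E i\<in>I. {..<h}). accept_prob n m alg (S\<^sub>1 y p) (S\<^sub>2 y p) \<ge> 2 / 3) \<longrightarrow> q y () \<ge> 37 / 60) \<and>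
      ((\<forall>p \<in> (\<Pi>\<^sub>E i\<in>I. {..<h}). accept_prob n m alg (S\<^sub>1 y p) (S\<^sub>2 y p) \<le> 1 / 3) \<longrightarrow> q y () \<le> 23 / 60))"
proof -
  define w where "w = workspace_dim alg"
  define dim where "dim = state_dim n m alg"
  define T where "T = num_queries alg"
  have w: "w > 0" using valid by (simp add: valid_algorithm_def w_def)
  have dim: "dim = 2 * (n * 2 ^ m * w)" by (simp add: dim_def state_dim_def w_def)
  have dim': "c < dim \<longleftrightarrow> c < (2 * n) * 2 ^ m * w" for c by (simp add: dim mult.assoc)
  have gate: "unitary_mat dim (gate alg t)" if "t \<le> T" for t
    using valid that by (simp add: valid_algorithm_def dim_def T_def)
  \<comment> \<open>Unitarity is known up to time \<open>T\<close> only, whereas the locale speaks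
    about all times; \<open>gate alg 0\<close> is the default beyond.\<close>
  define G where "G t = (if t \<le> T then gate alg t else gate alg 0)" for t
  have G: "unitary_mat dim (G t)" for t
    using gate[of t] gate[of 0] by (simp add: G_def)
  define L where "L c = (if c < dim then loc (pos_of m w c) else None)" for c
  define \<beta> where "\<beta> c = flip_bits m w (base (pos_of m w c)) c" for c
  define U where "U t v c = (\<Sum>k<dim. index_mat (G (Suc t)) (c, k) * v k)" for t and v :: "nat \<Rightarrow> complex" and c
  define v0 where "v0 c = (\<Sum>k<dim. index_mat (G 0) (c, k) * (if k = 0 then 1 else 0))" for c
  interpret hq: hidden_query dim h I L \<beta> "flip_bits m w" U v0
  proof
    show "L c = Some (i, r) \<Longrightarrow> i \<in> I \<and> r < h" for c i r
      using loc by (auto simp: L_def split: if_splits)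
    show "flip_bits m w s c < dim \<and> flip_bits m w s (flip_bits m w s c) = c \<and> L (flip_bits m w s c) = L c"
      if "c < dim" for s c
      using that flip_bits(1,2)[OF w, of m s c] flip_bits(3)[OF w, of c "2 * n" m s] by (simp add: dim' L_def)
    then show "\<beta> c < dim \<and> \<beta> (\<beta> c) = c \<and> L (\<beta> c) = L c" if "c < dim" for c
      using that flip_bits(1)[OF w] by (simp add: \<beta>_def)
    show "U t (\<lambda>c. v c + u c) c = U t v c + U t u c" for t v u c
      by (simp add: U_def distrib_left sum.distrib)
    show "(\<Sum>c<dim. (cmod (U t v c))\<^sup>2) \<le> (\<Sum>c<dim. (cmod (v c))\<^sup>2)" for t v
      unfolding U_def unitary_mat_norm[OF G] ..
    show "(\<Sum>c<dim. (cmod (v0 c))\<^sup>2) \<le> 1"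
      unfolding v0_def unitary_mat_norm[OF G] by (simp add: if_distrib[of cmod] if_distrib[of "\<lambda>x. x\<^sup>2"] sum.delta cong: if_cong)
  qed (use I h in auto)
  have state: "state_after n m alg (S\<^sub>1 y p) (S\<^sub>2 y p) t \<in> carrier_vec dim \<and>
      (\<forall>c<dim. vec_index (state_after n m alg (S\<^sub>1 y p) (S\<^sub>2 y p) t) c = hq.state t (with_addr y p) c)"
    if y: "\<forall>i\<in>I. y i < 2 ^ m" and p: "p \<in> (\<Pi>\<^sub>E i\<in>I. {..<h})" and "t \<le> T" for y p t
    using \<open>t \<le> T\<close>
  proof (induction t)
    case 0
    have g: "gate alg 0 \<in> carrier_mat dim dim" using gate[of 0] by (simp add: unitary_mat_def)
    have "vec_index (state_after n m alg (S\<^sub>1 y p) (S\<^sub>2 y p) 0) c = v0 c" if "c < dim" for c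
      using g that
      by (auto simp: v0_def G_def scalar_prod_def lessThan_atLeast0 unit_vec_def simp flip: dim_def intro!: sum.cong)
    then show ?case using g by (auto simp flip: dim_def)
  next
    case (Suc t)
    define v where "v = state_after n m alg (S\<^sub>1 y p) (S\<^sub>2 y p) t"
    have v: "v \<in> carrier_vec dim" "\<And>c. c < dim \<Longrightarrow> vec_index v c = hq.state t (with_addr y p) c"
      using Suc by (auto simp: v_def)
    define Q where "Q = query_mat m w (S\<^sub>1 y p) (S\<^sub>2 y p)"
    define u where "u = Q *\<^sub>v v"
    have "Q \<in> carrier_mat dim dim"
      unfolding Q_def query_mat_def Let_def len dim mult_2
      by (rule four_block_carrier_mat) (simp_all add: oracle_mat_def len)
    then have u: "u \<in> carrier_vec dim"
      unfolding u_def using v(1) by (rule mult_mat_vec_carrier)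
    have less: "(S\<^sub>1 y p @ S\<^sub>2 y p) ! k < 2 ^ m" if "k < 2 * n" for k
      using S[OF p that] base[OF that] loc y by (auto split: option.split)
    have Qv: "vec_index u c = hq.query (hq.state t) (with_addr y p) c" if c: "c < dim" for c
    proof -
      have k: "pos_of m w c < 2 * n" using flip_bits(4)[OF w] c by (simp add: dim')
      have fl: "flip_bits m w s c < dim" for s using flip_bits(3)[OF w] c by (simp add: dim')
      have "vec_index u c = vec_index v (flip_bits m w ((S\<^sub>1 y p @ S\<^sub>2 y p) ! pos_of m w c) c)"
        unfolding u_def Q_def using less v(1) c unfolding dim by (intro query_mat_mult[OF w len])
      also have "\<dots> = hq.state t (with_addr y p) (flip_bits m w ((S\<^sub>1 y p @ S\<^sub>2 y p) ! pos_of m w c) c)"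
        by (rule v(2)[OF fl])
      also have "\<dots> = hq.query (hq.state t) (with_addr y p) c"
        unfolding S[OF p k] hq.query_def L_def \<beta>_def using c by (simp add: with_addr_def split: option.split)
      finally show ?thesis .
    qed
    have g: "gate alg (Suc t) \<in> carrier_mat dim dim" using gate[of "Suc t"] Suc.prems by (simp add: unitary_mat_def)
    have st: "state_after n m alg (S\<^sub>1 y p) (S\<^sub>2 y p) (Suc t) = gate alg (Suc t) *\<^sub>v u"
      by (simp add: Q_def v_def w_def u_def)
    have "vec_index (gate alg (Suc t) *\<^sub>v u) c = hq.state (Suc t) (with_addr y p) c" if c: "c < dim" for c
    proof -
      have "vec_index (gate alg (Suc t) *\<^sub>v u) c = (\<Sum>k<dim. index_mat (gate alg (Suc t)) (c, k) * vec_index u k)"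
        using g c u by (simp add: scalar_prod_def lessThan_atLeast0)
      also have "\<dots> = U t (hq.query (hq.state t) (with_addr y p)) c"
      proof -
        have "U t z c = (\<Sum>k<dim. index_mat (gate alg (Suc t)) (c, k) * z k)" for z
          using Suc.prems by (simp add: U_def G_def)
        then show ?thesis by (simp add: Qv)
      qed
      also have "\<dots> = hq.state (Suc t) (with_addr y p) c" by (simp only: hq.state.simps)
      finally show ?thesis .
    qed
    then show ?case unfolding st using mult_mat_vec_carrier[OF g u] by blast
  qed
  define Acc where "Acc = {k \<in> accepting alg. k < dim}"
  obtain q :: "(nat \<Rightarrow> nat) \<Rightarrow> unit \<Rightarrow> real" where q: "junta_sum I (2 * J) q"
    and qb: "\<And>y. 0 \<le> q y () \<and> q y () \<le> 21 / 20 \<and>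
      \<bar>q y () - (\<Sum>p\<in>hq.P. \<Sum>c\<in>Acc. (cmod (hq.state T (with_addr y p) c))\<^sup>2) / card hq.P\<bar> \<le> 1 / 20"
    using hq.junta_approximation[of T J Acc] J by (auto simp: Acc_def T_def)
  have "((\<forall>p\<in>hq.P. accept_prob n m alg (S\<^sub>1 y p) (S\<^sub>2 y p) \<ge> 2 / 3) \<longrightarrow> q y () \<ge> 37 / 60) \<and>
      ((\<forall>p\<in>hq.P. accept_prob n m alg (S\<^sub>1 y p) (S\<^sub>2 y p) \<le> 1 / 3) \<longrightarrow> q y () \<le> 23 / 60)"
    if y: "\<forall>i\<in>I. y i < 2 ^ m" for y
  proof -
    define a where "a p = accept_prob n m alg (S\<^sub>1 y p) (S\<^sub>2 y p)" for p
    have "a p = (\<Sum>c\<in>Acc. (cmod (hq.state T (with_addr y p) c))\<^sup>2)" if "p \<in> hq.P" for p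
      using state[OF y, of p T] that
      by (auto simp: a_def accept_prob_def Acc_def T_def[symmetric] hq.P_def dim_def intro!: sum.cong)
    then have "\<bar>q y () - sum a hq.P / card hq.P\<bar> \<le> 1 / 20" using qb[of y] by simp
    then have avg: "q y () \<le> sum a hq.P / card hq.P + 1 / 20" "sum a hq.P / card hq.P - 1 / 20 \<le> q y ()"
      unfolding abs_le_iff by linarith+
    show ?thesis unfolding a_def[symmetric]
    proof (intro conjI impI)
      assume "\<forall>p\<in>hq.P. a p \<ge> 2 / 3"
      then have "2 / 3 \<le> sum a hq.P / card hq.P"
        using sum_bounded_below[of hq.P "2 / 3" a] hq.card_P by (simp add: field_simps)
      then show "37 / 60 \<le> q y ()" using avg(2) by linarith
    next
      assume "\<forall>p\<in>hq.P. a p \<le> 1 / 3"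
      then have "sum a hq.P / card hq.P \<le> 1 / 3"
        using sum_bounded_above[of hq.P a "1 / 3"] hq.card_P by (simp add: field_simps)
      then show "q y () \<le> 23 / 60" using avg(1) by linarith
    qed
  qed
  note decision = this
  show ?thesis
  proof (intro exI[of _ q] conjI[OF q] allI impI)
    fix y :: "nat \<Rightarrow> nat" assume y: "\<forall>i\<in>I. y i < 2 ^ m"
    show "0 \<le> q y () \<and> q y () \<le> 21 / 20 \<and>
      ((\<forall>p \<in> (\<Pi>\<^sub>E i\<in>I. {..<h}). accept_prob n m alg (S\<^sub>1 y p) (S\<^sub>2 y p) \<ge> 2 / 3) \<longrightarrow> q y () \<ge> 37 / 60) \<and>
      ((\<forall>p \<in> (\<Pi>\<^sub>E i\<in>I. {..<h}). accept_prob n m alg (S\<^sub>1 y p) (S\<^sub>2 y p) \<le> 1 / 3) \<longrightarrow> q y () \<le> 23 / 60)"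
      using qb[of y] decision[OF y] unfolding hq.P_def by (intro conjI) (elim conjE, assumption)+
  qed
qed

section \<open>Hard instances\<close>

lemma junta_sum_coordinatewise:
  "junta_sum I j f \<Longrightarrow> junta_sum I j (\<lambda>v. f (\<lambda>i. g i (v i)))"
proof (induction rule: junta_sum.induct)
  case (junta S f)
  then show ?case by (intro junta_sum.junta[of S]) (auto simp: is_junta_def)
next
  case (add f f')
  then show ?case using junta_sum.add[OF add.IH] by simp
qed

lemma junta_sum_0_const: "junta_sum I 0 f \<Longrightarrow> f x = f x'"
  by (induction rule: junta_sum.induct) (auto simp: is_junta_def fun_eq_iff)

lemma has_common_substring_iff:
  "has_common_substring d S\<^sub>1 S\<^sub>2 \<longleftrightarrow> (\<exists>i j. i + d \<le> length S\<^sub>1 \<and> j + d \<le> length S\<^sub>2 \<and>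
     (\<forall>k<d. S\<^sub>1 ! (i + k) = S\<^sub>2 ! (j + k)))"
proof -
  have "take d (drop i S\<^sub>1) = take d (drop j S\<^sub>2) \<longleftrightarrow> (\<forall>k<d. S\<^sub>1 ! (i + k) = S\<^sub>2 ! (j + k))"
    if "i + d \<le> length S\<^sub>1" "j + d \<le> length S\<^sub>2" for i j
    using that by (subst list_eq_iff_nth_eq) auto
  then show ?thesis unfolding has_common_substring_def by blast
qed

text \<open>One string of the hard instances: \<open>b\<close> blanks \<open>z\<close>, then \<open>N\<close> blocks of length \<open>b + h\<close>, the \<open>i\<close>-th of
  which is blank except for the symbol \<open>y (off + i)\<close> at its address \<open>p (off + i) < h\<close>, then copies of \<open>j\<close>.\<close>

definition block_char ::
    "nat \<Rightarrow> nat \<Rightarrow> nat \<Rightarrow> nat \<Rightarrow> nat \<Rightarrow> nat \<Rightarrow> (nat \<Rightarrow> nat) \<Rightarrow> (nat \<Rightarrow> nat) \<Rightarrow> nat \<Rightarrow> nat" where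
  "block_char b h N z off j y p k =
     (if k < b then z
      else if (k - b) div (b + h) \<ge> N then j
      else if (k - b) mod (b + h) = p (off + (k - b) div (b + h)) then y (off + (k - b) div (b + h))
      else z)"

lemma block_char_at:
  assumes "r < b + h"
  shows "block_char b h N z off j y p (b + i * (b + h) + r) =
    (if i \<ge> N then j else if r = p (off + i) then y (off + i) else z)"
proof -
  define L where "L = b + h"
  have eqs: "(i * L + r) div L = i" "(i * L + r) mod L = r" "b + i * L + r - b = i * L + r"
    using assms by (simp_all add: L_def[symmetric])
  show ?thesis unfolding block_char_def L_def[symmetric] eqs by simp
qed

lemma block_char_in: "block_char b h N z off j y p k \<in> {z, j} \<union> (\<lambda>i. y (off + i)) ` {..<N}"
  by (auto simp: block_char_def not_le)

text \<open>Addresses lie below \<open>h\<close> in blocks of length \<open>b + h\<close>, so the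
  \<open>b\<close> positions after a hidden symbol stay blank within its block. The
  \<open>a \<le> b\<close> positions before it reach at most into the blank tail of the preceding
  block, or into the leading blanks if there is none.\<close>

lemma block_char_window:
  assumes i: "i < N" and p: "\<And>k. k < N \<Longrightarrow> p (off + k) < h" and a: "a \<le> b" "s \<le> a + b"
  shows "block_char b h N z off j y p (b + i * (b + h) + p (off + i) - a + s)
    = (if s = a then y (off + i) else z)"
proof -
  define L where "L = b + h"
  define q where "q = p (off + i)"
  have q: "q < h" using p[OF i] by (simp add: q_def)
  have at: "block_char b h N z off j y p (b + i * L + r) = (if r = q then y (off + i) else z)" if "r < L" for r
    using block_char_at[of r b h N z off j y p i] that i by (simp add: L_def q_def)
  show ?thesis
  proof (cases "a \<le> q + s")
    case True
    have "b + i * L + q - a + s = b + i * L + (q + s - a)" using True a by simp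
    moreover have "q + s - a < L" using q a by (simp add: L_def)
    ultimately show ?thesis using at[of "q + s - a"] True by (auto simp flip: L_def q_def)
  next
    case False
    show ?thesis
    proof (cases i)
      case 0
      have "b + i * L + q - a + s < b" using False 0 a by simp
      then show ?thesis using False by (simp add: block_char_def flip: L_def q_def)
    next
      case (Suc i')
      have e: "b + i * L + q - a + s = b + i' * L + (L + q + s - a)"
        using False a by (simp add: Suc L_def)
      have "L + q + s - a < L" "L + q + s - a \<noteq> p (off + i')" "i' < N"
        using False a p[of i'] i by (auto simp: L_def Suc)
      then show ?thesis
        unfolding L_def[symmetric] q_def[symmetric] e
        using block_char_at[of "L + q + s - a" b h N z off j y p i'] False by (simp flip: L_def)
    qed
  qed
qed

text \<open>Consecutive hidden symbols are at most \<open>b + 2 * h - 1\<close> apart, and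
  \<open>h \<le> a div 2 + 1\<close> bounds this by \<open>d\<close>. Hence no window of length
  \<open>d\<close> is blank, and two strings cannot agree merely on blanks.\<close>

lemma block_char_nonblank:
  assumes d: "a + b + 1 = d" "h \<le> a div 2 + 1" "a \<le> b" and N: "N > 0"
    and p: "\<And>k. k < N \<Longrightarrow> p (off + k) < h"
    and nz: "j \<noteq> z" "\<And>k. k < N \<Longrightarrow> y (off + k) \<noteq> z"
  shows "\<exists>k<d. block_char b h N z off j y p (s + k) \<noteq> z"
proof -
  define L where "L = b + h"
  have hd: "b + h \<le> d" "2 * h \<le> a + 2" using d by linarith+
  have h: "h > 0" using p[OF N] by linarith
  have at: "block_char b h N z off j y p (b + i * L + r) \<noteq> z" if "r = p (off + i) \<and> i < N \<or> i \<ge> N \<and> r < L" for i r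
    using block_char_at[of r b h N z off j y p i] that nz(1) nz(2)[of i] p[of i] by (auto simp: L_def)
  show ?thesis
  proof (cases "s \<le> b")
    case True
    have "block_char b h N z off j y p (b + 0 * L + p (off + 0)) \<noteq> z" by (rule at) (use N in simp)
    then show ?thesis using True p[OF N] hd by (intro exI[of _ "b + p off - s"]) auto
  next
    case False
    define i where "i = (s - b) div L"
    define r where "r = (s - b) mod L"
    have L: "L > 0" using h by (simp add: L_def)
    have r: "r < L" using L by (simp add: r_def)
    have s: "s = b + i * L + r" using False by (simp add: i_def r_def add.assoc)
    show ?thesis
    proof (cases "i \<ge> N")
      case True
      then show ?thesis using at[of r i] r d by (intro exI[of _ 0]) (auto simp: s)
    next
      case iN: False
      show ?thesis
      proof (cases "r \<le> p (off + i)")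
        case True
        then have "s + (p (off + i) - r) = b + i * L + p (off + i)" by (simp add: s)
        moreover have "p (off + i) - r < d" using p[of i] iN hd by linarith
        ultimately show ?thesis using at[of "p (off + i)" i] iN by (intro exI[of _ "p (off + i) - r"]) auto
      next
        case False
        define r' where "r' = (if Suc i < N then p (off + Suc i) else 0)"
        have r': "r' < h" using p[of "Suc i"] h by (simp add: r'_def)
        have e: "s + (L - r + r') = b + Suc i * L + r'" using r by (simp add: s)
        have "block_char b h N z off j y p (s + (L - r + r')) \<noteq> z"
          unfolding e by (rule at) (use L in \<open>auto simp: r'_def\<close>)
        moreover have "L - r + r' < d" using False r r' hd d by (simp add: L_def)
        ultimately show ?thesis by blast
      qed
    qed
  qed
qed

definition block_string ::
    "nat \<Rightarrow> nat \<Rightarrow> nat \<Rightarrow> nat \<Rightarrow> nat \<Rightarrow> nat \<Rightarrow> nat \<Rightarrow> (nat \<Rightarrow> nat) \<Rightarrow> (nat \<Rightarrow> nat) \<Rightarrow> nat list" where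
  "block_string n b h N z off j y p = map (block_char b h N z off j y p) [0..<n]"

text \<open>A common window contains a nonblank character, which cannot be junk and so is a shared
  symbol. Conversely, the window with a shared symbol at offset \<open>a\<close> and blanks
  elsewhere occurs in both strings.\<close>

lemma has_common_substring_block_strings:
  assumes d: "a + b + 1 = d" "h \<le> a div 2 + 1" "a \<le> b" and N: "N > 0" and n: "b + N * (b + h) \<le> n"
    and p: "\<And>k. k < 2 * N \<Longrightarrow> p k < h"
    and nz: "j\<^sub>1 \<noteq> z" "j\<^sub>2 \<noteq> z" "j\<^sub>1 \<noteq> j\<^sub>2" "\<And>k. k < 2 * N \<Longrightarrow> y k \<noteq> z"
    and junk: "\<And>k. k < N \<Longrightarrow> y k \<noteq> j\<^sub>2" "\<And>k. k < N \<Longrightarrow> y (N + k) \<noteq> j\<^sub>1"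
  shows "has_common_substring d (block_string n b h N z 0 j\<^sub>1 y p) (block_string n b h N z N j\<^sub>2 y p)
    \<longleftrightarrow> (\<exists>i<N. \<exists>k<N. y i = y (N + k))"
proof
  assume "has_common_substring d (block_string n b h N z 0 j\<^sub>1 y p) (block_string n b h N z N j\<^sub>2 y p)"
  then obtain s t where st: "s + d \<le> n" "t + d \<le> n" and
    eq: "\<And>k. k < d \<Longrightarrow> block_char b h N z 0 j\<^sub>1 y p (s + k) = block_char b h N z N j\<^sub>2 y p (t + k)"
    by (auto simp: has_common_substring_iff block_string_def)
  obtain k where k: "k < d" "block_char b h N z 0 j\<^sub>1 y p (s + k) \<noteq> z"
    using block_char_nonblank[OF d N, of p 0 j\<^sub>1 z y s] p nz by auto
  define c where "c = block_char b h N z 0 j\<^sub>1 y p (s + k)"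
  have "c \<in> {z, j\<^sub>1} \<union> (\<lambda>i. y (0 + i)) ` {..<N}" unfolding c_def by (rule block_char_in)
  moreover have "c \<in> {z, j\<^sub>2} \<union> (\<lambda>i. y (N + i)) ` {..<N}"
    unfolding c_def eq[OF k(1)] by (rule block_char_in)
  moreover have "c \<noteq> z" using k by (simp add: c_def)
  ultimately show "\<exists>i<N. \<exists>k<N. y i = y (N + k)" using junk nz(3) by (auto simp: image_iff)
next
  assume "\<exists>i<N. \<exists>k<N. y i = y (N + k)"
  then obtain i k where ik: "i < N" "k < N" "y i = y (N + k)" by blast
  define s where "s = b + i * (b + h) + p i - a"
  define t where "t = b + k * (b + h) + p (N + k) - a"
  have le: "b + i * (b + h) + q - a + d \<le> n" if "q < h" "i < N" for i q
  proof -
    have "Suc i * (b + h) \<le> N * (b + h)" using that by (intro mult_right_mono) auto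
    then show ?thesis using n that d by simp
  qed
  have sd: "s + d \<le> n" "t + d \<le> n" unfolding s_def t_def using le p ik by auto
  have "block_char b h N z 0 j\<^sub>1 y p (s + l) = block_char b h N z N j\<^sub>2 y p (t + l)" if "l < d" for l
    using block_char_window[of i N p 0 h a b l z j\<^sub>1 y] block_char_window[of k N p N h a b l z j\<^sub>2 y]
      ik p d that by (simp add: s_def t_def)
  then show "has_common_substring d (block_string n b h N z 0 j\<^sub>1 y p) (block_string n b h N z N j\<^sub>2 y p)"
    unfolding has_common_substring_iff block_string_def using sd by (intro exI[of _ s] exI[of _ t]) auto
qed


text \<open>The second string is blank; in the first one only the last \<open>d\<close> characters
  can form a blank window, and they do so iff the hidden symbol is \<open>z\<close> instead of
  \<open>u1\<close>. With too few queries \<open>J = 0\<close> is allowed, and the approximating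
  function would be constant.\<close>

lemma search_lower_bound:
  assumes valid: "valid_algorithm n m alg" and d: "1 \<le> d" "d \<le> n"
    and z: "z \<in> A" and u1: "u1 \<in> A" "u1 \<noteq> z" and A: "A \<subseteq> {..<2 ^ m}"
    and dec: "decides_common_substring n d m A alg"
  shows "402 * real (num_queries alg) > sqrt d"
proof (rule ccontr)
  assume "\<not> 402 * real (num_queries alg) > sqrt d"
  then have J: "real (Suc 0) \<ge> 402 * real (num_queries alg) / sqrt d"
    using d by (simp add: field_simps)
  define S\<^sub>1 where "S\<^sub>1 y p = map (\<lambda>k. if k < n - d then u1 else if k - (n - d) = p 0 then y 0 else z) [0..<n]"
    for y p :: "nat \<Rightarrow> nat"
  define S\<^sub>2 where "S\<^sub>2 y p = replicate n z" for y p :: "nat \<Rightarrow> nat"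
  define loc where "loc k = (if n - d \<le> k \<and> k < n then Some (0 :: nat, k - (n - d)) else None)" for k
  define base where "base k = (if k < n - d then u1 else z)" for k
  have sym: "z < 2 ^ m" "u1 < 2 ^ m" using z u1 A by auto
  have "\<exists>q :: (nat \<Rightarrow> nat) \<Rightarrow> unit \<Rightarrow> real. junta_sum {0} (2 * 0) q \<and>
    (\<forall>y. (\<forall>i\<in>{0}. y i < 2 ^ m) \<longrightarrow> 0 \<le> q y () \<and> q y () \<le> 21 / 20 \<and>
      ((\<forall>p \<in> (\<Pi>\<^sub>E i\<in>{0}. {..<d}). accept_prob n m alg (S\<^sub>1 y p) (S\<^sub>2 y p) \<ge> 2 / 3) \<longrightarrow> q y () \<ge> 37 / 60) \<and>
      ((\<forall>p \<in> (\<Pi>\<^sub>E i\<in>{0}. {..<d}). accept_prob n m alg (S\<^sub>1 y p) (S\<^sub>2 y p) \<le> 1 / 3) \<longrightarrow> q y () \<le> 23 / 60))"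
  proof (rule junta_approximation_of_algorithm[OF valid, where loc = loc and base = base])
    show "loc k = Some (i, r) \<Longrightarrow> i \<in> {0} \<and> r < d" for k i r
      using d by (auto simp: loc_def split: if_splits)
    show "(S\<^sub>1 y p @ S\<^sub>2 y p) ! k =
      (case loc k of None \<Rightarrow> base k | Some (i, r) \<Rightarrow> if p i = r then y i else base k)" if "k < 2 * n" for y p k
      using that d by (auto simp: S\<^sub>1_def S\<^sub>2_def loc_def base_def nth_append)
  qed (use d J sym in \<open>auto simp: S\<^sub>1_def S\<^sub>2_def base_def\<close>)
  then obtain q :: "(nat \<Rightarrow> nat) \<Rightarrow> unit \<Rightarrow> real" where q: "junta_sum {0} 0 q"
    and q_yes: "\<And>y. y 0 < 2 ^ m \<Longrightarrow> (\<And>p. p 0 < d \<Longrightarrow> accept_prob n m alg (S\<^sub>1 y p) (S\<^sub>2 y p) \<ge> 2 / 3) \<Longrightarrow> q y () \<ge> 37 / 60"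
    and q_no: "\<And>y. y 0 < 2 ^ m \<Longrightarrow> (\<And>p. p 0 < d \<Longrightarrow> accept_prob n m alg (S\<^sub>1 y p) (S\<^sub>2 y p) \<le> 1 / 3) \<Longrightarrow> q y () \<le> 23 / 60"
    by (auto simp: PiE_iff)
  have strings: "S\<^sub>1 y p \<in> strings n A" "S\<^sub>2 y p \<in> strings n A" if "y 0 \<in> A" for y p
    using that z u1 by (auto simp: strings_def S\<^sub>1_def S\<^sub>2_def)
  have acc: "(has_common_substring d (S\<^sub>1 y p) (S\<^sub>2 y p) \<longrightarrow> accept_prob n m alg (S\<^sub>1 y p) (S\<^sub>2 y p) \<ge> 2 / 3) \<and>
      (\<not> has_common_substring d (S\<^sub>1 y p) (S\<^sub>2 y p) \<longrightarrow> accept_prob n m alg (S\<^sub>1 y p) (S\<^sub>2 y p) \<le> 1 / 3)"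
    if "y 0 \<in> A" for y p
    using dec strings(1)[of y p, OF that] strings(2)[of y p, OF that] unfolding decides_common_substring_def by blast
  have "q (\<lambda>_. z) () \<ge> 37 / 60"
  proof (rule q_yes)
    fix p :: "nat \<Rightarrow> nat"
    have "has_common_substring d (S\<^sub>1 (\<lambda>_. z) p) (S\<^sub>2 (\<lambda>_. z) p)"
      unfolding has_common_substring_iff using d
      by (intro exI[of _ "n - d"] exI[of _ 0]) (auto simp: S\<^sub>1_def S\<^sub>2_def)
    then show "accept_prob n m alg (S\<^sub>1 (\<lambda>_. z) p) (S\<^sub>2 (\<lambda>_. z) p) \<ge> 2 / 3" using acc[of "\<lambda>_. z" p] z by blast
  qed (use sym in simp)
  moreover have "q (\<lambda>_. u1) () \<le> 23 / 60"
  proof (rule q_no)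
    fix p :: "nat \<Rightarrow> nat" assume p: "p 0 < d"
    have "\<not> has_common_substring d (S\<^sub>1 (\<lambda>_. u1) p) (S\<^sub>2 (\<lambda>_. u1) p)"
    proof
      assume "has_common_substring d (S\<^sub>1 (\<lambda>_. u1) p) (S\<^sub>2 (\<lambda>_. u1) p)"
      then obtain s t where st: "s + d \<le> n" "t + d \<le> n"
        and eq: "\<And>k. k < d \<Longrightarrow> S\<^sub>1 (\<lambda>_. u1) p ! (s + k) = z"
        by (auto simp: has_common_substring_iff S\<^sub>1_def S\<^sub>2_def)
      show False
      proof (cases "s < n - d")
        case True
        then show False using eq[of 0] d u1 by (simp add: S\<^sub>1_def)
      next
        case False
        then have "s = n - d" using st by simp
        then have "s + p 0 < n" "s + p 0 - (n - d) = p 0" "\<not> s + p 0 < n - d" using p d by auto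
        then show False using eq[OF p] u1 by (simp add: S\<^sub>1_def)
      qed
    qed
    then show "accept_prob n m alg (S\<^sub>1 (\<lambda>_. u1) p) (S\<^sub>2 (\<lambda>_. u1) p) \<le> 1 / 3" using acc[of "\<lambda>_. u1" p] u1 by blast
  qed (use sym in simp)
  ultimately show False using junta_sum_0_const[OF q, of "\<lambda>_. z" "\<lambda>_. u1"] by simp
qed

lemma block_lower_bound:
  assumes d: "1 \<le> d" and N: "N \<ge> 400" "d * (N + 1) \<le> n" and A: "A \<subseteq> {..<2 ^ m}" "2 * N + 3 \<le> card A"
    and dec: "decides_common_substring n d m A alg"
  shows "real (num_queries alg) \<ge> sqrt d * real N powr (2 / 3) / 1608000"
proof -
  define T where "T = num_queries alg"
  \<comment> \<open>A window consists of \<open>a\<close> blanks, the symbol and \<open>b\<close>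
    blanks. \<open>h\<close> is as large as the absence of blank windows permits and still at least
    \<open>d / 4\<close>, which costs the factor 2 in
    \<open>sqrt d / 2 \<le> sqrt h\<close>.\<close>
  define a where "a = (d - 1) div 2"
  define b where "b = d - 1 - a"
  define h where "h = a div 2 + 1"
  have ab: "a + b + 1 = d" "h \<le> a div 2 + 1" "a \<le> b" using d by (auto simp: a_def b_def h_def)
  have hpos: "h > 0" and hd: "d \<le> 4 * h" and bh: "b + h \<le> d" using d ab by (auto simp: a_def h_def)
  have "b + N * (b + h) \<le> d + N * d" using bh by (intro add_mono mult_left_mono) auto
  then have n: "b + N * (b + h) \<le> n" using N(2) by (simp add: algebra_simps)
  have finA: "finite A" using A finite_subset by blast
  obtain B where B: "B \<subseteq> A" "card B = 2 * N + 3" using obtain_subset_with_card_n[OF A(2)] by auto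
  then have "finite B" using finA finite_subset by blast
  then obtain e where e: "bij_betw e {..<2 * N + 3} B"
    using ex_bij_betw_nat_finite[of B] B(2) by (auto simp: lessThan_atLeast0)
  have e_in: "e k \<in> A" if "k < 2 * N + 3" for k using bij_betwE[OF e] that B(1) by blast
  have e_inj: "e k = e l \<longleftrightarrow> k = l" if "k < 2 * N + 3" "l < 2 * N + 3" for k l
    using bij_betw_imp_inj_on[OF e] that by (auto simp: inj_on_def)
  define z where "z = e (2 * N)"
  define j\<^sub>1 where "j\<^sub>1 = e (2 * N + 1)"
  define j\<^sub>2 where "j\<^sub>2 = e (2 * N + 2)"
  define S\<^sub>1 where "S\<^sub>1 = block_string n b h N z 0 j\<^sub>1"
  define S\<^sub>2 where "S\<^sub>2 = block_string n b h N z N j\<^sub>2"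
  define J where "J = nat \<lfloor>402 * real T / sqrt h\<rfloor>"
  have J: "real (Suc J) \<ge> 402 * real T / sqrt h" "real J \<le> 402 * real T / sqrt h"
  proof -
    show "real (Suc J) \<ge> 402 * real T / sqrt h" unfolding J_def by linarith
    show "real J \<le> 402 * real T / sqrt h" unfolding J_def by (rule of_nat_floor) simp
  qed
  define L where "L = b + h"
  define loc where "loc k = (let k' = (if k < n then k else k - n); off = (if k < n then 0 else N) in
    if k < 2 * n \<and> b \<le> k' \<and> (k' - b) div L < N \<and> (k' - b) mod L < h
    then Some (off + (k' - b) div L, (k' - b) mod L) else None)" for k
  define base where "base k = (let k' = (if k < n then k else k - n) in
    if b \<le> k' \<and> N \<le> (k' - b) div L then (if k < n then j\<^sub>1 else j\<^sub>2) else z)" for k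
  have syms: "z \<in> A" "j\<^sub>1 \<in> A" "j\<^sub>2 \<in> A" by (auto simp: z_def j\<^sub>1_def j\<^sub>2_def e_in)
  have "\<exists>q :: (nat \<Rightarrow> nat) \<Rightarrow> unit \<Rightarrow> real. junta_sum {..<2 * N} (2 * J) q \<and>
    (\<forall>y. (\<forall>i\<in>{..<2 * N}. y i < 2 ^ m) \<longrightarrow> 0 \<le> q y () \<and> q y () \<le> 21 / 20 \<and>
      ((\<forall>p \<in> (\<Pi>\<^sub>E i\<in>{..<2 * N}. {..<h}). accept_prob n m alg (S\<^sub>1 y p) (S\<^sub>2 y p) \<ge> 2 / 3) \<longrightarrow> q y () \<ge> 37 / 60) \<and>
      ((\<forall>p \<in> (\<Pi>\<^sub>E i\<in>{..<2 * N}. {..<h}). accept_prob n m alg (S\<^sub>1 y p) (S\<^sub>2 y p) \<le> 1 / 3) \<longrightarrow> q y () \<le> 23 / 60))"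
  proof (rule junta_approximation_of_algorithm[where loc = loc and base = base])
    show "valid_algorithm n m alg" using dec by (simp add: decides_common_substring_def)
    show "loc k = Some (i, r) \<Longrightarrow> i \<in> {..<2 * N} \<and> r < h" for k i r
      by (auto simp: loc_def Let_def split: if_splits)
    show "base k < 2 ^ m" for k using syms A(1) by (auto simp: base_def Let_def)
    show "real (Suc J) \<ge> 402 * real (num_queries alg) / sqrt h" using J(1) by (simp add: T_def)
    show "length (S\<^sub>1 y p) = n" "length (S\<^sub>2 y p) = n" for y p
      by (simp_all add: S\<^sub>1_def S\<^sub>2_def block_string_def)
    fix y p k assume p: "p \<in> (\<Pi>\<^sub>E i\<in>{..<2 * N}. {..<h})" and k: "k < 2 * n"
    have p_less: "p i < h" if "i < 2 * N" for i using p that by (auto simp: PiE_iff)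
    show "(S\<^sub>1 y p @ S\<^sub>2 y p) ! k =
      (case loc k of None \<Rightarrow> base k | Some (i, r) \<Rightarrow> if p i = r then y i else base k)"
    proof (cases "k < n")
      case True
      then have "(S\<^sub>1 y p @ S\<^sub>2 y p) ! k = block_char b h N z 0 j\<^sub>1 y p k"
        by (simp add: S\<^sub>1_def block_string_def nth_append)
      then show ?thesis using True p_less[of "(k - b) div L"]
        by (auto simp: block_char_def loc_def base_def Let_def simp flip: L_def)
    next
      case False
      then have "(S\<^sub>1 y p @ S\<^sub>2 y p) ! k = block_char b h N z N j\<^sub>2 y p (k - n)"
        using k by (simp add: S\<^sub>1_def S\<^sub>2_def block_string_def nth_append)
      then show ?thesis using False k p_less[of "N + (k - n - b) div L"]
        by (auto simp: block_char_def loc_def base_def Let_def simp flip: L_def)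
    qed
  qed (use hpos in auto)
  then obtain q :: "(nat \<Rightarrow> nat) \<Rightarrow> unit \<Rightarrow> real" where q: "junta_sum {..<2 * N} (2 * J) q"
    and qb: "\<And>y. (\<And>i. i < 2 * N \<Longrightarrow> y i < 2 ^ m) \<Longrightarrow> 0 \<le> q y () \<and> q y () \<le> 21 / 20 \<and>
      ((\<forall>p \<in> (\<Pi>\<^sub>E i\<in>{..<2 * N}. {..<h}). accept_prob n m alg (S\<^sub>1 y p) (S\<^sub>2 y p) \<ge> 2 / 3) \<longrightarrow> q y () \<ge> 37 / 60) \<and>
      ((\<forall>p \<in> (\<Pi>\<^sub>E i\<in>{..<2 * N}. {..<h}). accept_prob n m alg (S\<^sub>1 y p) (S\<^sub>2 y p) \<le> 1 / 3) \<longrightarrow> q y () \<le> 23 / 60)"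
    by (metis lessThan_iff)
  \<comment> \<open>The sampled value 0 becomes the junk symbol of the string that owns coordinate
    \<open>i\<close>. The values 1 to \<open>2 * N\<close> become \<open>e 0\<close> to
    \<open>e (2 * N - 1)\<close>; the last three symbols are the blank and the two kinds of
    junk.\<close>
  define g where "g i v = (if v = 0 then (if i < N then j\<^sub>1 else j\<^sub>2) else e (v - 1))" for i v :: nat
  define q' where "q' v = q (\<lambda>i. g i (v i))" for v
  have q': "junta_sum {..<2 * N} (2 * J) q'"
    unfolding q'_def by (rule junta_sum_coordinatewise[OF q])
  have main: "0 \<le> q' v () \<and> q' v () \<le> 21 / 20 \<and> (\<not> shares N (2 * N) v \<longrightarrow> q' v () \<le> 23 / 60) \<and>
      (shares N (2 * N) v \<longrightarrow> 37 / 60 \<le> q' v ())" if v: "\<And>i. i < 2 * N \<Longrightarrow> v i \<le> 2 * N" for v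
  proof -
    define y where "y i = g i (v i)" for i
    have y_in: "y i \<in> A" if "i < 2 * N" for i
      using v[OF that] syms by (auto simp: y_def g_def e_in)
    have y_nz: "y i \<noteq> z" if "i < 2 * N" for i
      using v[OF that] by (auto simp: y_def g_def z_def j\<^sub>1_def j\<^sub>2_def e_inj)
    have y_junk: "y i \<noteq> j\<^sub>2" "y (N + i) \<noteq> j\<^sub>1" if "i < N" for i
      using v[of i] v[of "N + i"] that by (auto simp: y_def g_def j\<^sub>1_def j\<^sub>2_def e_inj)
    have y_eq: "y i = y (N + k) \<longleftrightarrow> v i = v (N + k) \<and> v i \<noteq> 0" if "i < N" "k < N" for i k
      using v[of i] v[of "N + k"] that by (auto simp: y_def g_def j\<^sub>1_def j\<^sub>2_def e_inj)
    have "(\<exists>i<N. \<exists>k<N. y i = y (N + k)) \<longleftrightarrow> shares N (2 * N) v"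
    proof
      assume "\<exists>i<N. \<exists>k<N. y i = y (N + k)"
      then obtain i k where "i < N" "k < N" "v i = v (N + k)" "v i \<noteq> 0" using y_eq by blast
      then show "shares N (2 * N) v" unfolding shares_def by (intro exI[of _ i] conjI exI[of _ "N + k"]) auto
    next
      assume "shares N (2 * N) v"
      then obtain i j where ij: "i < N" "N \<le> j" "j < 2 * N" "v i = v j" "v i \<noteq> 0" by (auto simp: shares_def)
      then show "\<exists>i<N. \<exists>k<N. y i = y (N + k)"
        using y_eq[of i "j - N"] by (intro exI[of _ i] conjI exI[of _ "j - N"]) auto
    qed
    moreover have "has_common_substring d (S\<^sub>1 y p) (S\<^sub>2 y p) \<longleftrightarrow> (\<exists>i<N. \<exists>k<N. y i = y (N + k))"
      if "p \<in> (\<Pi>\<^sub>E i\<in>{..<2 * N}. {..<h})" for p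
      unfolding S\<^sub>1_def S\<^sub>2_def
    proof (rule has_common_substring_block_strings[OF ab _ n])
      show "p k < h" if "k < 2 * N" for k using \<open>p \<in> _\<close> that by (auto simp: PiE_iff)
    qed (use N y_nz y_junk in \<open>auto simp: z_def j\<^sub>1_def j\<^sub>2_def e_inj\<close>)
    moreover have "S\<^sub>1 y p \<in> strings n A \<and> S\<^sub>2 y p \<in> strings n A" for p
    proof -
      have "block_char b h N z off j y p k \<in> A" if "j \<in> A" "off \<in> {0, N}" for off j k
        using block_char_in[of b h N z off j y p k] that y_in syms by auto
      then show ?thesis using syms by (auto simp: strings_def S\<^sub>1_def S\<^sub>2_def block_string_def)
    qed
    ultimately have "shares N (2 * N) v \<longrightarrow> (\<forall>p \<in> (\<Pi>\<^sub>E i\<in>{..<2 * N}. {..<h}). accept_prob n m alg (S\<^sub>1 y p) (S\<^sub>2 y p) \<ge> 2 / 3)"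
      "\<not> shares N (2 * N) v \<longrightarrow> (\<forall>p \<in> (\<Pi>\<^sub>E i\<in>{..<2 * N}. {..<h}). accept_prob n m alg (S\<^sub>1 y p) (S\<^sub>2 y p) \<le> 1 / 3)"
      using dec unfolding decides_common_substring_def by blast+
    moreover have "q' v = q y" by (simp add: q'_def y_def[abs_def])
    moreover have "y i < 2 ^ m" if "i < 2 * N" for i using y_in[OF that] A(1) by auto
    ultimately show ?thesis using qb[of y] by simp
  qed
  have "real (2 * J) \<ge> real N powr (2 / 3) / 1000"
    using N(1) main by (intro collision_junta_degree[OF q']) blast+
  then have "real N powr (2 / 3) / 1000 \<le> 804 * real T / sqrt h" using J(2) by simp
  then have "sqrt h * real N powr (2 / 3) / 804000 \<le> real T"
    using hpos by (simp add: field_simps)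
  moreover have "sqrt d / 2 \<le> sqrt h"
  proof -
    have "sqrt d \<le> sqrt (4 * h)" using hd by (intro real_sqrt_le_mono) (metis of_nat_le_iff of_nat_mult of_nat_numeral)
    then show ?thesis by (simp add: real_sqrt_mult)
  qed
  then have "sqrt d / 2 * (real N powr (2 / 3) / 804000) \<le> sqrt h * (real N powr (2 / 3) / 804000)"
    by (intro mult_right_mono) auto
  ultimately show ?thesis by (simp add: T_def)
qed


theorem theorem1p2:
  fixes C :: real
  assumes "C > 0"
  shows "\<exists>c > (0::real). \<forall>(n::nat) (d::nat) (m::nat) (A::nat set) alg.
    1 \<le> d \<longrightarrow> d \<le> n \<longrightarrow>
    A \<subseteq> {..<2 ^ m} \<longrightarrow> 2 \<le> card A \<longrightarrow> real (card A) \<ge> C * (real n / real d) \<longrightarrow>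
    decides_common_substring n d m A alg \<longrightarrow>
    real (num_queries alg) \<ge> c * (real n powr (2 / 3) / real d powr (1 / 6))"
proof -
  \<comment> \<open>With \<open>N\<close> about \<open>c0 * n / d\<close> this gives
    \<open>8 * N \<le> card A\<close> and \<open>8 * N \<le> n / d\<close>, leaving room for three
    extra symbols and one extra block.\<close>
  define c0 where "c0 = min C 1 / 8"
  have c0: "c0 > 0" "8 * c0 \<le> C" "8 * c0 \<le> 1" using assms by (auto simp: c0_def)
  define c1 where "c1 = (c0 / 2) powr (2 / 3) / 1608000"
  define c2 where "c2 = (c0 / 400) powr (2 / 3) / 402"
  have c12: "c1 > 0" "c2 > 0" using c0 by (simp_all add: c1_def c2_def)
  show ?thesis
  proof (intro exI[of _ "min c1 c2"] conjI allI impI)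
    show "min c1 c2 > 0" using c12 by simp
    fix n d m :: nat and A :: "nat set" and alg
    assume d: "1 \<le> d" "d \<le> n" and A: "A \<subseteq> {..<2 ^ m}" "2 \<le> card A" "real (card A) \<ge> C * (real n / real d)"
      and dec: "decides_common_substring n d m A alg"
    define x where "x = real n / real d"
    have x: "x \<ge> 1" using d by (simp add: x_def)
    define T where "T = real (num_queries alg)"
    \<comment> \<open>Writing \<open>n = x * d\<close>, the power of \<open>d\<close> is 2 / 3 - 1 /
      6 = 1 / 2, the factor that search contributes in both cases.\<close>
    have R: "real n powr (2 / 3) / real d powr (1 / 6) = x powr (2 / 3) * sqrt d"
    proof -
      have "real d powr (2 / 3) = real d powr (1 / 6) * real d powr (1 / 2)" by (simp flip: powr_add)
      then show ?thesis using d by (simp add: x_def powr_divide powr_half_sqrt)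
    qed
    define N where "N = nat \<lfloor>c0 * x\<rfloor>"
    have "c0 * x \<ge> 0" using c0 x by simp
    then have N: "real N \<le> c0 * x" "c0 * x < real N + 1" unfolding N_def by linarith+
    have "min c1 c2 * (x powr (2 / 3) * sqrt d) \<le> T"
    proof (cases "N \<ge> 400")
      case True
      have "8 * real N \<le> 8 * c0 * x" using N(1) by simp
      moreover have "8 * c0 * x \<le> C * x" "8 * c0 * x \<le> 1 * x" using c0 x by (intro mult_right_mono; simp)+
      ultimately have N8: "8 * real N \<le> C * x" "8 * real N \<le> x" by linarith+
      have "real (d * (8 * N)) \<le> real n" using N8(2) d by (simp add: x_def field_simps)
      then have "d * (8 * N) \<le> n" unfolding of_nat_le_iff .
      moreover have "d * (N + 1) \<le> d * (8 * N)" using True by (intro mult_left_mono) auto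
      ultimately have dN: "d * (N + 1) \<le> n" by linarith
      have "real (8 * N) \<le> real (card A)" using N8(1) A(3) by (simp add: x_def)
      then have "8 * N \<le> card A" unfolding of_nat_le_iff .
      then have "2 * N + 3 \<le> card A" using True by linarith
      then have "sqrt d * real N powr (2 / 3) / 1608000 \<le> T"
        unfolding T_def using block_lower_bound[OF d(1) True dN A(1) _ dec] by blast
      moreover have "(c0 / 2) powr (2 / 3) * x powr (2 / 3) \<le> real N powr (2 / 3)"
      proof -
        have "c0 / 2 * x \<le> real N" using N(2) True by simp
        then have "(c0 / 2 * x) powr (2 / 3) \<le> real N powr (2 / 3)" using c0 x by (intro powr_mono2) auto
        moreover have "(c0 / 2 * x) powr (2 / 3) = (c0 / 2) powr (2 / 3) * x powr (2 / 3)"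
          by (rule powr_mult)
        ultimately show ?thesis by (simp only:)
      qed
      then have "sqrt d * ((c0 / 2) powr (2 / 3) * x powr (2 / 3)) \<le> sqrt d * real N powr (2 / 3)"
        by (intro mult_left_mono) auto
      ultimately have "c1 * (x powr (2 / 3) * sqrt d) \<le> T" by (simp add: c1_def mult_ac)
      moreover have "min c1 c2 * (x powr (2 / 3) * sqrt d) \<le> c1 * (x powr (2 / 3) * sqrt d)"
        by (intro mult_right_mono) auto
      ultimately show ?thesis by linarith
    next
      case False
      have "finite A" using A(1) finite_subset by blast
      then obtain z u where zu: "z \<in> A" "u \<in> A" "u \<noteq> z" using A(2) by (metis card_le_Suc0_iff_eq not_less_eq_eq numeral_2_eq_2)
      have "sqrt d < 402 * T" unfolding T_def
        using dec by (intro search_lower_bound[OF _ d zu(1) zu(2,3) A(1) dec]) (simp add: decides_common_substring_def)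
      moreover have "c0 / 400 * x \<le> 1" using N(2) False by simp
      then have "(c0 / 400 * x) powr (2 / 3) \<le> 1 powr (2 / 3)" using c0 x by (intro powr_mono2) auto
      then have "(c0 / 400) powr (2 / 3) * x powr (2 / 3) * sqrt d \<le> 1 * sqrt d"
        unfolding powr_mult by (intro mult_right_mono) simp_all
      ultimately have "c2 * (x powr (2 / 3) * sqrt d) \<le> T" by (simp add: c2_def mult_ac)
      moreover have "min c1 c2 * (x powr (2 / 3) * sqrt d) \<le> c2 * (x powr (2 / 3) * sqrt d)"
        by (intro mult_right_mono) auto
      ultimately show ?thesis by linarith
    qed
    then show "real (num_queries alg) \<ge> min c1 c2 * (real n powr (2 / 3) / real d powr (1 / 6))"
      unfolding R T_def .
  qed
qed

end
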